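(* Let $d\ge1$ and $1\le p<\frac{d}{d-1}$ (meaning $1\le p<\infty$ when $d=1$). Let $\gamma\in\mathbb{R}\setminus[-pd,0]$. There is a constant $C$ depending only on $d,p,\gamma$ such that for every convex domain $\Omega\subset\mathbb{R}^d$ with finite ball deviation $\mathrm{dev}(\Omega)$, every $f\in C^1(\Omega)$, every pair of weights $(u,w)\in A_p(\Omega)$ and every $\lambda>0$, $$\mu^u_\gamma\big(E_{\lambda,\gamma/p}(f)\big)\le C\,[u,w]_{A_p(\Omega)}\Big(\frac{\mathrm{dev}(\Omega)}{\lambda}\Big)^{p}\int_\Omega|\nabla f(y)|^p\,w(y)\,dy .$$
   Context: A domain is a nonempty open connected set. The ball deviation of $\Omega\subset\mathbb{R}^d$ is $$\mathrm{dev}(\Omega)=\sup_{x\in\Omega}\ \sup_{0<r\le\mathrm{diam}(\Omega)}\frac{|B(x,r)|}{|B(x,r)\cap\Omega|},$$ where $\mathrm{diam}(\Omega)=\sup_{x,y\in\Omega}|x-y|\in(0,\infty]$, $r$ is finite, $B(x,r)$ is the ball of center $x$ and radius $r$, and $|E|$ is Lebesgue measure. For $b\in\mathbb{R}$ and $x\ne y$ in $\Omega$ put $\mathfrak{D}_bf(x,y)=\frac{|f(y)-f(x)|}{|y-x|^{1+b}}$, and $\mathfrak{D}_bf(x,x)=0$. For $\lambda>0$, $E_{\lambda,b}(f)=\{(x,y)\in\Omega\times\Omega:\mathfrak{D}_bf(x,y)>\lambda\}$. For a nonnegative measurable function $u$ on $\Omega$, $\mu^u_\gamma$ is the measure on $\Omega\times\Omega$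 given by $d\mu^u_\gamma(x,y)=u(x)|y-x|^{\gamma-d}\,dx\,dy$. Weights $u,w$ are measurable functions on $\Omega$ with values in $[0,\infty)$. For $1<p<\infty$ and $p'=p/(p-1)$, $(u,w)\in A_p(\Omega)$ means $$[u,w]_{A_p(\Omega)}:=\sup_B\frac1{|B|}\int_{B\cap\Omega}u(x)\,dx\,\Big(\frac1{|B|}\int_{B\cap\Omega}w(y)^{-p'/p}\,dy\Big)^{p/p'}<\infty,$$ the supremum over all balls $B\subset\mathbb{R}^d$. For $p=1$, $(u,w)\in A_1(\Omega)$ means that there is a constant $K<\infty$ with $\frac1{|B|}\int_{B\cap\Omega}u(x)\,dx\le K\,\operatorname{ess\,inf}_{y\in B\cap\Omega}w(y)$ for every ball $B\subset\mathbb{R}^d$; $[u,w]_{A_1(\Omega)}$ is the infimum of all such $K$. The convention $0\cdot\infty=0$ is used. *)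

theory Defs
  imports "HOL-Analysis.Analysis"
begin

definition domain :: "'a::euclidean_space set \<Rightarrow> bool" where
  "domain \<Omega> \<longleftrightarrow> \<Omega> \<noteq> {} \<and> open \<Omega> \<and> connected \<Omega>"

text \<open>Real powers on \<open>[0,\<infinity>]\<close>, with \<open>0\<^sup>a = \<infinity>\<close> and \<open>\<infinity>\<^sup>a = 0\<close> for \<open>a < 0\<close>.\<close>

definition epowr :: "ennreal \<Rightarrow> real \<Rightarrow> ennreal" where
  "epowr x a =
     (if a = 0 then 1
      else if x = 0 then (if a < 0 then top else 0)
      else if x = top then (if a < 0 then 0 else top)
      else ennreal (enn2real x powr a))"

text \<open>Unlike \<^const>\<open>diameter\<close>, this takes the value \<open>\<infinity>\<close> on unbounded sets.\<close>

definition ediam :: "'a::euclidean_space set \<Rightarrow> ennreal" where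
  "ediam \<Omega> = (SUP x\<in>\<Omega>. SUP y\<in>\<Omega>. ennreal (norm (x - y)))"

definition ball_deviation :: "'a::euclidean_space set \<Rightarrow> ennreal" where
  "ball_deviation \<Omega> =
     (SUP x\<in>\<Omega>. SUP r\<in>{r::real. 0 < r \<and> ennreal r \<le> ediam \<Omega>}.
        emeasure lebesgue (ball x r) / emeasure lebesgue (ball x r \<inter> \<Omega>))"

definition gradient :: "('a::euclidean_space \<Rightarrow> real) \<Rightarrow> 'a \<Rightarrow> 'a" where
  "gradient f x = (THE D. GDERIV f x :> D)"

text \<open>Meant for open \<open>\<Omega>\<close>; values of \<open>f\<close> outside \<open>\<Omega>\<close> are then irrelevant.\<close>

definition C1_on :: "'a::euclidean_space set \<Rightarrow> ('a \<Rightarrow> real) \<Rightarrow> bool" where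
  "C1_on \<Omega> f \<longleftrightarrow> (\<forall>x\<in>\<Omega>. f differentiable (at x)) \<and> continuous_on \<Omega> (gradient f)"

definition diff_quot :: "real \<Rightarrow> ('a::euclidean_space \<Rightarrow> real) \<Rightarrow> 'a \<Rightarrow> 'a \<Rightarrow> real" where
  "diff_quot b f x y =
     (if x = y then 0 else \<bar>f y - f x\<bar> / norm (y - x) powr (1 + b))"

definition level_set ::
  "'a::euclidean_space set \<Rightarrow> real \<Rightarrow> real \<Rightarrow> ('a \<Rightarrow> real) \<Rightarrow> ('a \<times> 'a) set" where
  "level_set \<Omega> t b f = {(x, y) \<in> \<Omega> \<times> \<Omega>. diff_quot b f x y > t}"

text \<open>\<^const>\<open>lebesgue\<close> on pairs is the completion of the product Lebesgue measure. The value of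
  the density on the diagonal, which is a null set, does not matter.\<close>

definition mu ::
  "'a::euclidean_space set \<Rightarrow> ('a \<Rightarrow> real) \<Rightarrow> real \<Rightarrow> ('a \<times> 'a) measure" where
  "mu \<Omega> u \<gamma> =
     density (lebesgue_on (\<Omega> \<times> \<Omega>))
       (\<lambda>(x, y). ennreal (u x * norm (y - x) powr (\<gamma> - real DIM('a))))"

definition weight :: "'a::euclidean_space set \<Rightarrow> ('a \<Rightarrow> real) \<Rightarrow> bool" where
  "weight \<Omega> w \<longleftrightarrow> w \<in> borel_measurable (lebesgue_on \<Omega>) \<and> (\<forall>x\<in>\<Omega>. 0 \<le> w x)"

definition ball_avg ::
  "'a::euclidean_space set \<Rightarrow> 'a \<Rightarrow> real \<Rightarrow> ('a \<Rightarrow> ennreal) \<Rightarrow> ennreal" where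
  "ball_avg \<Omega> z r g =
     (\<integral>\<^sup>+ x. g x \<partial>lebesgue_on (ball z r \<inter> \<Omega>)) / emeasure lebesgue (ball z r)"

text \<open>The essential infimum over a null set is \<open>\<infinity>\<close>.\<close>

definition ess_inf_on :: "'a::euclidean_space set \<Rightarrow> ('a \<Rightarrow> real) \<Rightarrow> ennreal" where
  "ess_inf_on S w = Sup {c. AE y in lebesgue_on S. c \<le> ennreal (w y)}"

definition A1_bound ::
  "'a::euclidean_space set \<Rightarrow> ('a \<Rightarrow> real) \<Rightarrow> ('a \<Rightarrow> real) \<Rightarrow> ennreal \<Rightarrow> bool" where
  "A1_bound \<Omega> u w K \<longleftrightarrow>
     (\<forall>z r. 0 < r \<longrightarrow>
        ball_avg \<Omega> z r (\<lambda>x. ennreal (u x)) \<le> K * ess_inf_on (ball z r \<inter> \<Omega>) w)"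

definition conj_exp :: "real \<Rightarrow> real" where
  "conj_exp p = p / (p - 1)"

definition Ap_const ::
  "real \<Rightarrow> 'a::euclidean_space set \<Rightarrow> ('a \<Rightarrow> real) \<Rightarrow> ('a \<Rightarrow> real) \<Rightarrow> ennreal" where
  "Ap_const p \<Omega> u w =
     (if p = 1 then Inf {K. K < top \<and> A1_bound \<Omega> u w K}
      else (SUP z. SUP r\<in>{0<..}.
              ball_avg \<Omega> z r (\<lambda>x. ennreal (u x)) *
              epowr (ball_avg \<Omega> z r (\<lambda>y. epowr (ennreal (w y)) (- (conj_exp p / p))))
                (p / conj_exp p)))"

definition Ap_pair ::
  "real \<Rightarrow> 'a::euclidean_space set \<Rightarrow> ('a \<Rightarrow> real) \<Rightarrow> ('a \<Rightarrow> real) \<Rightarrow> bool" where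
  "Ap_pair p \<Omega> u w \<longleftrightarrow>
     weight \<Omega> u \<and> weight \<Omega> w \<and>
     (if p = 1 then \<exists>K<top. A1_bound \<Omega> u w K else Ap_const p \<Omega> u w < top)"

end

theory Submission
  imports Defs
begin

text \<open>
  For \<open>x, y \<in> \<Omega>\<close> at distance \<open>r\<close>, integrating \<open>\<nabla>f\<close> over the segments from \<open>x\<close> and from \<open>y\<close> to the points of
  \<open>B(x,r) \<inter> \<Omega>\<close> bounds \<open>|f(x) - f(y)|\<close> by \<open>dev(\<Omega>)\<close> times
  \<open>\<Sum>\<^sub>j (2\<^bsup>-j\<^esup> r)\<^bsup>1-d\<^esup> \<integral> |\<nabla>f|\<close> over the balls of radius \<open>2\<^bsup>1-j\<^esup> r\<close> around \<open>x\<close> and \<open>y\<close>. Hence, if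
  \<open>(x,y)\<close> lies in the level set, then for some \<open>j\<close> one of the two points is close to a dyadic cube \<open>Q\<close> of side
  \<open>2\<^sup>k\<close>, about \<open>2\<^bsup>-j\<^esup> r\<close>, with \<open>\<integral>\<^sub>Q |\<nabla>f| \<ge> s\<^sub>j 2\<^bsup>k\<theta>/p\<^esup>\<close>, where \<open>\<theta> = pd + \<gamma>\<close>.
  By the two-weight condition the pairs belonging to \<open>Q\<close> and \<open>j\<close> have \<open>\<mu>\<close>-measure at most a constant times
  \<open>[u,w] 2\<^bsup>j(\<theta>-d)\<^esup> 2\<^bsup>k\<theta>\<^esup> v(Q)\<close>, where \<open>v(Q) = (\<integral>\<^sub>Q w\<^bsup>-1/(p-1)\<^esup>)\<^bsup>1-p\<^esup>\<close>, or the essential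
  infimum of \<open>w\<close> on \<open>Q\<close> if \<open>p = 1\<close>.

  It remains to see that the sum of \<open>2\<^bsup>k\<theta>\<^esup> v(Q)\<close> over all such cubes is at most a constant times
  \<open>s\<^sub>j\<^bsup>-p\<^esup> \<integral> |\<nabla>f|\<^sup>p w\<close>. For \<open>\<theta> < 0\<close> the sum is dominated by the minimal
  cubes, which are disjoint. For \<open>\<theta> > pd\<close> one groups the cubes by the dyadic size of
  \<open>2\<^bsup>k\<theta>/p\<^esup> / \<integral>\<^sub>Q w\<^bsup>-1/(p-1)\<^esup>\<close> (of \<open>v(Q)\<close> if \<open>p = 1\<close>); each group is dominated by its maximal cubes, and
  truncating \<open>|\<nabla>f|\<close> at the level of the group makes the groups summable. The final sum over \<open>j\<close> is a
  geometric series because \<open>p(d - 1) < d\<close>.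
\<close>



subsection \<open>Dyadic cubes\<close>

text \<open>The half-open dyadic cube of side 2^k that contains z. Naming a cube by any of its
  points makes membership an equality of integer coordinates.\<close>

definition cell :: "int \<Rightarrow> 'a::euclidean_space \<Rightarrow> 'a set" where
  "cell k z = {y. \<forall>b\<in>Basis. \<lfloor>(y \<bullet> b) / 2 powr k\<rfloor> = \<lfloor>(z \<bullet> b) / 2 powr k\<rfloor>}"

lemma cell_self [simp]: "z \<in> cell k z"
  by (simp add: cell_def)

lemma cell_eq: "y \<in> cell k z \<Longrightarrow> cell k y = cell k z"
  by (simp add: cell_def)

lemma cell_disjoint: "cell k y \<noteq> cell k z \<Longrightarrow> cell k y \<inter> cell k z = {}"
  using cell_eq by (metis disjoint_iff)

text \<open>Dividing by an integer power of 2 commutes with taking the floor up to integer division,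
  so the coordinates of a cube at level k determine those of its ancestor at level l.\<close>

lemma cell_mono:
  assumes "k \<le> l"
  shows "cell k z \<subseteq> cell l z"
proof -
  define m where "m = nat (l - k)"
  have l: "2 powr l = 2 powr k * real_of_int (2 ^ m)"
    using assms by (simp add: m_def powr_realpow [symmetric] powr_add [symmetric])
  have "\<lfloor>t / 2 powr l\<rfloor> = \<lfloor>t / 2 powr k\<rfloor> div 2 ^ m" for t :: real
    unfolding l divide_divide_eq_left [symmetric] by (rule floor_divide_real_eq_div) simp
  then show ?thesis
    by (auto simp: cell_def)
qed

lemma cell_iff:
  "y \<in> cell k z \<longleftrightarrow>
    (\<forall>b\<in>Basis. of_int \<lfloor>(z \<bullet> b) / 2 powr k\<rfloor> * 2 powr k \<le> y \<bullet> b \<and>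
       y \<bullet> b < (of_int \<lfloor>(z \<bullet> b) / 2 powr k\<rfloor> + 1) * 2 powr k)"
  by (simp add: cell_def floor_eq_iff pos_le_divide_eq pos_divide_less_eq)

lemma cell_borel [measurable, simp]: "cell k z \<in> sets borel"
proof -
  have "cell k z = (\<Inter>b\<in>Basis. {y. \<lfloor>(y \<bullet> b) / 2 powr k\<rfloor> = \<lfloor>(z \<bullet> b) / 2 powr k\<rfloor>})"
    by (auto simp: cell_def)
  also have "\<dots> \<in> sets borel"
    by (intro sets.finite_INT) auto
  finally show ?thesis .
qed

text \<open>The half-open cube lies between the open and the closed box with the same corners, and
  these two have equal volume.\<close>

lemma emeasure_cell:
  "emeasure lborel (cell k (z::'a::euclidean_space)) = ennreal (2 powr (real_of_int k * DIM('a)))"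
proof -
  define l where "l = (\<Sum>b\<in>Basis. (of_int \<lfloor>(z \<bullet> b) / 2 powr k\<rfloor> * 2 powr k) *\<^sub>R b)"
  define h where "h = (\<Sum>b\<in>Basis. ((of_int \<lfloor>(z \<bullet> b) / 2 powr k\<rfloor> + 1) * 2 powr k) *\<^sub>R b)"
  have l: "l \<bullet> b = of_int \<lfloor>(z \<bullet> b) / 2 powr k\<rfloor> * 2 powr k"
    and h: "h \<bullet> b = (of_int \<lfloor>(z \<bullet> b) / 2 powr k\<rfloor> + 1) * 2 powr k" if "b \<in> Basis" for b
    using that by (auto simp: l_def h_def)
  have d: "(h - l) \<bullet> b = 2 powr k" if "b \<in> Basis" for b
    using that by (simp add: inner_diff_left l h algebra_simps)
  have le: "l \<bullet> b \<le> h \<bullet> b" if "b \<in> Basis" for b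
    using d[OF that] by (simp add: inner_diff_left) (smt (verit) powr_ge_zero)
  have "box l h \<subseteq> cell k z" "cell k z \<subseteq> cbox l h"
    by (auto simp: cell_iff mem_box l h less_imp_le)
  then have "emeasure lborel (box l h) \<le> emeasure lborel (cell k z)"
    "emeasure lborel (cell k z) \<le> emeasure lborel (cbox l h)"
    by (auto intro!: emeasure_mono)
  moreover have "(\<Prod>b\<in>(Basis::'a set). (h - l) \<bullet> b) = 2 powr (real_of_int k * DIM('a))"
    by (simp add: d prod_constant powr_powr [symmetric] powr_realpow)
  ultimately show ?thesis
    using le by (auto simp: emeasure_lborel_box_eq emeasure_lborel_cbox_eq intro: antisym)
qed

text \<open>Each coordinate of y - z is at most the side, so the sum of coordinates gives d times
  the side; the extra 1 makes the inequality strict, as the open ball requires.\<close>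

lemma cell_subset_ball: "cell k z \<subseteq> ball (z::'a::euclidean_space) ((real DIM('a) + 1) * 2 powr k)"
proof
  fix y assume y: "y \<in> cell k z"
  have "\<bar>(y - z) \<bullet> b\<bar> \<le> 2 powr k" if "b \<in> Basis" for b
  proof -
    have "y \<in> cell k z" "z \<in> cell k z" using y by auto
    then show ?thesis
      using that unfolding cell_iff by (force simp: inner_diff_left algebra_simps abs_le_iff)
  qed
  then have "norm (y - z) \<le> (\<Sum>b\<in>(Basis::'a set). 2 powr k)"
    by (intro order_trans[OF norm_le_l1] sum_mono) auto
  also have "\<dots> < (real DIM('a) + 1) * 2 powr k"
    by (simp add: algebra_simps)
  finally show "y \<in> ball z ((real DIM('a) + 1) * 2 powr k)"
    by (simp add: dist_norm norm_minus_commute)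
qed

lemma countable_cells: "countable (range (cell k :: 'a::euclidean_space \<Rightarrow> 'a set))"
proof -
  let ?F = "\<lambda>n::'a \<Rightarrow> int. {y::'a. \<forall>b\<in>Basis. \<lfloor>(y \<bullet> b) / 2 powr k\<rfloor> = n b}"
  have "range (cell k) \<subseteq> ?F ` (Basis \<rightarrow>\<^sub>E UNIV)"
  proof
    fix Q :: "'a set" assume "Q \<in> range (cell k)"
    then obtain z where z: "Q = cell k z" by auto
    show "Q \<in> ?F ` (Basis \<rightarrow>\<^sub>E UNIV)"
      by (rule image_eqI[where x = "restrict (\<lambda>b. \<lfloor>(z \<bullet> b) / 2 powr k\<rfloor>) Basis"])
        (auto simp: z cell_def)
  qed
  moreover have "countable (?F ` (Basis \<rightarrow>\<^sub>E UNIV))"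
    by (intro countable_image countable_PiE) auto
  ultimately show ?thesis
    by (rule countable_subset)
qed

text \<open>The cubes of side \<open>2\<^sup>k\<close> that meet the ball of radius \<open>2 \<cdot> 2\<^sup>k\<close> around \<open>x\<close> are among the
  cubes of the points \<open>x + 2\<^sup>k v\<close> with \<open>v\<close> in the following fixed finite set.\<close>

definition offsets :: "'a::euclidean_space set" where
  "offsets = (\<lambda>n::'a \<Rightarrow> int. \<Sum>b\<in>Basis. of_int (n b) *\<^sub>R b) ` (Basis \<rightarrow>\<^sub>E {-2..2})"

lemma finite_offsets: "finite offsets"
  unfolding offsets_def by (intro finite_imageI finite_PiE) auto

lemma offsets_bound:
  assumes "v \<in> offsets" shows "norm (v::'a::euclidean_space) \<le> 2 * real DIM('a)"
proof -
  obtain n where n: "n \<in> Basis \<rightarrow>\<^sub>E {-2..2::int}" and v: "v = (\<Sum>b\<in>Basis. of_int (n b) *\<^sub>R b)"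
    using assms by (auto simp: offsets_def)
  have "\<bar>v \<bullet> b\<bar> \<le> 2" if "b \<in> Basis" for b
  proof -
    have "n b \<in> {-2..2}" using n that by blast
    moreover have "v \<bullet> b = of_int (n b)" using that by (simp add: v)
    ultimately show ?thesis by auto
  qed
  then have "norm v \<le> (\<Sum>b\<in>(Basis::'a set). 2)"
    by (intro order_trans[OF norm_le_l1] sum_mono) auto
  then show ?thesis by simp
qed

text \<open>In units of 2^k the coordinates of x and y differ by less than 2, so their floors differ
  by an integer in {-2..2}. Shifting x by these integers moves its floors exactly onto those of
  y.\<close>

lemma ball_subset_offset_cells:
  "ball (x::'a::euclidean_space) (2 * 2 powr k) \<subseteq> (\<Union>v\<in>offsets. cell k (x + 2 powr k *\<^sub>R v))"
proof
  fix y assume y: "y \<in> ball x (2 * 2 powr k)"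
  define n where "n = restrict (\<lambda>b. \<lfloor>(y \<bullet> b) / 2 powr k\<rfloor> - \<lfloor>(x \<bullet> b) / 2 powr k\<rfloor>) (Basis::'a set)"
  define v where "v = (\<Sum>b\<in>(Basis::'a set). of_int (n b) *\<^sub>R b)"
  have "n b \<in> {-2..2}" if b: "b \<in> Basis" for b
  proof -
    have "\<bar>(y - x) \<bullet> b\<bar> \<le> norm (y - x)" using b by (rule Basis_le_norm)
    also have "\<dots> < 2 * 2 powr k" using y by (simp add: dist_norm norm_minus_commute)
    finally have "\<bar>(y - x) \<bullet> b / 2 powr k\<bar> < 2"
      by (simp add: abs_div_pos [symmetric] pos_divide_less_eq abs_divide)
    then have "\<bar>(y \<bullet> b) / 2 powr k - (x \<bullet> b) / 2 powr k\<bar> < 2"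
      by (simp add: inner_diff_left diff_divide_distrib)
    then show ?thesis
      using b unfolding n_def restrict_apply' [OF b] by (auto, linarith+)
  qed
  then have "n \<in> Basis \<rightarrow>\<^sub>E {-2..2}"
    by (auto simp: n_def)
  then have v: "v \<in> offsets"
    by (auto simp: offsets_def v_def)
  have "y \<in> cell k (x + 2 powr k *\<^sub>R v)"
  proof -
    have "((x + 2 powr k *\<^sub>R v) \<bullet> b) / 2 powr k = (x \<bullet> b) / 2 powr k + of_int (n b)" if "b \<in> Basis" for b
      using that by (simp add: v_def inner_add_left add_divide_distrib)
    then show ?thesis
      by (simp add: cell_def n_def)
  qed
  with v show "y \<in> (\<Union>v\<in>offsets. cell k (x + 2 powr k *\<^sub>R v))" by blast
qed

text \<open>The level is stored with the set, so that sums over cubes can read off the side without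
  recovering it from Q.\<close>

definition cubes :: "(int \<times> 'a::euclidean_space set) set" where
  "cubes = (SIGMA k:UNIV. range (cell k))"

lemma countable_cubes: "countable cubes"
  unfolding cubes_def by (intro countable_SIGMA countable_cells) auto

lemma cubes_iff: "(k, Q) \<in> cubes \<longleftrightarrow> (\<exists>z. Q = cell k z)"
  by (auto simp: cubes_def)

lemma cubes_borel: "(k, Q) \<in> cubes \<Longrightarrow> Q \<in> sets borel"
  by (auto simp: cubes_iff)

lemma cubes_eq_cell: "(k, Q) \<in> cubes \<Longrightarrow> z \<in> Q \<Longrightarrow> Q = cell k z"
  by (auto simp: cubes_iff dest: cell_eq)

lemma cubes_nested:
  assumes "(k, Q) \<in> cubes" "(l, R) \<in> cubes" "k \<le> l" "Q \<inter> R \<noteq> {}"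
  shows "Q \<subseteq> R"
proof -
  obtain z where "z \<in> Q" "z \<in> R" using assms by blast
  then show ?thesis
    using assms cell_mono[of k l z] cubes_eq_cell by metis
qed


lemma cubes_nonempty: "(k, Q) \<in> cubes \<Longrightarrow> Q \<noteq> {}"
  using cell_self unfolding cubes_iff by blast

subsection \<open>Sums over finite families of dyadic cubes\<close>

text \<open>Indexed by the distance N - n, the terms form part of a geometric series with ratio
  2^(-a) that starts at the top term.\<close>

lemma sum_powr_le:
  fixes a :: real
  assumes "finite F" "0 < a" "\<And>n. n \<in> F \<Longrightarrow> n \<le> N"
  shows "(\<Sum>n\<in>F. 2 powr (real_of_int n * a)) \<le> 2 powr (real_of_int N * a) / (1 - 2 powr - a)"
proof -
  define q where "q = 2 powr - a"
  have q: "0 < q" "q < 1" using assms(2) by (auto simp: q_def powr_less_one)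
  have "(\<Sum>n\<in>F. 2 powr (real_of_int n * a)) = (\<Sum>n\<in>F. 2 powr (real_of_int N * a) * q ^ nat (N - n))"
  proof (intro sum.cong refl)
    fix n assume "n \<in> F"
    then have "n \<le> N" by (rule assms)
    then have "q ^ nat (N - n) = 2 powr (- a * (N - n))"
      using q by (simp add: q_def powr_realpow [symmetric] powr_powr)
    then show "2 powr (real_of_int n * a) = 2 powr (real_of_int N * a) * q ^ nat (N - n)"
      by (simp add: powr_add [symmetric] algebra_simps)
  qed
  also have "\<dots> = 2 powr (real_of_int N * a) * (\<Sum>i\<in>(\<lambda>n. nat (N - n)) ` F. q ^ i)"
  proof -
    have "inj_on (\<lambda>n. nat (N - n)) F"
    proof (rule inj_onI)
      fix m n assume "m \<in> F" "n \<in> F" "nat (N - m) = nat (N - n)"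
      then show "m = n" using assms(3)[of m] assms(3)[of n] by linarith
    qed
    then show ?thesis by (simp add: sum.reindex sum_distrib_left)
  qed
  also have "\<dots> \<le> 2 powr (real_of_int N * a) * (\<Sum>i. q ^ i)"
    using q assms(1) by (intro mult_left_mono sum_le_suminf summable_geometric) auto
  also have "\<dots> = 2 powr (real_of_int N * a) / (1 - 2 powr - a)"
    using q by (simp add: suminf_geometric q_def)
  finally show ?thesis .
qed

text \<open>On a fixed level k the cubes are disjoint subsets of R, so their number times 2^(kd) is
  at most 2^(ld). The remaining factor 2^(k(\<eta>-d)) has a positive exponent per level and is
  summed geometrically over k \<le> l.\<close>

lemma sum_cubes_in_cube_le:
  fixes F :: "(int \<times> 'a::euclidean_space set) set"
  assumes "finite F" "F \<subseteq> cubes" "(l, R) \<in> cubes" and \<eta>: "real DIM('a) < \<eta>"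
    and sub: "\<And>k Q. (k, Q) \<in> F \<Longrightarrow> k \<le> l \<and> Q \<subseteq> R"
  shows "(\<Sum>(k, Q)\<in>F. 2 powr (real_of_int k * \<eta>))
    \<le> 2 powr (real_of_int l * \<eta>) / (1 - 2 powr - (\<eta> - real DIM('a)))"
proof -
  let ?d = "real DIM('a)"
  have vol: "emeasure lborel Q = ennreal (2 powr (real_of_int k * ?d))" if "(k, Q) \<in> cubes" for k and Q :: "'a set"
    using that by (auto simp: cubes_iff emeasure_cell)
  have level: "(\<Sum>q\<in>{q\<in>F. fst q = k}. 2 powr (real_of_int k * ?d)) \<le> 2 powr (real_of_int l * ?d)" for k
  proof -
    let ?S = "{q\<in>F. fst q = k}"
    have "(\<Sum>q\<in>?S. ennreal (2 powr (real_of_int k * ?d))) = (\<Sum>q\<in>?S. emeasure lborel (snd q))"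
      using assms(2) by (intro sum.cong) (auto simp: vol)
    also have "\<dots> = emeasure lborel (\<Union>q\<in>?S. snd q)"
    proof (rule sum_emeasure)
      show "snd ` ?S \<subseteq> sets lborel"
        using assms(2) by (auto dest!: cubes_borel)
      show "disjoint_family_on snd ?S"
        unfolding disjoint_family_on_def
      proof (intro ballI impI)
        fix p q assume *: "p \<in> ?S" "q \<in> ?S" "p \<noteq> q"
        then have "p = (k, snd p)" "q = (k, snd q)" by (auto simp: prod_eq_iff)
        with * have "(k, snd p) \<in> cubes" "(k, snd q) \<in> cubes" "snd p \<noteq> snd q"
          using assms(2) by (metis (no_types, lifting) mem_Collect_eq subsetD)+
        then show "snd p \<inter> snd q = {}"
          unfolding cubes_iff by (metis cell_disjoint)
      qed
    qed (use assms in simp)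
    also have "\<dots> \<le> emeasure lborel R"
      using sub[of k] cubes_borel[OF assms(3)] by (intro emeasure_mono UN_least) (auto simp: prod_eq_iff subset_iff)
    also have "\<dots> = ennreal (2 powr (real_of_int l * ?d))"
      by (rule vol) fact
    finally show ?thesis
      by (subst (asm) sum_ennreal) (auto simp del: sum_constant)
  qed
  have "(\<Sum>(k, Q)\<in>F. 2 powr (real_of_int k * \<eta>)) = (\<Sum>k\<in>fst ` F. \<Sum>q\<in>{q\<in>F. fst q = k}. 2 powr (real_of_int (fst q) * \<eta>))"
    using assms(1) by (subst sum.group) (auto simp: case_prod_beta)
  also have "\<dots> = (\<Sum>k\<in>fst ` F. 2 powr (real_of_int k * (\<eta> - ?d)) * (\<Sum>q\<in>{q\<in>F. fst q = k}. 2 powr (real_of_int k * ?d)))"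
    by (intro sum.cong refl) (auto simp: sum_distrib_left powr_add [symmetric] algebra_simps simp del: sum_constant intro!: sum.cong)
  also have "\<dots> \<le> (\<Sum>k\<in>fst ` F. 2 powr (real_of_int k * (\<eta> - ?d)) * 2 powr (real_of_int l * ?d))"
    by (intro sum_mono mult_left_mono level) auto
  also have "\<dots> = (\<Sum>k\<in>fst ` F. 2 powr (real_of_int k * (\<eta> - ?d))) * 2 powr (real_of_int l * ?d)"
    by (simp add: sum_distrib_right)
  also have "\<dots> \<le> 2 powr (real_of_int l * (\<eta> - ?d)) / (1 - 2 powr - (\<eta> - ?d)) * 2 powr (real_of_int l * ?d)"
    using assms by (intro mult_right_mono sum_powr_le) auto
  also have "\<dots> = 2 powr (real_of_int l * \<eta>) / (1 - 2 powr - (\<eta> - ?d))"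
    by (simp add: powr_add [symmetric] algebra_simps)
  finally show ?thesis .
qed

section \<open>Extremal cubes and packing estimates\<close>

text \<open>Take a member of largest level among those containing \<open>q\<close>. Whatever
  contains it also contains \<open>q\<close>, so it competed for the same maximum.\<close>

lemma ex_maximal_cube:
  assumes "finite F" "q \<in> (F :: (int \<times> 'a set) set)"
  obtains m where "m \<in> F" "fst q \<le> fst m" "snd q \<subseteq> snd m" "\<And>r. r \<in> F \<Longrightarrow> snd m \<subseteq> snd r \<Longrightarrow> fst r \<le> fst m"
proof -
  let ?S = "{r\<in>F. snd q \<subseteq> snd r}"
  have S: "finite ?S" "q \<in> ?S" using assms by auto
  then obtain m where "m \<in> ?S" and m: "fst m = Max (fst ` ?S)"
    using Max_in[of "fst ` ?S"] by (metis (no_types, lifting) empty_iff finite_imageI imageE image_is_empty)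
  moreover have "fst r \<le> fst m" if "r \<in> ?S" for r
    unfolding m using S that by (intro Max_ge) auto
  ultimately show ?thesis
    using S(2) by (intro that[of m]) auto
qed

lemma ex_minimal_cube:
  assumes "finite F" "q \<in> (F :: (int \<times> 'a set) set)"
  obtains m where "m \<in> F" "fst m \<le> fst q" "snd m \<subseteq> snd q" "\<And>r. r \<in> F \<Longrightarrow> snd r \<subseteq> snd m \<Longrightarrow> fst m \<le> fst r"
proof -
  let ?S = "{r\<in>F. snd r \<subseteq> snd q}"
  have S: "finite ?S" "q \<in> ?S" using assms by auto
  then obtain m where "m \<in> ?S" and m: "fst m = Min (fst ` ?S)"
    by (metis (no_types, lifting) Min_in empty_iff finite_imageI imageE image_is_empty)
  moreover have "fst m \<le> fst r" if "r \<in> ?S" for r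
    unfolding m using S that by (intro Min_le) auto
  ultimately show ?thesis
    using S(2) by (intro that[of m]) auto
qed

lemma cubes_eqI:
  assumes "(k, Q) \<in> cubes" "(k, R) \<in> cubes" "Q \<inter> R \<noteq> {}"
  shows "Q = R"
  using assms cubes_nested[of k Q k R] cubes_nested[of k R k Q] by auto

text \<open>Two dyadic cubes that meet are nested. Under \<open>anti\<close> nested members have the
  same level, hence coincide, so distinct members are disjoint and their measures add up.\<close>

lemma sum_emeasure_antichain_le:
  fixes M :: "(int \<times> 'a::euclidean_space set) set"
  assumes "finite M" "M \<subseteq> cubes" "\<And>q. q \<in> M \<Longrightarrow> snd q \<in> sets \<mu>"
    and anti: "\<And>q r. q \<in> M \<Longrightarrow> r \<in> M \<Longrightarrow> snd q \<subseteq> snd r \<Longrightarrow> fst q = fst r"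
  shows "(\<Sum>q\<in>M. emeasure \<mu> (snd q)) \<le> emeasure \<mu> (space \<mu>)"
proof -
  have *: "snd q \<inter> snd r = {}" if "q \<in> M" "r \<in> M" "q \<noteq> r" "fst q \<le> fst r" for q r
  proof (rule ccontr)
    assume n: "snd q \<inter> snd r \<noteq> {}"
    then have "snd q \<subseteq> snd r"
      using cubes_nested[of "fst q" "snd q" "fst r" "snd r"] that assms(2) by auto
    moreover from this have "fst q = fst r" using anti that by blast
    moreover have "(fst q, snd q) \<in> cubes" "(fst r, snd r) \<in> cubes"
      using that assms(2) by auto
    ultimately have "snd q = snd r"
      using cubes_eqI[of "fst q" "snd q" "snd r"] n by simp
    with \<open>fst q = fst r\<close> that show False by (simp add: prod_eq_iff)
  qed
  have "disjoint_family_on snd M"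
    unfolding disjoint_family_on_def using * by (metis Int_commute linorder_le_cases)
  then have "(\<Sum>q\<in>M. emeasure \<mu> (snd q)) = emeasure \<mu> (\<Union>q\<in>M. snd q)"
    using assms by (intro sum_emeasure) auto
  also have "\<dots> \<le> emeasure \<mu> (space \<mu>)"
    by (rule emeasure_space)
  finally show ?thesis .
qed

text \<open>Each cube is charged to a maximal one. Since \<eta> exceeds the dimension, all cubes
  below a maximal cube together cost only a constant times its own term, which \<open>low\<close>
  bounds by its measure; the maximal cubes are disjoint.\<close>

lemma cube_packing:
  fixes F :: "(int \<times> 'a::euclidean_space set) set"
  assumes "finite F" "F \<subseteq> cubes" and \<eta>: "real DIM('a) < \<eta>"
    and "\<And>q. q \<in> F \<Longrightarrow> snd q \<in> sets \<mu>"
    and low: "\<And>k Q. (k, Q) \<in> F \<Longrightarrow> ennreal (2 powr (real_of_int k * \<eta>)) \<le> emeasure \<mu> Q"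
  shows "(\<Sum>(k, Q)\<in>F. ennreal (2 powr (real_of_int k * \<eta>)))
    \<le> ennreal (1 / (1 - 2 powr - (\<eta> - real DIM('a)))) * emeasure \<mu> (space \<mu>)"
proof -
  define c where "c = 1 / (1 - 2 powr - (\<eta> - real DIM('a)))"
  have c: "0 \<le> c" using \<eta> powr_less_one[of 2 "- (\<eta> - real DIM('a))"] by (simp add: c_def)
  define M where "M = {m\<in>F. \<forall>r\<in>F. snd m \<subseteq> snd r \<longrightarrow> fst r \<le> fst m}"
  have M: "finite M" "M \<subseteq> F" using assms by (auto simp: M_def)
  have "\<exists>m. m \<in> M \<and> fst q \<le> fst m \<and> snd q \<subseteq> snd m" if "q \<in> F" for q
    by (rule ex_maximal_cube[OF assms(1) that]) (unfold M_def, blast)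
  then obtain g where g: "g q \<in> M" "fst q \<le> fst (g q)" "snd q \<subseteq> snd (g q)" if "q \<in> F" for q
    by metis
  have "(\<Sum>(k, Q)\<in>F. ennreal (2 powr (real_of_int k * \<eta>)))
      = (\<Sum>m\<in>M. \<Sum>(k, Q)\<in>{q\<in>F. g q = m}. ennreal (2 powr (real_of_int k * \<eta>)))"
    using assms(1) M g by (subst sum.group) auto
  also have "\<dots> \<le> (\<Sum>m\<in>M. ennreal c * emeasure \<mu> (snd m))"
  proof (rule sum_mono)
    fix m assume m: "m \<in> M"
    have "(\<Sum>(k, Q)\<in>{q\<in>F. g q = m}. ennreal (2 powr (real_of_int k * \<eta>)))
        = ennreal (\<Sum>(k, Q)\<in>{q\<in>F. g q = m}. 2 powr (real_of_int k * \<eta>))"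
      by (subst sum_ennreal [symmetric]) (auto simp: case_prod_beta)
    also have "\<dots> \<le> ennreal (2 powr (real_of_int (fst m) * \<eta>) / (1 - 2 powr - (\<eta> - real DIM('a))))"
    proof (intro ennreal_leI sum_cubes_in_cube_le[where R = "snd m"])
      show "\<And>k Q. (k, Q) \<in> {q \<in> F. g q = m} \<Longrightarrow> k \<le> fst m \<and> Q \<subseteq> snd m"
        using g by force
    qed (use m M assms in auto)
    also have "\<dots> = ennreal c * ennreal (2 powr (real_of_int (fst m) * \<eta>))"
      using c by (simp add: c_def ennreal_mult [symmetric])
    also have "\<dots> \<le> ennreal c * emeasure \<mu> (snd m)"
      using m M low[of "fst m" "snd m"] by (intro mult_left_mono) auto
    finally show "(\<Sum>(k, Q)\<in>{q\<in>F. g q = m}. ennreal (2 powr (real_of_int k * \<eta>))) \<le> ennreal c * emeasure \<mu> (snd m)" .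
  qed
  also have "\<dots> = ennreal c * (\<Sum>m\<in>M. emeasure \<mu> (snd m))"
    by (simp add: sum_distrib_left)
  also have "\<dots> \<le> ennreal c * emeasure \<mu> (space \<mu>)"
  proof (intro mult_left_mono sum_emeasure_antichain_le)
    fix q r assume qr: "q \<in> M" "r \<in> M" "snd q \<subseteq> snd r"
    then have "fst r \<le> fst q" by (auto simp: M_def)
    \<comment> \<open>If \<open>q\<close> had the higher level, it would contain \<open>r\<close> by
      nestedness, against the maximality of \<open>r\<close>.\<close>
    moreover have "fst q \<le> fst r"
    proof (rule ccontr)
      assume n: "\<not> fst q \<le> fst r"
      have "(fst q, snd q) \<in> cubes" "(fst r, snd r) \<in> cubes" using qr M assms(2) by auto
      moreover from this have "snd q \<noteq> {}" using cubes_nonempty by blast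
      ultimately have "snd r \<subseteq> snd q" using cubes_nested n qr(3)
        by (metis Int_absorb1 inf_commute linorder_le_cases)
      then show False using qr n by (auto simp: M_def)
    qed
    ultimately show "fst q = fst r" by simp
  qed (use M assms in auto)
  finally show ?thesis by (simp add: c_def)
qed


text \<open>Sorting the cubes by the dyadic size of \<open>\<tau>\<close> puts each group under \<open>cube_packing\<close>; the groups are
  then recombined by a pointwise geometric sum over the levels \<open>2\<^sup>n \<le> \<phi> x\<close>.\<close>

lemma cube_sum_pos:
  fixes F :: "(int \<times> 'a::euclidean_space set) set" and \<tau> :: "int \<times> 'a set \<Rightarrow> real"
  assumes F: "finite F" "F \<subseteq> cubes" and \<eta>: "real DIM('a) < \<eta>" and a: "0 < a" and K: "0 \<le> K"
    and sets: "\<And>q. q \<in> F \<Longrightarrow> snd q \<in> sets M"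
    and [measurable]: "G \<in> borel_measurable M" "\<phi> \<in> borel_measurable M"
    and \<tau>: "\<And>q. q \<in> F \<Longrightarrow> 0 < \<tau> q"
    and low: "\<And>q. q \<in> F \<Longrightarrow> ennreal (2 powr (real_of_int (fst q) * \<eta>))
      \<le> ennreal K * (\<integral>\<^sup>+x. G x * indicator {x. \<tau> q \<le> \<phi> x} x * indicator (snd q) x \<partial>M)"
  shows "(\<Sum>q\<in>F. ennreal (2 powr (real_of_int (fst q) * \<eta>) * \<tau> q powr a))
    \<le> ennreal (2 powr a / (1 - 2 powr - (\<eta> - real DIM('a))) / (1 - 2 powr - a) * K)
      * (\<integral>\<^sup>+x. G x * ennreal (\<phi> x powr a) \<partial>M)"
proof -
  define c1 where "c1 = 1 / (1 - 2 powr - (\<eta> - real DIM('a)))"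
  define c2 where "c2 = 1 / (1 - 2 powr - a)"
  have c1: "0 \<le> c1" using \<eta> powr_less_one[of 2 "- (\<eta> - real DIM('a))"] by (simp add: c1_def)
  have c2: "0 \<le> c2" using a powr_less_one[of 2 "- a"] by (simp add: c2_def)
  define n where "n q = \<lfloor>log 2 (\<tau> q)\<rfloor>" for q
  have n: "2 powr n q \<le> \<tau> q" "\<tau> q \<le> 2 powr (n q + 1)" if "q \<in> F" for q
  proof -
    have "n q \<le> log 2 (\<tau> q)" "log 2 (\<tau> q) \<le> n q + 1"
      unfolding n_def by linarith+
    then show "2 powr n q \<le> \<tau> q" "\<tau> q \<le> 2 powr (n q + 1)"
      using \<tau>[OF that] by (auto simp: le_log_iff log_le_iff)
  qed
  have [measurable]: "{x. c \<le> \<phi> x} \<inter> space M \<in> sets M" for c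
    by measurable
  \<comment> \<open>\<open>H m\<close> keeps only the mass of \<open>G\<close> where \<phi> is at
    least 2^m. For a cube in group m this set contains the one in \<open>low\<close>, because 2^m
    \<le> \<tau>; including \<open>K\<close> turns \<open>low\<close> into the packing hypothesis
    for the density \<open>H m\<close>.\<close>
  define H where "H m x = ennreal K * (G x * indicator {x. 2 powr real_of_int m \<le> \<phi> x} x)" for m :: int and x
  have [measurable]: "H m \<in> borel_measurable M" for m
    unfolding H_def by measurable
  have level: "(\<Sum>q\<in>{q\<in>F. n q = m}. ennreal (2 powr (real_of_int (fst q) * \<eta>)))
      \<le> ennreal c1 * (\<integral>\<^sup>+x. H m x \<partial>M)" for m
  proof -
    have "(\<Sum>(k, Q)\<in>{q\<in>F. n q = m}. ennreal (2 powr (real_of_int k * \<eta>)))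
        \<le> ennreal (1 / (1 - 2 powr - (\<eta> - real DIM('a)))) * emeasure (density M (H m)) (space (density M (H m)))"
    proof (rule cube_packing)
      fix k Q assume q: "(k, Q) \<in> {q\<in>F. n q = m}"
      then have "2 powr real_of_int m \<le> \<tau> (k, Q)" using n(1) by fastforce
      have "ennreal (2 powr (real_of_int k * \<eta>))
          \<le> ennreal K * (\<integral>\<^sup>+x. G x * indicator {x. \<tau> (k, Q) \<le> \<phi> x} x * indicator Q x \<partial>M)"
        using low[of "(k, Q)"] q by simp
      also have "\<dots> \<le> ennreal K * (\<integral>\<^sup>+x. G x * indicator {x. 2 powr real_of_int m \<le> \<phi> x} x * indicator Q x \<partial>M)"
        using \<open>2 powr real_of_int m \<le> \<tau> (k, Q)\<close>
        by (intro mult_left_mono nn_integral_mono mult_right_mono) (auto simp: indicator_def)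
      also have "\<dots> = (\<integral>\<^sup>+x. H m x * indicator Q x \<partial>M)"
        using sets[of "(k, Q)"] q by (subst nn_integral_cmult [symmetric]) (auto simp: H_def mult.assoc)
      also have "\<dots> = emeasure (density M (H m)) Q"
        using sets[of "(k, Q)"] q by (subst emeasure_density) auto
      finally show "ennreal (2 powr (real_of_int k * \<eta>)) \<le> emeasure (density M (H m)) Q" .
    qed (use F \<eta> sets in auto)
    also have "emeasure (density M (H m)) (space (density M (H m))) = (\<integral>\<^sup>+x. H m x \<partial>M)"
      by (simp add: emeasure_density cong: nn_integral_cong)
    finally show ?thesis by (simp add: c1_def case_prod_beta)
  qed
  \<comment> \<open>Rounding \<tau> up to the next power 2^(n+1) costs the factor 2^a of the final
    constant.\<close>
  have "(\<Sum>q\<in>F. ennreal (2 powr (real_of_int (fst q) * \<eta>) * \<tau> q powr a))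
      \<le> (\<Sum>q\<in>F. ennreal (2 powr (real_of_int (fst q) * \<eta>)) * ennreal (2 powr a * 2 powr (n q * a)))"
  proof (rule sum_mono)
    fix q assume q: "q \<in> F"
    have "\<tau> q powr a \<le> (2 powr (n q + 1)) powr a"
      using n(2)[OF q] \<tau>[OF q] a by (intro powr_mono2) auto
    also have "\<dots> = 2 powr a * 2 powr (n q * a)"
      by (simp add: powr_powr powr_add [symmetric] algebra_simps)
    finally show "ennreal (2 powr (real_of_int (fst q) * \<eta>) * \<tau> q powr a)
        \<le> ennreal (2 powr (real_of_int (fst q) * \<eta>)) * ennreal (2 powr a * 2 powr (n q * a))"
      by (subst ennreal_mult [symmetric]) (auto intro!: ennreal_leI mult_left_mono)
  qed
  also have "\<dots> = (\<Sum>m\<in>n ` F. \<Sum>q\<in>{q\<in>F. n q = m}. ennreal (2 powr (real_of_int (fst q) * \<eta>)) * ennreal (2 powr a * 2 powr (n q * a)))"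
    using F by (subst sum.group) auto
  also have "\<dots> = (\<Sum>m\<in>n ` F. ennreal (2 powr a * 2 powr (m * a)) * (\<Sum>q\<in>{q\<in>F. n q = m}. ennreal (2 powr (real_of_int (fst q) * \<eta>))))"
    by (intro sum.cong refl, subst sum_distrib_left, intro sum.cong refl) (simp add: mult.commute)
  also have "\<dots> \<le> (\<Sum>m\<in>n ` F. ennreal (2 powr a * 2 powr (m * a)) * (ennreal c1 * (\<integral>\<^sup>+x. H m x \<partial>M)))"
    by (intro sum_mono mult_left_mono level) auto
  also have "\<dots> = (\<integral>\<^sup>+x. (\<Sum>m\<in>n ` F. ennreal (2 powr a * 2 powr (m * a)) * (ennreal c1 * H m x)) \<partial>M)"
    by (subst nn_integral_sum) (auto simp: nn_integral_cmult)
  also have "\<dots> \<le> (\<integral>\<^sup>+x. ennreal (2 powr a * c1 * c2 * K) * (G x * ennreal (\<phi> x powr a)) \<partial>M)"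
  proof (rule nn_integral_mono)
    fix x
    define S where "S = {m\<in>n ` F. 2 powr real_of_int m \<le> \<phi> x}"
    have "(\<Sum>m\<in>S. 2 powr (real_of_int m * a)) \<le> \<phi> x powr a * c2"
    proof (cases "S = {}")
      case False
      then obtain m where "2 powr real_of_int m \<le> \<phi> x" by (auto simp: S_def)
      then have \<phi>: "0 < \<phi> x" by (rule less_le_trans[rotated]) simp
      have "(\<Sum>m\<in>S. 2 powr (real_of_int m * a)) \<le> 2 powr (real_of_int \<lfloor>log 2 (\<phi> x)\<rfloor> * a) / (1 - 2 powr - a)"
        using F a \<phi> by (intro sum_powr_le) (auto simp: S_def le_floor_iff le_log_iff)
      also have "\<dots> \<le> \<phi> x powr a / (1 - 2 powr - a)"
      proof (intro divide_right_mono)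
        have "2 powr (real_of_int \<lfloor>log 2 (\<phi> x)\<rfloor> * a) \<le> 2 powr (log 2 (\<phi> x) * a)"
          using a by (intro powr_mono mult_right_mono) auto
        also have "\<dots> = \<phi> x powr a"
          using \<phi> by (simp add: powr_powr [symmetric])
        finally show "2 powr (real_of_int \<lfloor>log 2 (\<phi> x)\<rfloor> * a) \<le> \<phi> x powr a" .
      qed (use a powr_less_one[of 2 "- a"] in simp)
      finally show ?thesis by (simp add: c2_def)
    qed (use c2 in simp)
    then have *: "(\<Sum>m\<in>S. ennreal (2 powr (real_of_int m * a))) \<le> ennreal (\<phi> x powr a * c2)"
      by (subst sum_ennreal) (auto intro: ennreal_leI)
    have "(\<Sum>m\<in>n ` F. ennreal (2 powr a * 2 powr (m * a)) * (ennreal c1 * H m x))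
        = (\<Sum>m\<in>S. ennreal (2 powr a * 2 powr (m * a)) * (ennreal c1 * H m x))"
      using F by (intro sum.mono_neutral_right) (auto simp: S_def H_def)
    also have "\<dots> = (\<Sum>m\<in>S. (ennreal (2 powr a) * ennreal c1 * ennreal K * G x) * ennreal (2 powr (real_of_int m * a)))"
      by (intro sum.cong refl) (auto simp: S_def H_def ennreal_mult' mult_ac)
    also have "\<dots> \<le> (ennreal (2 powr a) * ennreal c1 * ennreal K * G x) * ennreal (\<phi> x powr a * c2)"
      unfolding sum_distrib_left [symmetric] by (intro mult_left_mono *) auto
    also have "\<dots> = ennreal (2 powr a * c1 * c2 * K) * (G x * ennreal (\<phi> x powr a))"
      using c1 c2 K by (simp add: ennreal_mult' ennreal_mult'' mult_ac)
    finally show "(\<Sum>m\<in>n ` F. ennreal (2 powr a * 2 powr (m * a)) * (ennreal c1 * H m x))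
        \<le> ennreal (2 powr a * c1 * c2 * K) * (G x * ennreal (\<phi> x powr a))" .
  qed
  also have "\<dots> = ennreal (2 powr a * c1 * c2 * K) * (\<integral>\<^sup>+x. G x * ennreal (\<phi> x powr a) \<partial>M)"
    by (rule nn_integral_cmult) measurable
  finally show ?thesis by (simp add: c1_def c2_def)
qed

text \<open>For \<open>\<theta> < 0\<close> the terms decay geometrically from a minimal cube up through its ancestors.\<close>

lemma cube_sum_neg:
  fixes F :: "(int \<times> 'a::euclidean_space set) set" and v :: "'a set \<Rightarrow> real"
  assumes F: "finite F" "F \<subseteq> cubes" and \<theta>: "\<theta> < 0"
    and sets: "\<And>q. q \<in> F \<Longrightarrow> snd q \<in> sets \<mu>"
    and v0: "\<And>q. q \<in> F \<Longrightarrow> 0 \<le> v (snd q)"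
    and mono: "\<And>q r. q \<in> F \<Longrightarrow> r \<in> F \<Longrightarrow> snd q \<subseteq> snd r \<Longrightarrow> v (snd r) \<le> v (snd q)"
    and low: "\<And>q. q \<in> F \<Longrightarrow> ennreal (2 powr (real_of_int (fst q) * \<theta>) * v (snd q)) \<le> emeasure \<mu> (snd q)"
  shows "(\<Sum>q\<in>F. ennreal (2 powr (real_of_int (fst q) * \<theta>) * v (snd q)))
    \<le> ennreal (1 / (1 - 2 powr \<theta>)) * emeasure \<mu> (space \<mu>)"
proof -
  define c where "c = 1 / (1 - 2 powr \<theta>)"
  have c: "0 \<le> c" using \<theta> powr_less_one[of 2 \<theta>] by (simp add: c_def)
  define M where "M = {m\<in>F. \<forall>r\<in>F. snd r \<subseteq> snd m \<longrightarrow> fst m \<le> fst r}"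
  have M: "finite M" "M \<subseteq> F" using F by (auto simp: M_def)
  have "\<exists>m. m \<in> M \<and> fst m \<le> fst q \<and> snd m \<subseteq> snd q" if "q \<in> F" for q
    by (rule ex_minimal_cube[OF F(1) that]) (unfold M_def, blast)
  then obtain g where g: "g q \<in> M" "fst (g q) \<le> fst q" "snd (g q) \<subseteq> snd q" if "q \<in> F" for q
    by metis
  have "(\<Sum>q\<in>F. ennreal (2 powr (real_of_int (fst q) * \<theta>) * v (snd q)))
      = (\<Sum>m\<in>M. \<Sum>q\<in>{q\<in>F. g q = m}. ennreal (2 powr (real_of_int (fst q) * \<theta>) * v (snd q)))"
    using F M g by (subst sum.group) auto
  also have "\<dots> \<le> (\<Sum>m\<in>M. ennreal c * emeasure \<mu> (snd m))"
  proof (rule sum_mono)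
    fix m assume m: "m \<in> M"
    let ?S = "{q\<in>F. g q = m}"
    \<comment> \<open>All cubes charged to \<open>m\<close> contain it, and there is only one dyadic
      cube of each level containing a given cube. The group is therefore a chain indexed by its
      levels.\<close>
    have inj: "inj_on fst ?S"
    proof (rule inj_onI)
      fix p q assume *: "p \<in> ?S" "q \<in> ?S" "fst p = fst q"
      have "(fst p, snd p) \<in> cubes" "(fst q, snd q) \<in> cubes" "(fst m, snd m) \<in> cubes"
        using * m M F by (metis (no_types, lifting) mem_Collect_eq prod.collapse subsetD)+
      moreover from this have "snd m \<noteq> {}" using cubes_nonempty by blast
      moreover have "snd m \<subseteq> snd p" "snd m \<subseteq> snd q" using * g(3)[of p] g(3)[of q] by auto
      ultimately have "snd p = snd q"
        using *(3) cubes_eqI[of "fst p" "snd p" "snd q"] by auto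
      with *(3) show "p = q" by (simp add: prod_eq_iff)
    qed
    have "(\<Sum>q\<in>?S. 2 powr (real_of_int (fst q) * \<theta>)) = (\<Sum>k\<in>fst ` ?S. 2 powr (real_of_int k * \<theta>))"
      using inj by (simp add: sum.reindex)
    \<comment> \<open>Negating the levels turns the decay above the level of \<open>m\<close> into a
      sum with positive exponent -\<theta> below a top index.\<close>
    also have "\<dots> = (\<Sum>k\<in>uminus ` fst ` ?S. 2 powr (real_of_int k * (- \<theta>)))"
      by (subst sum.reindex) auto
    also have "\<dots> \<le> 2 powr (real_of_int (- fst m) * (- \<theta>)) / (1 - 2 powr - (- \<theta>))"
      using F \<theta> g by (intro sum_powr_le) auto
    also have "\<dots> = c * 2 powr (real_of_int (fst m) * \<theta>)"
      by (simp add: c_def)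
    finally have le: "(\<Sum>q\<in>?S. 2 powr (real_of_int (fst q) * \<theta>)) \<le> c * 2 powr (real_of_int (fst m) * \<theta>)" .
    have mF: "m \<in> F" using m M by auto
    have "(\<Sum>q\<in>?S. ennreal (2 powr (real_of_int (fst q) * \<theta>) * v (snd q)))
        = ennreal (\<Sum>q\<in>?S. 2 powr (real_of_int (fst q) * \<theta>) * v (snd q))"
      using v0 by (intro sum_ennreal) auto
    also have "\<dots> \<le> ennreal (\<Sum>q\<in>?S. 2 powr (real_of_int (fst q) * \<theta>) * v (snd m))"
      using mF by (intro ennreal_leI sum_mono mult_left_mono mono) (auto simp del: split_paired_All dest: g(3)[THEN subsetD])
    also have "\<dots> \<le> ennreal (c * 2 powr (real_of_int (fst m) * \<theta>) * v (snd m))"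
      unfolding sum_distrib_right [symmetric] using v0 mF by (intro ennreal_leI mult_right_mono le) auto
    also have "\<dots> = ennreal c * ennreal (2 powr (real_of_int (fst m) * \<theta>) * v (snd m))"
      using c v0[OF mF] by (simp add: ennreal_mult' mult.assoc)
    also have "\<dots> \<le> ennreal c * emeasure \<mu> (snd m)"
      by (intro mult_left_mono low mF) auto
    finally show "(\<Sum>q\<in>?S. ennreal (2 powr (real_of_int (fst q) * \<theta>) * v (snd q))) \<le> ennreal c * emeasure \<mu> (snd m)" .
  qed
  also have "\<dots> = ennreal c * (\<Sum>m\<in>M. emeasure \<mu> (snd m))"
    by (simp add: sum_distrib_left)
  also have "\<dots> \<le> ennreal c * emeasure \<mu> (space \<mu>)"
  proof (intro mult_left_mono sum_emeasure_antichain_le)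
    fix q r assume qr: "q \<in> M" "r \<in> M" "snd q \<subseteq> snd r"
    then have "fst r \<le> fst q" by (auto simp: M_def)
    have cb: "(fst q, snd q) \<in> cubes" "(fst r, snd r) \<in> cubes" using qr M F by auto
    moreover from this have "snd q \<noteq> {}" using cubes_nonempty by blast
    ultimately have "snd r \<subseteq> snd q"
      using cubes_nested[of "fst r" "snd r" "fst q" "snd q"] \<open>fst r \<le> fst q\<close> qr(3) by blast
    then have "fst q \<le> fst r" using qr by (auto simp: M_def)
    with \<open>fst r \<le> fst q\<close> show "fst q = fst r" by simp
  qed (use M F sets in auto)
  finally show ?thesis by (simp add: c_def)
qed


subsection \<open>Weighted sums over cubes with large average\<close>

text \<open>With \<open>\<sigma> = w\<^bsup>-1/(p-1)\<^esup>\<close>, this is \<open>\<sigma>(Q)\<^bsup>1-p\<^esup>\<close> for \<open>p > 1\<close> and the essential infimum of \<open>w\<close> for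
  \<open>p = 1\<close>. It is \<open>0\<close> if \<open>\<sigma>(Q) = \<infinity>\<close>, and, through the junk values of \<^const>\<open>enn2real\<close> and
  of powers of \<open>0\<close>, also if \<open>Q \<inter> \<Omega>\<close> is a null set.\<close>

definition cube_weight :: "real \<Rightarrow> 'a::euclidean_space set \<Rightarrow> ('a \<Rightarrow> real) \<Rightarrow> 'a set \<Rightarrow> real" where
  "cube_weight p \<Omega> w Q =
    (if p = 1 then enn2real (ess_inf_on (Q \<inter> \<Omega>) w)
     else enn2real (\<integral>\<^sup>+x. epowr (ennreal (w x)) (- (conj_exp p / p)) * indicator (Q \<inter> \<Omega>) x \<partial>lebesgue) powr (1 - p))"

lemma cube_weight_nonneg [simp]: "0 \<le> cube_weight p \<Omega> w Q"
  by (simp add: cube_weight_def)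

lemma conj_exp_div: "1 < p \<Longrightarrow> conj_exp p / p = 1 / (p - 1)"
  by (simp add: conj_exp_def)

lemma epowr_neg:
  "0 \<le> y \<Longrightarrow> 0 < b \<Longrightarrow> epowr (ennreal y) (- b) = (if y = 0 then top else ennreal (y powr - b))"
  by (auto simp: epowr_def)

text \<open>The supremum of the essential lower bounds is the supremum of a sequence of them, so
  only countably many exceptional null sets have to be united.\<close>

lemma ess_inf_on_AE:
  "AE y in lebesgue_on S. ess_inf_on S w \<le> ennreal (w y)"
proof -
  let ?A = "{c. AE y in lebesgue_on S. c \<le> ennreal (w y)}"
  have "0 \<in> ?A" by simp
  then have "?A \<noteq> {}" by blast
  from ennreal_Sup_countable_SUP[OF this] obtain f :: "nat \<Rightarrow> ennreal"
    where f: "range f \<subseteq> ?A" "Sup ?A = (SUP i. f i)" by auto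
  have "AE y in lebesgue_on S. \<forall>i. f i \<le> ennreal (w y)"
    using f(1) by (subst AE_all_countable) auto
  then show ?thesis
    unfolding ess_inf_on_def f(2) by eventually_elim (auto intro: SUP_least)
qed

lemma ess_inf_on_antimono:
  assumes "S \<subseteq> T" "S \<in> sets lebesgue" "T \<in> sets lebesgue"
  shows "ess_inf_on T w \<le> ess_inf_on S w"
  unfolding ess_inf_on_def
proof (rule Sup_subset_mono, clarify)
  fix c assume "AE y in lebesgue_on T. c \<le> ennreal (w y)"
  then have "AE y in lebesgue. y \<in> T \<longrightarrow> c \<le> ennreal (w y)"
    using assms by (subst (asm) AE_restrict_space_iff) auto
  then show "AE y in lebesgue_on S. c \<le> ennreal (w y)"
    using assms by (subst AE_restrict_space_iff) (auto elim: eventually_mono)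
qed

text \<open>Enlarging the cube lowers an essential infimum and raises the dual integral, which
  enters with the negative exponent 1 - p. Positivity excludes default values: a cube that is null
  in \<Omega> has weight 0 and would break the inequality.\<close>

lemma cube_weight_antimono:
  assumes "1 \<le> p" "Q \<subseteq> R" "Q \<in> sets borel" "R \<in> sets borel" "open \<Omega>"
    and pos: "0 < cube_weight p \<Omega> w Q" "0 < cube_weight p \<Omega> w R"
  shows "cube_weight p \<Omega> w R \<le> cube_weight p \<Omega> w Q"
proof (cases "p = 1")
  case True
  have "ess_inf_on (R \<inter> \<Omega>) w \<le> ess_inf_on (Q \<inter> \<Omega>) w"
    using assms by (intro ess_inf_on_antimono) auto
  moreover have "ess_inf_on (Q \<inter> \<Omega>) w < top"
    using pos(1) True by (auto simp: cube_weight_def enn2real_positive_iff)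
  ultimately show ?thesis
    using True by (simp add: cube_weight_def enn2real_mono)
next
  case False
  let ?I = "\<lambda>Q. \<integral>\<^sup>+x. epowr (ennreal (w x)) (- (conj_exp p / p)) * indicator (Q \<inter> \<Omega>) x \<partial>lebesgue"
  have "?I Q \<le> ?I R"
    using assms by (intro nn_integral_mono mult_left_mono) (auto simp: indicator_def)
  moreover have "0 < enn2real (?I Q)" "0 < enn2real (?I R)"
    using pos False by (auto simp: cube_weight_def enn2real_nonneg less_le)
  moreover from this have "?I R < top" by (auto simp: enn2real_positive_iff)
  ultimately have "enn2real (?I R) powr (1 - p) \<le> enn2real (?I Q) powr (1 - p)"
    using assms(1) by (intro powr_mono2') (auto intro: enn2real_mono)
  then show ?thesis
    using False by (simp add: cube_weight_def)
qed

text \<open>A common form of both regimes that serves p = 1 and p > 1 alike. The level \<tau> is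
  tied to \<open>v\<close> by 2^(k\<theta>) v = 2^(k\<eta>) \<tau>^a, and the last hypothesis says
  that \<open>G\<close> has mass at least 2^(k\<eta>) / K on the part of the cube where \<phi>
  reaches \<tau>.\<close>

lemma cube_sum_abstract:
  fixes \<theta> \<eta> a :: real
  assumes "0 < a" and \<eta>: "\<theta> < 0 \<or> real DIM('a::euclidean_space) < \<eta>"
  shows "\<exists>C\<ge>0. \<forall>(F :: (int \<times> 'a set) set) (\<tau> :: int \<times> 'a set \<Rightarrow> real) v K G \<phi>.
    finite F \<longrightarrow> F \<subseteq> cubes \<longrightarrow> 0 \<le> K \<longrightarrow> G \<in> borel_measurable lebesgue \<longrightarrow> \<phi> \<in> borel_measurable lebesgue \<longrightarrow>
    (\<forall>q\<in>F. 0 < \<tau> q \<and> 0 < v (snd q)) \<longrightarrow>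
    (\<forall>q\<in>F. \<forall>r\<in>F. snd q \<subseteq> snd r \<longrightarrow> v (snd r) \<le> v (snd q)) \<longrightarrow>
    (\<forall>q\<in>F. 2 powr (real_of_int (fst q) * \<theta>) * v (snd q) = 2 powr (real_of_int (fst q) * \<eta>) * \<tau> q powr a) \<longrightarrow>
    (\<forall>q\<in>F. ennreal (2 powr (real_of_int (fst q) * \<eta>))
      \<le> ennreal K * (\<integral>\<^sup>+x. G x * indicator {x. \<tau> q \<le> \<phi> x} x * indicator (snd q) x \<partial>lebesgue)) \<longrightarrow>
    (\<Sum>q\<in>F. ennreal (2 powr (real_of_int (fst q) * \<theta>) * v (snd q)))
      \<le> ennreal (C * K) * (\<integral>\<^sup>+x. G x * ennreal (\<phi> x powr a) \<partial>lebesgue)"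
    (is "\<exists>C\<ge>0. ?P C")
proof (cases "real DIM('a) < \<eta>")
  case True
  show ?thesis
  proof (intro exI conjI allI impI)
    show "0 \<le> 2 powr a / (1 - 2 powr - (\<eta> - real DIM('a))) / (1 - 2 powr - a)"
      using True assms(1) powr_less_one[of 2 "- (\<eta> - real DIM('a))"] powr_less_one[of 2 "- a"]
      by (intro divide_nonneg_nonneg) auto
  next
    fix F :: "(int \<times> 'a set) set" and \<tau> :: "int \<times> 'a set \<Rightarrow> real" and v K G \<phi>
    assume *: "finite F" "F \<subseteq> cubes" "0 \<le> K" "G \<in> borel_measurable lebesgue" "\<phi> \<in> borel_measurable lebesgue"
      and pos: "\<forall>q\<in>F. 0 < \<tau> q \<and> 0 < v (snd q)"
      and eq: "\<forall>q\<in>F. 2 powr (real_of_int (fst q) * \<theta>) * v (snd q) = 2 powr (real_of_int (fst q) * \<eta>) * \<tau> q powr a"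
      and low: "\<forall>q\<in>F. ennreal (2 powr (real_of_int (fst q) * \<eta>))
      \<le> ennreal K * (\<integral>\<^sup>+x. G x * indicator {x. \<tau> q \<le> \<phi> x} x * indicator (snd q) x \<partial>lebesgue)"
    have "(\<Sum>q\<in>F. ennreal (2 powr (real_of_int (fst q) * \<theta>) * v (snd q)))
        = (\<Sum>q\<in>F. ennreal (2 powr (real_of_int (fst q) * \<eta>) * \<tau> q powr a))"
      using eq by (intro sum.cong refl) simp
    also have "\<dots> \<le> ennreal (2 powr a / (1 - 2 powr - (\<eta> - real DIM('a))) / (1 - 2 powr - a) * K)
        * (\<integral>\<^sup>+x. G x * ennreal (\<phi> x powr a) \<partial>lebesgue)"
    proof (rule cube_sum_pos)
      show "snd q \<in> sets lebesgue" if "q \<in> F" for q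
        using that *(2) cubes_borel[of "fst q" "snd q"] by auto
    qed (use * pos low True assms(1) in auto)
    finally show "(\<Sum>q\<in>F. ennreal (2 powr (real_of_int (fst q) * \<theta>) * v (snd q))) \<le> \<dots>" .
  qed
next
  case False
  then have \<theta>: "\<theta> < 0" using \<eta> by simp
  show ?thesis
  proof (intro exI conjI allI impI)
    show "0 \<le> 1 / (1 - 2 powr \<theta>)"
      using \<theta> powr_less_one[of 2 \<theta>] by simp
  next
    fix F :: "(int \<times> 'a set) set" and \<tau> :: "int \<times> 'a set \<Rightarrow> real" and v K G \<phi>
    assume *: "finite F" "F \<subseteq> cubes" "0 \<le> K"
      and [measurable]: "G \<in> borel_measurable lebesgue" "\<phi> \<in> borel_measurable lebesgue"
      and pos: "\<forall>q\<in>F. 0 < \<tau> q \<and> 0 < v (snd q)"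
      and mono: "\<forall>q\<in>F. \<forall>r\<in>F. snd q \<subseteq> snd r \<longrightarrow> v (snd r) \<le> v (snd q)"
      and eq: "\<forall>q\<in>F. 2 powr (real_of_int (fst q) * \<theta>) * v (snd q) = 2 powr (real_of_int (fst q) * \<eta>) * \<tau> q powr a"
      and low: "\<forall>q\<in>F. ennreal (2 powr (real_of_int (fst q) * \<eta>))
      \<le> ennreal K * (\<integral>\<^sup>+x. G x * indicator {x. \<tau> q \<le> \<phi> x} x * indicator (snd q) x \<partial>lebesgue)"
    let ?H = "\<lambda>x. ennreal K * (G x * ennreal (\<phi> x powr a))"
    let ?\<mu> = "density lebesgue ?H"
    have sets: "snd q \<in> sets lebesgue" if "q \<in> F" for q
      using that *(2) cubes_borel[of "fst q" "snd q"] by auto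
    have "(\<Sum>q\<in>F. ennreal (2 powr (real_of_int (fst q) * \<theta>) * v (snd q)))
        \<le> ennreal (1 / (1 - 2 powr \<theta>)) * emeasure ?\<mu> (space ?\<mu>)"
    proof (rule cube_sum_neg)
      fix q assume q: "q \<in> F"
      then have sq[measurable]: "snd q \<in> sets lebesgue" by (rule sets)
      have "ennreal (2 powr (real_of_int (fst q) * \<theta>) * v (snd q))
          = ennreal (2 powr (real_of_int (fst q) * \<eta>)) * ennreal (\<tau> q powr a)"
        using eq q by (simp add: ennreal_mult)
      also have "\<dots> \<le> ennreal K * (\<integral>\<^sup>+x. G x * indicator {x. \<tau> q \<le> \<phi> x} x * indicator (snd q) x \<partial>lebesgue) * ennreal (\<tau> q powr a)"
        using low q by (intro mult_right_mono) auto
      also have "\<dots> = (\<integral>\<^sup>+x. ennreal K * (G x * indicator {x. \<tau> q \<le> \<phi> x} x * indicator (snd q) x) * ennreal (\<tau> q powr a) \<partial>lebesgue)"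
        by (subst nn_integral_multc, measurable) (subst nn_integral_cmult, auto)
      \<comment> \<open>Chebyshev's argument: on the set where \<tau> \<le> \<phi> the constant
        \<tau>^a may be replaced by \<phi>^a. This produces one measure that serves all
        levels.\<close>
      also have "\<dots> \<le> (\<integral>\<^sup>+x. ?H x * indicator (snd q) x \<partial>lebesgue)"
      proof (rule nn_integral_mono)
        fix x
        show "ennreal K * (G x * indicator {x. \<tau> q \<le> \<phi> x} x * indicator (snd q) x) * ennreal (\<tau> q powr a)
          \<le> ?H x * indicator (snd q) x"
        proof (cases "\<tau> q \<le> \<phi> x \<and> x \<in> snd q")
          case True
          then have "ennreal (\<tau> q powr a) \<le> ennreal (\<phi> x powr a)"
            using pos q assms(1) by (intro ennreal_leI powr_mono2) (auto intro: less_imp_le)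
          then show ?thesis
            using True by (auto simp: mult.assoc intro!: mult_left_mono)
        qed (auto simp: indicator_def)
      qed
      also have "\<dots> = emeasure ?\<mu> (snd q)"
        by (subst emeasure_density) auto
      finally show "ennreal (2 powr (real_of_int (fst q) * \<theta>) * v (snd q)) \<le> emeasure ?\<mu> (snd q)" .
    qed (use * pos mono \<theta> sets in \<open>auto intro: less_imp_le\<close>)
    also have "emeasure ?\<mu> (space ?\<mu>) = ennreal K * (\<integral>\<^sup>+x. G x * ennreal (\<phi> x powr a) \<partial>lebesgue)"
      by (subst emeasure_density) (auto simp: nn_integral_cmult)
    finally show "(\<Sum>q\<in>F. ennreal (2 powr (real_of_int (fst q) * \<theta>) * v (snd q)))
        \<le> ennreal (1 / (1 - 2 powr \<theta>) * K) * (\<integral>\<^sup>+x. G x * ennreal (\<phi> x powr a) \<partial>lebesgue)"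
      using \<open>0 \<le> K\<close> ennreal_mult''[OF \<open>0 \<le> K\<close>, of "1 / (1 - 2 powr \<theta>)"] by (simp only: mult.assoc)
  qed
qed


section \<open>Gradient mass above a level inside one cube\<close>

lemma weight_borel_lebesgue:
  assumes "open \<Omega>" "weight \<Omega> w"
  shows "(\<lambda>x. w x * indicator \<Omega> x) \<in> borel_measurable lebesgue"
  using assms by (auto simp: weight_def borel_measurable_restrict_space_iff mult.commute)

lemma nn_integral_lebesgue_on:
  "\<Omega> \<in> sets lebesgue \<Longrightarrow> (\<integral>\<^sup>+x. f x \<partial>lebesgue_on \<Omega>) = (\<integral>\<^sup>+x. f x * indicator \<Omega> x \<partial>lebesgue)"
  by (subst nn_integral_restrict_space) auto

text \<open>The level condition for p = 1: \<open>g\<close> lives on \<Omega>, and almost everywhere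
  on the part of the cube in \<Omega> the weight is at least its essential infimum, so restricting
  to v \<le> w loses no mass.\<close>

lemma cube_level_ess_inf:
  fixes g w :: "'a::euclidean_space \<Rightarrow> real"
  assumes \<Omega>: "open \<Omega>" "weight \<Omega> w" and g: "g \<in> borel_measurable borel" "\<And>x. x \<notin> \<Omega> \<Longrightarrow> g x = 0"
    and s: "0 < s" and Q: "Q \<in> sets borel"
    and low: "ennreal (s * L) \<le> (\<integral>\<^sup>+x. ennreal (g x) * indicator Q x \<partial>lebesgue)" and L: "0 \<le> L"
    and v: "v = enn2real (ess_inf_on (Q \<inter> \<Omega>) w)"
  shows "ennreal L \<le> ennreal (1 / s) *
    (\<integral>\<^sup>+x. ennreal (g x) * indicator {x. v \<le> w x * indicator \<Omega> x} x * indicator Q x \<partial>lebesgue)"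
proof -
  have v0: "0 \<le> v" using v by simp
  have "AE x in lebesgue. x \<in> Q \<inter> \<Omega> \<longrightarrow> ess_inf_on (Q \<inter> \<Omega>) w \<le> ennreal (w x)"
    using ess_inf_on_AE[of "Q \<inter> \<Omega>" w] \<Omega>(1) Q by (subst (asm) AE_restrict_space_iff) auto
  then have "AE x in lebesgue. x \<in> Q \<inter> \<Omega> \<longrightarrow> v \<le> w x"
  proof eventually_elim
    case (elim x)
    show ?case
    proof
      assume x: "x \<in> Q \<inter> \<Omega>"
      then have "v \<le> enn2real (ennreal (w x))"
        unfolding v using elim by (intro enn2real_mono) auto
      then show "v \<le> w x"
        using x \<Omega>(2) by (simp add: weight_def)
    qed
  qed
  then have "AE x in lebesgue. ennreal (g x) * indicator Q x =
      ennreal (g x) * indicator {x. v \<le> w x * indicator \<Omega> x} x * indicator Q x"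
    by eventually_elim (use g(2) in \<open>auto simp: indicator_def\<close>)
  then have eq: "(\<integral>\<^sup>+x. ennreal (g x) * indicator Q x \<partial>lebesgue) =
      (\<integral>\<^sup>+x. ennreal (g x) * indicator {x. v \<le> w x * indicator \<Omega> x} x * indicator Q x \<partial>lebesgue)"
    by (rule nn_integral_cong_AE)
  have "ennreal L = ennreal (1 / s) * ennreal (s * L)"
    using s L by (simp add: ennreal_mult [symmetric])
  also have "\<dots> \<le> ennreal (1 / s) * (\<integral>\<^sup>+x. ennreal (g x) * indicator Q x \<partial>lebesgue)"
    by (intro mult_left_mono low) simp
  finally show ?thesis unfolding eq .
qed

text \<open>Where \<open>g < (s \<tau> / 2) \<sigma>\<close>, \<open>\<sigma> = w\<^bsup>-b\<^esup>\<close>, the integral of \<open>g\<close> over \<open>Q\<close> is at most \<open>s L / 2\<close>, so half of the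
  mass of \<open>g\<close> lies where \<open>g / \<sigma>\<close> is large. For \<open>\<theta> < 0\<close> this also takes the place of Hoelder's inequality.\<close>

lemma cube_level_dual_weight:
  fixes g w :: "'a::euclidean_space \<Rightarrow> real"
  assumes \<Omega>: "open \<Omega>" "weight \<Omega> w" and g: "g \<in> borel_measurable borel" "\<And>x. x \<notin> \<Omega> \<Longrightarrow> g x = 0" "\<And>x. 0 \<le> g x"
    and s: "0 < s" and Q: "Q \<in> sets borel" and b: "0 < b"
    and low: "ennreal (s * L) \<le> (\<integral>\<^sup>+x. ennreal (g x) * indicator Q x \<partial>lebesgue)" and L: "0 \<le> L"
    and \<tau>: "0 < \<tau>" and int_\<sigma>: "ennreal \<tau> * (\<integral>\<^sup>+x. epowr (ennreal (w x)) (- b) * indicator (Q \<inter> \<Omega>) x \<partial>lebesgue) \<le> ennreal L"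
  shows "ennreal L \<le> ennreal (2 / s) *
    (\<integral>\<^sup>+x. ennreal (g x) * indicator {x. \<tau> \<le> 2 / s * g x * (w x * indicator \<Omega> x) powr b} x * indicator Q x \<partial>lebesgue)"
    (is "_ \<le> _ * ?I")
proof -
  have [measurable]: "(\<lambda>x. w x * indicator \<Omega> x) \<in> borel_measurable lebesgue"
    by (rule weight_borel_lebesgue) fact+
  have [measurable]: "g \<in> borel_measurable lebesgue" "Q \<in> sets lebesgue" "\<Omega> \<in> sets lebesgue"
    using g(1) Q \<Omega>(1) by (auto intro: measurable_completion)
  let ?\<sigma> = "\<lambda>x. epowr (ennreal (w x)) (- b) * indicator (Q \<inter> \<Omega>) x"
  have w0: "0 \<le> w x" if "x \<in> \<Omega>" for x using that \<Omega>(2) by (auto simp: weight_def)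
  \<comment> \<open>Expressing the power through \<open>w\<close> cut off to \<Omega>, with value
    \<open>top\<close> at its zeros, exhibits the measurability of the dual weight.\<close>
  have \<sigma>: "?\<sigma> = (\<lambda>x. (if w x * indicator \<Omega> x = 0 then top else ennreal ((w x * indicator \<Omega> x) powr - b)) * indicator (Q \<inter> \<Omega>) x)"
    using b w0 epowr_neg[of 0 b] by (auto simp: fun_eq_iff indicator_def epowr_neg)
  have [measurable]: "?\<sigma> \<in> borel_measurable lebesgue"
    unfolding \<sigma> by measurable
  let ?J = "\<lambda>x. ennreal (g x) * indicator {x. \<tau> \<le> 2 / s * g x * (w x * indicator \<Omega> x) powr b} x * indicator Q x"
  have "ennreal (g x) * indicator Q x \<le> ennreal (s / 2 * \<tau>) * ?\<sigma> x + ?J x" for x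
  proof (cases "x \<in> Q \<and> x \<in> \<Omega> \<and> 2 / s * g x * w x powr b < \<tau>")
    case True
    show ?thesis
    \<comment> \<open>At a zero of \<open>w\<close> the dual weight is infinite and absorbs any
      value of \<open>g\<close>.\<close>
    proof (cases "w x = 0")
      case True
      then have "epowr (ennreal (w x)) (- b) = top" using b epowr_neg[of 0 b] by simp
      then show ?thesis
        using \<open>x \<in> Q \<and> _\<close> s \<tau> by (simp add: ennreal_mult_top)
    next
      case False
      then have w: "0 < w x" using True w0[of x] by simp
      have "g x * w x powr b \<le> s / 2 * \<tau>"
        using True s by (simp add: field_simps)
      then have "g x * w x powr b * w x powr - b \<le> s / 2 * \<tau> * w x powr - b"
        by (intro mult_right_mono) auto
      then have "g x \<le> s / 2 * \<tau> * w x powr - b"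
        using w by (simp add: mult.assoc powr_add [symmetric])
      then have "ennreal (g x) \<le> ennreal (s / 2 * \<tau>) * ennreal (w x powr - b)"
        using s \<tau> by (subst ennreal_mult [symmetric]) (auto intro: ennreal_leI)
      also have "ennreal (w x powr - b) = ?\<sigma> x"
        using True w b by (simp add: epowr_neg)
      finally show ?thesis using True by (simp add: add_increasing2)
    qed
  next
    case False
    then show ?thesis
      using g(2)[of x] by (cases "x \<in> \<Omega>"; cases "x \<in> Q") (auto simp: indicator_def add_increasing)
  qed
  then have "(\<integral>\<^sup>+x. ennreal (g x) * indicator Q x \<partial>lebesgue) \<le> (\<integral>\<^sup>+x. ennreal (s / 2 * \<tau>) * ?\<sigma> x + ?J x \<partial>lebesgue)"
    by (intro nn_integral_mono)
  also have "\<dots> = ennreal (s / 2 * \<tau>) * (\<integral>\<^sup>+x. ?\<sigma> x \<partial>lebesgue) + ?I"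
    by (subst nn_integral_add, measurable) (subst nn_integral_cmult, auto)
  also have "ennreal (s / 2 * \<tau>) * (\<integral>\<^sup>+x. ?\<sigma> x \<partial>lebesgue) \<le> ennreal (s / 2 * L)"
  proof -
    have "ennreal (s / 2) * (ennreal \<tau> * (\<integral>\<^sup>+x. ?\<sigma> x \<partial>lebesgue)) \<le> ennreal (s / 2) * ennreal L"
      by (intro mult_left_mono int_\<sigma>) simp
    moreover have "ennreal (s / 2 * \<tau>) = ennreal (s / 2) * ennreal \<tau>" "ennreal (s / 2 * L) = ennreal (s / 2) * ennreal L"
      using s \<tau> L by (simp_all only: ennreal_mult)
    ultimately show ?thesis
      by (simp only: mult.assoc)
  qed
  finally have *: "ennreal (s * L) \<le> ennreal (s / 2 * L) + ?I"
    using low by (meson add_right_mono order_trans)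
  show ?thesis
  proof (cases "?I = top")
    case True
    then show ?thesis using s by (simp add: ennreal_mult_top)
  next
    case False
    then obtain i where i: "?I = ennreal i" "0 \<le> i" by (cases ?I) auto
    have "s * L \<le> s / 2 * L + i"
      using * i s L by (simp flip: ennreal_plus)
    then have "L \<le> 2 / s * i"
      using s by (simp add: field_simps)
    then show ?thesis
      using i s by (simp add: ennreal_mult [symmetric] ennreal_leI)
  qed
qed

text \<open>The abstract sum is applied with \<eta> = \<theta>/p. For p = 1 the level is the cube
  weight and \<phi> = w. For p > 1 the level is 2^(k\<theta>/p) divided by the dual integral, and
  \<phi> = (2/s) g w^(1/(p-1)); then g \<phi>^(p-1) is a constant times g^p w, the integrand on the
  right.\<close>

lemma cube_sum:
  fixes p \<theta> :: real
  assumes p: "1 \<le> p" and \<theta>: "\<theta> < 0 \<or> p * real DIM('a::euclidean_space) < \<theta>"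
  shows "\<exists>C\<ge>0. \<forall>(\<Omega> :: 'a set) w g s F.
    open \<Omega> \<longrightarrow> weight \<Omega> w \<longrightarrow> g \<in> borel_measurable borel \<longrightarrow> (\<forall>x. 0 \<le> g x) \<longrightarrow> (\<forall>x. x \<notin> \<Omega> \<longrightarrow> g x = 0) \<longrightarrow>
    0 < s \<longrightarrow> finite F \<longrightarrow> F \<subseteq> cubes \<longrightarrow>
    (\<forall>q\<in>F. ennreal (s * 2 powr (real_of_int (fst q) * (\<theta> / p))) \<le> (\<integral>\<^sup>+x. ennreal (g x) * indicator (snd q) x \<partial>lebesgue)) \<longrightarrow>
    (\<Sum>q\<in>F. ennreal (2 powr (real_of_int (fst q) * \<theta>) * cube_weight p \<Omega> w (snd q)))
      \<le> ennreal (C * s powr - p) * (\<integral>\<^sup>+x. ennreal (g x powr p * w x) \<partial>lebesgue_on \<Omega>)"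
proof -
  define a where "a = (if p = 1 then 1 else p - 1)"
  have a: "0 < a" using p by (auto simp: a_def)
  have "\<theta> < 0 \<or> real DIM('a) < \<theta> / p" using p \<theta> by (auto simp: field_simps)
  from cube_sum_abstract[OF a this] obtain C where C: "0 \<le> C" and sum_le:
    "\<And>(F :: (int \<times> 'a set) set) (\<tau> :: int \<times> 'a set \<Rightarrow> real) v K G \<phi>.
    finite F \<Longrightarrow> F \<subseteq> cubes \<Longrightarrow> 0 \<le> K \<Longrightarrow> G \<in> borel_measurable lebesgue \<Longrightarrow> \<phi> \<in> borel_measurable lebesgue \<Longrightarrow>
    (\<forall>q\<in>F. 0 < \<tau> q \<and> 0 < v (snd q)) \<Longrightarrow>
    (\<forall>q\<in>F. \<forall>r\<in>F. snd q \<subseteq> snd r \<longrightarrow> v (snd r) \<le> v (snd q)) \<Longrightarrow>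
    (\<forall>q\<in>F. 2 powr (real_of_int (fst q) * \<theta>) * v (snd q) = 2 powr (real_of_int (fst q) * (\<theta> / p)) * \<tau> q powr a) \<Longrightarrow>
    (\<forall>q\<in>F. ennreal (2 powr (real_of_int (fst q) * (\<theta> / p)))
      \<le> ennreal K * (\<integral>\<^sup>+x. G x * indicator {x. \<tau> q \<le> \<phi> x} x * indicator (snd q) x \<partial>lebesgue)) \<Longrightarrow>
    (\<Sum>q\<in>F. ennreal (2 powr (real_of_int (fst q) * \<theta>) * v (snd q)))
      \<le> ennreal (C * K) * (\<integral>\<^sup>+x. G x * ennreal (\<phi> x powr a) \<partial>lebesgue)"
    by blast
  show ?thesis
  \<comment> \<open>The factor 2^p is the cost of keeping only half of the mass when p > 1: it
    arises from (2/s) (2/s)^(p-1).\<close>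
  proof (intro exI[of _ "C * 2 powr p"] conjI allI impI)
    show "0 \<le> C * 2 powr p" using C by simp
  next
    fix \<Omega> :: "'a set" and w g :: "'a \<Rightarrow> real" and s :: real and F :: "(int \<times> 'a set) set"
    assume \<Omega>: "open \<Omega>" "weight \<Omega> w" and g: "g \<in> borel_measurable borel" "\<forall>x. 0 \<le> g x" "\<forall>x. x \<notin> \<Omega> \<longrightarrow> g x = 0"
      and s: "0 < s" and F: "finite F" "F \<subseteq> cubes"
      and low: "\<forall>q\<in>F. ennreal (s * 2 powr (real_of_int (fst q) * (\<theta> / p))) \<le> (\<integral>\<^sup>+x. ennreal (g x) * indicator (snd q) x \<partial>lebesgue)"
    define v where "v = cube_weight p \<Omega> w"
    \<comment> \<open>Cubes of weight 0 add nothing to the sum and are removed, since their level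
      \<tau> and the monotonicity of \<open>v\<close> rest on default values.\<close>
    define F' where "F' = {q\<in>F. 0 < v (snd q)}"
    define w0 where "w0 x = w x * indicator \<Omega> x" for x
    have F': "finite F'" "F' \<subseteq> cubes" "F' \<subseteq> F" using F by (auto simp: F'_def)
    have [measurable]: "w0 \<in> borel_measurable lebesgue"
      unfolding w0_def by (rule weight_borel_lebesgue) fact+
    have [measurable]: "g \<in> borel_measurable lebesgue"
      using g(1) by (auto intro: measurable_completion)
    have w0: "0 \<le> w x" if "x \<in> \<Omega>" for x using that \<Omega>(2) by (auto simp: weight_def)
    have sb: "snd q \<in> sets borel" if "q \<in> F'" for q
      using that F' cubes_borel[of "fst q" "snd q"] by auto
    have mono: "\<forall>q\<in>F'. \<forall>r\<in>F'. snd q \<subseteq> snd r \<longrightarrow> v (snd r) \<le> v (snd q)"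
      using cube_weight_antimono[OF p _ sb sb \<Omega>(1)] unfolding v_def F'_def by auto
    have X: "(\<integral>\<^sup>+x. ennreal (g x powr p * w x) \<partial>lebesgue_on \<Omega>) = (\<integral>\<^sup>+x. ennreal (g x powr p * w0 x) \<partial>lebesgue)"
      using \<Omega>(1) by (subst nn_integral_lebesgue_on) (auto intro!: nn_integral_cong simp: w0_def indicator_def)
    have "(\<Sum>q\<in>F. ennreal (2 powr (real_of_int (fst q) * \<theta>) * v (snd q)))
        = (\<Sum>q\<in>F'. ennreal (2 powr (real_of_int (fst q) * \<theta>) * v (snd q)))"
      using F by (intro sum.mono_neutral_right) (auto simp: F'_def v_def less_le)
    also have "\<dots> \<le> ennreal (C * 2 powr p * s powr - p) * (\<integral>\<^sup>+x. ennreal (g x powr p * w0 x) \<partial>lebesgue)"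
    proof (cases "p = 1")
      case True
      have "(\<Sum>q\<in>F'. ennreal (2 powr (real_of_int (fst q) * \<theta>) * v (snd q)))
          \<le> ennreal (C * (1 / s)) * (\<integral>\<^sup>+x. ennreal (g x) * ennreal (w0 x powr a) \<partial>lebesgue)"
      proof (rule sum_le[where \<tau> = "\<lambda>q. v (snd q)"])
        show "\<forall>q\<in>F'. ennreal (2 powr (real_of_int (fst q) * (\<theta> / p)))
          \<le> ennreal (1 / s) * (\<integral>\<^sup>+x. ennreal (g x) * indicator {x. v (snd q) \<le> w0 x} x * indicator (snd q) x \<partial>lebesgue)"
        proof
          fix q assume q: "q \<in> F'"
          show "ennreal (2 powr (real_of_int (fst q) * (\<theta> / p)))
            \<le> ennreal (1 / s) * (\<integral>\<^sup>+x. ennreal (g x) * indicator {x. v (snd q) \<le> w0 x} x * indicator (snd q) x \<partial>lebesgue)"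
            unfolding w0_def
            by (rule cube_level_ess_inf[OF \<Omega> g(1) _ s sb[OF q]])
              (use g low q F'(3) True in \<open>auto simp: v_def cube_weight_def\<close>)
        qed
      qed (use F' s mono True in \<open>auto simp: a_def F'_def\<close>)
      also have "ennreal (C * (1 / s)) \<le> ennreal (C * 2 powr p * s powr - p)"
        using C s True by (intro ennreal_leI) (auto simp: powr_minus field_simps)
      also have "(\<integral>\<^sup>+x. ennreal (g x) * ennreal (w0 x powr a) \<partial>lebesgue) = (\<integral>\<^sup>+x. ennreal (g x powr p * w0 x) \<partial>lebesgue)"
        using True g(2) w0 by (intro nn_integral_cong) (auto simp: a_def ennreal_mult w0_def indicator_def)
      finally show ?thesis by (simp add: mult_right_mono)
    next
      case False
      then have p1: "1 < p" using p by simp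
      then have a_eq: "a = p - 1" by (simp add: a_def)
      define b where "b = 1 / (p - 1)"
      have b: "0 < b" using p1 by (simp add: b_def)
      define \<sigma> where "\<sigma> Q = (\<integral>\<^sup>+x. epowr (ennreal (w x)) (- b) * indicator (Q \<inter> \<Omega>) x \<partial>lebesgue)" for Q
      have v: "v Q = enn2real (\<sigma> Q) powr (1 - p)" for Q
        using False p1 by (simp add: v_def cube_weight_def \<sigma>_def b_def conj_exp_div)
      define \<tau> where "\<tau> q = 2 powr (real_of_int (fst q) * (\<theta> / p)) / enn2real (\<sigma> (snd q))" for q :: "int \<times> 'a set"
      have \<sigma>: "0 < enn2real (\<sigma> (snd q))" if "q \<in> F'" for q
        using that by (auto simp: F'_def v enn2real_nonneg less_le)
      let ?\<phi> = "\<lambda>x. 2 / s * g x * w0 x powr b"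
      have "(\<Sum>q\<in>F'. ennreal (2 powr (real_of_int (fst q) * \<theta>) * v (snd q)))
          \<le> ennreal (C * (2 / s)) * (\<integral>\<^sup>+x. ennreal (g x) * ennreal (?\<phi> x powr a) \<partial>lebesgue)"
      proof (rule sum_le[where \<tau> = \<tau>])
        show "\<forall>q\<in>F'. ennreal (2 powr (real_of_int (fst q) * (\<theta> / p)))
          \<le> ennreal (2 / s) * (\<integral>\<^sup>+x. ennreal (g x) * indicator {x. \<tau> q \<le> ?\<phi> x} x * indicator (snd q) x \<partial>lebesgue)"
        proof
          fix q assume q: "q \<in> F'"
          have fin: "\<sigma> (snd q) = ennreal (enn2real (\<sigma> (snd q)))"
            using \<sigma>[OF q] by (simp add: enn2real_positive_iff)
          show "ennreal (2 powr (real_of_int (fst q) * (\<theta> / p)))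
            \<le> ennreal (2 / s) * (\<integral>\<^sup>+x. ennreal (g x) * indicator {x. \<tau> q \<le> ?\<phi> x} x * indicator (snd q) x \<partial>lebesgue)"
            unfolding w0_def
          proof (rule cube_level_dual_weight[OF \<Omega> g(1) _ _ s sb[OF q] b])
            have "ennreal (\<tau> q) * ennreal (enn2real (\<sigma> (snd q))) = ennreal (2 powr (real_of_int (fst q) * (\<theta> / p)))"
              using \<sigma>[OF q] by (simp add: \<tau>_def ennreal_mult [symmetric])
            then show "ennreal (\<tau> q) * (\<integral>\<^sup>+x. epowr (ennreal (w x)) (- b) * indicator (snd q \<inter> \<Omega>) x \<partial>lebesgue)
              \<le> ennreal (2 powr (real_of_int (fst q) * (\<theta> / p)))"
              using fin by (simp add: \<sigma>_def)
          qed (use g low q F'(3) \<sigma>[OF q] in \<open>auto simp: \<tau>_def\<close>)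
        qed
        show "\<forall>q\<in>F'. 2 powr (real_of_int (fst q) * \<theta>) * v (snd q) = 2 powr (real_of_int (fst q) * (\<theta> / p)) * \<tau> q powr a"
        proof
          fix q assume q: "q \<in> F'"
          have "2 powr (real_of_int (fst q) * (\<theta> / p)) * \<tau> q powr a
              = 2 powr (real_of_int (fst q) * (\<theta> / p)) * (2 powr (real_of_int (fst q) * (\<theta> / p) * a) * enn2real (\<sigma> (snd q)) powr - a)"
            using \<sigma>[OF q] by (simp add: \<tau>_def powr_divide powr_powr powr_minus_divide)
          also have "\<dots> = 2 powr (real_of_int (fst q) * (\<theta> / p) + real_of_int (fst q) * (\<theta> / p) * a) * v (snd q)"
            by (simp add: powr_add v a_eq)
          also have "real_of_int (fst q) * (\<theta> / p) + real_of_int (fst q) * (\<theta> / p) * a = real_of_int (fst q) * \<theta>"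
            using p1 by (simp add: a_eq field_simps)
          finally show "2 powr (real_of_int (fst q) * \<theta>) * v (snd q) = 2 powr (real_of_int (fst q) * (\<theta> / p)) * \<tau> q powr a" ..
        qed
      qed (use F' s mono \<sigma> in \<open>auto simp: F'_def \<tau>_def\<close>)
      also have "(\<integral>\<^sup>+x. ennreal (g x) * ennreal (?\<phi> x powr a) \<partial>lebesgue)
          = (\<integral>\<^sup>+x. ennreal ((2 / s) powr a) * ennreal (g x powr p * w0 x) \<partial>lebesgue)"
      proof (rule nn_integral_cong)
        fix x
        have "g x * (?\<phi> x powr a) = (2 / s) powr a * (g x powr p * w0 x)"
        proof (cases "g x = 0 \<or> w0 x = 0")
          case True
          then show ?thesis using a p1 by auto
        next
          case nz: False
          then have gx: "0 < g x" using g(2)[rule_format, of x] by simp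
          have wx: "0 < w0 x" using nz w0[of x] by (auto simp: w0_def indicator_def less_le split: if_splits)
          have "g x * (?\<phi> x powr a) = (2 / s) powr a * (g x * g x powr a) * w0 x powr (b * a)"
            using gx wx s by (simp only: powr_mult powr_powr) (simp add: mult_ac powr_mult del: times_divide_eq_left times_divide_eq_right)
          also have "g x * g x powr a = g x powr p"
            using gx by (simp add: a_eq powr_mult_base)
          also have "b * a = 1" using p1 by (simp add: a_eq b_def)
          finally show ?thesis using wx by (simp add: mult.assoc)
        qed
        then show "ennreal (g x) * ennreal (?\<phi> x powr a) = ennreal ((2 / s) powr a) * ennreal (g x powr p * w0 x)"
          using g(2) w0 by (simp add: ennreal_mult [symmetric] w0_def indicator_def)
      qed
      also have "\<dots> = ennreal ((2 / s) powr a) * (\<integral>\<^sup>+x. ennreal (g x powr p * w0 x) \<partial>lebesgue)"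
        by (rule nn_integral_cmult) measurable
      also have "ennreal (C * (2 / s)) * (ennreal ((2 / s) powr a) * (\<integral>\<^sup>+x. ennreal (g x powr p * w0 x) \<partial>lebesgue))
          = ennreal (C * ((2 / s) * (2 / s) powr a)) * (\<integral>\<^sup>+x. ennreal (g x powr p * w0 x) \<partial>lebesgue)"
        using C s by (subst mult.assoc [symmetric], subst ennreal_mult [symmetric]) (auto simp: mult_ac)
      also have "(2 / s) * (2 / s) powr a = 2 powr p * s powr - p"
        using s by (simp add: a_eq powr_mult_base powr_divide powr_minus_divide)
      finally show ?thesis by (simp add: mult.assoc)
    qed
    finally show "(\<Sum>q\<in>F. ennreal (2 powr (real_of_int (fst q) * \<theta>) * cube_weight p \<Omega> w (snd q)))
      \<le> ennreal (C * 2 powr p * s powr - p) * (\<integral>\<^sup>+x. ennreal (g x powr p * w x) \<partial>lebesgue_on \<Omega>)"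
      unfolding X v_def .
  qed
qed


subsection \<open>Oscillation of a continuously differentiable function\<close>

text \<open>The coordinates of the derivative on the basis represent it as an inner product, and
  derivatives are unique; hence the description in \<open>gradient\<close> denotes this
  vector.\<close>

lemma gradient_has_derivative:
  assumes "f differentiable (at x)"
  shows "(f has_derivative (\<lambda>h. h \<bullet> gradient f x)) (at x)"
proof -
  obtain f' where f': "(f has_derivative f') (at x)"
    using assms by (auto simp: differentiable_def)
  then have "linear f'" by (rule has_derivative_linear)
  then have "f' h = h \<bullet> (\<Sum>b\<in>Basis. f' b *\<^sub>R b)" for h
  proof -
    assume lin: "linear f'"
    have "f' h = f' (\<Sum>b\<in>Basis. (h \<bullet> b) *\<^sub>R b)"
      by (simp add: euclidean_representation)
    also have "\<dots> = (\<Sum>b\<in>Basis. (h \<bullet> b) * f' b)"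
      using lin by (simp add: linear_sum linear_scale)
    finally show ?thesis by (simp add: inner_sum_right mult.commute)
  qed
  then have "f' = (\<lambda>h. h \<bullet> (\<Sum>b\<in>Basis. f' b *\<^sub>R b))" by blast
  then have ex: "GDERIV f x :> (\<Sum>b\<in>Basis. f' b *\<^sub>R b)"
    using f' by (simp add: gderiv_def)
  have uniq: "D = D'" if "GDERIV f x :> D" "GDERIV f x :> D'" for D D'
  proof -
    have "(\<lambda>h. h \<bullet> D) = (\<lambda>h. h \<bullet> D')"
      using that unfolding gderiv_def by (rule has_derivative_unique)
    then have "(D - D') \<bullet> D = (D - D') \<bullet> D'" by metis
    then have "(D - D') \<bullet> (D - D') = 0" by (simp add: inner_diff_right)
    then show ?thesis by simp
  qed
  have "GDERIV f x :> gradient f x"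
    unfolding gradient_def by (rule theI[of "\<lambda>D. GDERIV f x :> D", OF ex uniq[OF _ ex]])
  then show ?thesis by (simp add: gderiv_def)
qed

text \<open>Cut off outside \<Omega>, where \<open>f\<close> is arbitrary, to obtain a Borel
  function on the whole space.\<close>

definition grad_norm :: "'a::euclidean_space set \<Rightarrow> ('a \<Rightarrow> real) \<Rightarrow> 'a \<Rightarrow> real" where
  "grad_norm \<Omega> f x = norm (gradient f x) * indicator \<Omega> x"

lemma grad_norm_simps [simp]: "0 \<le> grad_norm \<Omega> f x" "x \<notin> \<Omega> \<Longrightarrow> grad_norm \<Omega> f x = 0"
  "x \<in> \<Omega> \<Longrightarrow> grad_norm \<Omega> f x = norm (gradient f x)"
  by (auto simp: grad_norm_def)

lemma grad_norm_borel:
  assumes "open \<Omega>" "C1_on \<Omega> f"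
  shows "grad_norm \<Omega> f \<in> borel_measurable borel"
proof -
  have "(\<lambda>x. indicator \<Omega> x *\<^sub>R norm (gradient f x)) \<in> borel_measurable borel"
    using assms by (intro borel_measurable_continuous_on_indicator continuous_intros) (auto simp: C1_on_def)
  then show ?thesis by (simp add: grad_norm_def [abs_def] mult.commute)
qed

text \<open>The fundamental theorem of calculus along the segment, which stays in \<Omega> by
  convexity. The bound is a nonnegative extended integral so that Tonelli's theorem can be applied
  to it in z.\<close>

lemma segment_bound:
  assumes \<Omega>: "open \<Omega>" "convex \<Omega>" and f: "C1_on \<Omega> f" and az: "a \<in> \<Omega>" "z \<in> \<Omega>"
  shows "ennreal \<bar>f a - f z\<bar> \<le>
    ennreal (norm (z - a)) * (\<integral>\<^sup>+t. ennreal (grad_norm \<Omega> f (a + t *\<^sub>R (z - a))) * indicator {0..1} t \<partial>lborel)"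
proof -
  define \<phi> where "\<phi> t = a + t *\<^sub>R (z - a)" for t
  have in\<Omega>: "\<phi> t \<in> \<Omega>" if "t \<in> {0..1}" for t
  proof -
    have "\<phi> t = (1 - t) *\<^sub>R a + t *\<^sub>R z" by (simp add: \<phi>_def algebra_simps)
    then show ?thesis using \<Omega>(2) az that by (auto intro: convexD)
  qed
  have der: "((\<lambda>t. f (\<phi> t)) has_vector_derivative (z - a) \<bullet> gradient f (\<phi> t)) (at t within {0..1})"
    if "t \<in> {0..1}" for t
  proof -
    have "(\<phi> has_derivative (\<lambda>h. h *\<^sub>R (z - a))) (at t within {0..1})"
      unfolding \<phi>_def [abs_def] by (auto intro!: derivative_eq_intros)
    moreover have "(f has_derivative (\<lambda>h. h \<bullet> gradient f (\<phi> t))) (at (\<phi> t))"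
      using f in\<Omega>[OF that] by (intro gradient_has_derivative) (auto simp: C1_on_def)
    ultimately have "((\<lambda>t. f (\<phi> t)) has_derivative (\<lambda>h. (h *\<^sub>R (z - a)) \<bullet> gradient f (\<phi> t))) (at t within {0..1})"
      by (rule has_derivative_compose)
    then show ?thesis by (simp add: has_vector_derivative_def)
  qed
  have int1: "((\<lambda>t. (z - a) \<bullet> gradient f (\<phi> t)) has_integral (f (\<phi> 1) - f (\<phi> 0))) {0..1}"
    by (rule fundamental_theorem_of_calculus) (use der in auto)
  have cont: "continuous_on {0..1} (\<lambda>t. gradient f (\<phi> t))"
  proof (rule continuous_on_compose2[where s = "{0..1}" and f = \<phi> and g = "gradient f" and t = \<Omega>])
    show "continuous_on \<Omega> (gradient f)" using f by (simp add: C1_on_def)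
    show "continuous_on {0..1} \<phi>" unfolding \<phi>_def by (intro continuous_intros)
  qed (use in\<Omega> in auto)
  have "continuous_on {0..1} (\<lambda>t. norm (z - a) * norm (gradient f (\<phi> t)))"
    using cont by (intro continuous_intros)
  then have "(\<lambda>t. norm (z - a) * norm (gradient f (\<phi> t))) integrable_on {0..1}"
    by (rule integrable_continuous_real)
  then obtain I where int2: "((\<lambda>t. norm (z - a) * norm (gradient f (\<phi> t))) has_integral I) {0..1}"
    by (auto simp: integrable_on_def)
  have "norm (f (\<phi> 1) - f (\<phi> 0)) \<le> I"
  proof -
    have "norm (integral {0..1} (\<lambda>t. (z - a) \<bullet> gradient f (\<phi> t)))
        \<le> integral {0..1} (\<lambda>t. norm (z - a) * norm (gradient f (\<phi> t)))"
      using int1 int2 by (intro integral_norm_bound_integral) (auto simp: norm_cauchy_schwarz has_integral_integrable Cauchy_Schwarz_ineq2)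
    then show ?thesis
      by (simp only: integral_unique[OF int1] integral_unique[OF int2])
  qed
  then have "ennreal \<bar>f a - f z\<bar> \<le> ennreal I"
    by (intro ennreal_leI) (simp add: \<phi>_def)
  also have "ennreal I = (\<integral>\<^sup>+t. ennreal (norm (z - a) * norm (gradient f (\<phi> t))) * indicator {0..1} t \<partial>lborel)"
    by (rule nn_integral_has_integral_lebesgue' [OF _ int2, symmetric]) simp
  also have "\<dots> = (\<integral>\<^sup>+t. ennreal (norm (z - a)) * (ennreal (grad_norm \<Omega> f (\<phi> t)) * indicator {0..1} t) \<partial>lborel)"
    using in\<Omega> by (intro nn_integral_cong) (auto simp: indicator_def ennreal_mult)
  also have "\<dots> = ennreal (norm (z - a)) * (\<integral>\<^sup>+t. ennreal (grad_norm \<Omega> f (\<phi> t)) * indicator {0..1} t \<partial>lborel)"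
  proof (rule nn_integral_cmult)
    have [measurable]: "grad_norm \<Omega> f \<in> borel_measurable borel" by (rule grad_norm_borel) fact+
    show "(\<lambda>t. ennreal (grad_norm \<Omega> f (\<phi> t)) * indicator {0..1} t) \<in> borel_measurable lborel"
      unfolding \<phi>_def by measurable
  qed
  finally show ?thesis by (simp add: \<phi>_def)
qed

text \<open>Change of variables under the homothety with center \<open>a\<close> and ratio
  \<open>t\<close>, which maps the ball of radius R onto that of radius tR with Jacobian
  t^d.\<close>

lemma nn_integral_ball_dilation:
  fixes G :: "'a::euclidean_space \<Rightarrow> ennreal"
  assumes [measurable]: "G \<in> borel_measurable borel" and t: "0 < t"
  shows "(\<integral>\<^sup>+z. G (a + t *\<^sub>R (z - a)) * indicator (ball a R) z \<partial>lborel)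
    = ennreal (t powr - real DIM('a)) * (\<integral>\<^sup>+z. G z * indicator (ball a (t * R)) z \<partial>lborel)"
proof -
  define T where "T x = (a - t *\<^sub>R a) + t *\<^sub>R x" for x
  have [measurable]: "ball a (t * R) \<in> sets borel" by simp
  have [measurable]: "T \<in> borel \<rightarrow>\<^sub>M borel" unfolding T_def by measurable
  have ind: "indicator (ball a (t * R)) (T x) = (indicator (ball a R) x :: ennreal)" for x
  proof -
    have "a - T x = t *\<^sub>R (a - x)" by (simp add: T_def algebra_simps)
    then have "dist a (T x) = t * dist a x" using t by (simp add: dist_norm)
    then show ?thesis using t by (simp add: indicator_def)
  qed
  have Teq: "T x = a + t *\<^sub>R (x - a)" for x by (simp add: T_def algebra_simps)
  have "(\<integral>\<^sup>+z. G z * indicator (ball a (t * R)) z \<partial>lborel)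
      = (\<integral>\<^sup>+z. G z * indicator (ball a (t * R)) z \<partial>density (distr lborel borel T) (\<lambda>_. ennreal (\<bar>t\<bar> ^ DIM('a))))"
    using t lborel_affine[of t "a - t *\<^sub>R a"] by (simp add: T_def [abs_def])
  also have "\<dots> = (\<integral>\<^sup>+z. ennreal (\<bar>t\<bar> ^ DIM('a)) * (G (T z) * indicator (ball a (t * R)) (T z)) \<partial>lborel)"
    by (subst nn_integral_density, measurable) (subst nn_integral_distr, measurable)
  also have "\<dots> = ennreal (t powr real DIM('a)) * (\<integral>\<^sup>+z. G (T z) * indicator (ball a R) z \<partial>lborel)"
    using t by (subst nn_integral_cmult, measurable) (simp add: ind powr_realpow)
  finally have "ennreal (t powr - real DIM('a)) * (\<integral>\<^sup>+z. G z * indicator (ball a (t * R)) z \<partial>lborel)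
      = ennreal (t powr - real DIM('a) * t powr real DIM('a)) * (\<integral>\<^sup>+z. G (T z) * indicator (ball a R) z \<partial>lborel)"
    by (simp add: ennreal_mult mult.assoc)
  also have "t powr - real DIM('a) * t powr real DIM('a) = 1"
    using t by (simp add: powr_add [symmetric])
  finally show ?thesis by (simp add: Teq)
qed

lemma dyadic_unit_interval:
  assumes "0 < t" "t \<le> (1::real)"
  shows "\<exists>j::nat. t \<in> {2 powr (- real j - 1)<..2 powr (- real j)}"
proof -
  define j where "j = nat \<lfloor>- log 2 t\<rfloor>"
  have "0 \<le> - log 2 t" using assms by (simp add: log_le_zero_cancel_iff)
  then have "real j \<le> - log 2 t" "- log 2 t < real j + 1"
    unfolding j_def by linarith+
  then have "log 2 t \<le> - real j" "- real j - 1 < log 2 t" by linarith+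
  then show ?thesis
    using assms by (auto simp: log_le_iff less_log_iff)
qed

lemma le_suminf_ennreal: "f j \<le> (\<Sum>i. f i)" for f :: "nat \<Rightarrow> ennreal"
  using sum_le_suminf[of f "{j}"] by (simp add: summableI)

text \<open>After exchanging the integrals and dilating, the inner integral is t^(-d) times the mass
  of \<open>G\<close> on the ball of radius tR. On the dyadic interval of t near 2^(-j) this is at
  most 2^((j+1)d) times the mass for radius 2^(-j) R, and the length 2^(-j-1) of the interval leaves
  the weight 2^(j(d-1)).\<close>

lemma ball_average_of_segments_le:
  fixes G :: "'a::euclidean_space \<Rightarrow> ennreal"
  assumes [measurable]: "G \<in> borel_measurable borel" and R: "0 < R"
  shows "(\<integral>\<^sup>+z. (\<integral>\<^sup>+t. G (a + t *\<^sub>R (z - a)) * indicator {0..1} t \<partial>lborel) * indicator (ball a R) z \<partial>lborel)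
    \<le> (\<Sum>j. ennreal (2 powr real DIM('a) * 2 powr (real j * (real DIM('a) - 1)))
        * (\<integral>\<^sup>+z. G z * indicator (ball a (2 powr (- real j) * R)) z \<partial>lborel))"
proof -
  let ?d = "real DIM('a)"
  let ?I = "\<lambda>j::nat. \<integral>\<^sup>+z. G z * indicator (ball a (2 powr (- real j) * R)) z \<partial>lborel"
  have [measurable]: "ball a r \<in> sets borel" for r :: real by simp
  let ?A = "\<lambda>j::nat. {2 powr (- real j - 1)<..2 powr (- real j)}"
  have "(\<integral>\<^sup>+z. (\<integral>\<^sup>+t. G (a + t *\<^sub>R (z - a)) * indicator {0..1} t \<partial>lborel) * indicator (ball a R) z \<partial>lborel)
      = (\<integral>\<^sup>+z. (\<integral>\<^sup>+t. G (a + t *\<^sub>R (z - a)) * indicator {0..1} t * indicator (ball a R) z \<partial>lborel) \<partial>lborel)"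
    by (intro nn_integral_cong nn_integral_multc [symmetric]) measurable
  also have "\<dots> = (\<integral>\<^sup>+t. (\<integral>\<^sup>+z. G (a + t *\<^sub>R (z - a)) * indicator {0..1} t * indicator (ball a R) z \<partial>lborel) \<partial>lborel)"
    by (rule lborel_pair.Fubini') measurable
  also have "\<dots> \<le> (\<integral>\<^sup>+t. (\<Sum>j. ennreal (2 powr ((real j + 1) * ?d)) * ?I j * indicator (?A j) t) \<partial>lborel)"
  proof (rule nn_integral_mono_AE)
    \<comment> \<open>The dyadic intervals cover the unit interval except for t = 0.\<close>
    have "AE t in lborel. t \<noteq> (0::real)" by (rule AE_lborel_singleton)
    then show "AE t in lborel. (\<integral>\<^sup>+z. G (a + t *\<^sub>R (z - a)) * indicator {0..1} t * indicator (ball a R) z \<partial>lborel)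
       \<le> (\<Sum>j. ennreal (2 powr ((real j + 1) * ?d)) * ?I j * indicator (?A j) t)"
    proof eventually_elim
      case (elim t)
      show ?case
      proof (cases "0 < t \<and> t \<le> 1")
        case True
        then obtain j where j: "t \<in> ?A j" using dyadic_unit_interval by blast
        have "(\<integral>\<^sup>+z. G (a + t *\<^sub>R (z - a)) * indicator {0..1} t * indicator (ball a R) z \<partial>lborel)
            = ennreal (t powr - ?d) * (\<integral>\<^sup>+z. G z * indicator (ball a (t * R)) z \<partial>lborel)"
          using True by (subst nn_integral_ball_dilation [symmetric]) auto
        also have "\<dots> \<le> ennreal (2 powr ((real j + 1) * ?d)) * ?I j"
        proof (rule mult_mono)
          have "t powr - ?d \<le> (2 powr (- real j - 1)) powr - ?d"
            using j by (intro powr_mono2') auto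
          also have "\<dots> = 2 powr ((real j + 1) * ?d)"
            by (simp add: powr_powr algebra_simps)
          finally show "ennreal (t powr - ?d) \<le> ennreal (2 powr ((real j + 1) * ?d))"
            by (rule ennreal_leI)
          have "t * R \<le> 2 powr (- real j) * R" using j R by (intro mult_right_mono) auto
          then show "(\<integral>\<^sup>+z. G z * indicator (ball a (t * R)) z \<partial>lborel) \<le> ?I j"
            by (intro nn_integral_mono mult_left_mono) (auto simp: indicator_def)
        qed auto
        also have "\<dots> = ennreal (2 powr ((real j + 1) * ?d)) * ?I j * indicator (?A j) t"
          using j by simp
        also have "\<dots> \<le> (\<Sum>j. ennreal (2 powr ((real j + 1) * ?d)) * ?I j * indicator (?A j) t)"
          by (rule le_suminf_ennreal[of "\<lambda>j. ennreal (2 powr ((real j + 1) * ?d)) * ?I j * indicator (?A j) t"])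
        finally show ?thesis .
      next
        case False
        then have "t \<notin> {0..1}" using elim by auto
        then show ?thesis by simp
      qed
    qed
  qed
  also have "\<dots> = (\<Sum>j. \<integral>\<^sup>+t. ennreal (2 powr ((real j + 1) * ?d)) * ?I j * indicator (?A j) t \<partial>lborel)"
    by (rule nn_integral_suminf) measurable
  also have "\<dots> \<le> (\<Sum>j. ennreal (2 powr ?d * 2 powr (real j * (?d - 1))) * ?I j)"
  proof (rule suminf_le)
    fix j
    have "2 powr (- real j) - 2 powr (- real j - 1) = 2 powr (- real j - 1)"
      by (simp add: powr_diff)
    then have "2 powr ((real j + 1) * ?d) * (2 powr (- real j) - 2 powr (- real j - 1))
        = 2 powr (?d + real j * (?d - 1) - 1)"
      by (simp add: powr_add [symmetric] algebra_simps)
    also have "\<dots> \<le> 2 powr (?d + real j * (?d - 1))"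
      by (intro powr_mono) auto
    finally have le: "2 powr ((real j + 1) * ?d) * (2 powr (- real j) - 2 powr (- real j - 1))
        \<le> 2 powr ?d * 2 powr (real j * (?d - 1))"
      by (simp only: powr_add)
    have "(\<integral>\<^sup>+t. ennreal (2 powr ((real j + 1) * ?d)) * ?I j * indicator (?A j) t \<partial>lborel)
        = ennreal (2 powr ((real j + 1) * ?d)) * ?I j * ennreal (2 powr (- real j) - 2 powr (- real j - 1))"
      by (subst nn_integral_cmult_indicator) auto
    also have "\<dots> = ennreal (2 powr ((real j + 1) * ?d) * (2 powr (- real j) - 2 powr (- real j - 1))) * ?I j"
      by (simp add: ennreal_mult'' mult_ac)
    also have "\<dots> \<le> ennreal (2 powr ?d * 2 powr (real j * (?d - 1))) * ?I j"
      by (intro mult_right_mono ennreal_leI le) simp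
    finally show "(\<integral>\<^sup>+t. ennreal (2 powr ((real j + 1) * ?d)) * ?I j * indicator (?A j) t \<partial>lborel)
        \<le> ennreal (2 powr ?d * 2 powr (real j * (?d - 1))) * ?I j" .
  qed (auto intro: summableI)
  finally show ?thesis .
qed

text \<open>The difference is split at a point z of the ball around x inside \<Omega> and then
  integrated over z. Such z is at distance less than 2r from both x and y, so both segment averages
  extend over balls of radius 2r.\<close>

lemma oscillation_bound:
  fixes \<Omega> :: "'a::euclidean_space set"
  assumes \<Omega>: "open \<Omega>" "convex \<Omega>" and f: "C1_on \<Omega> f" and xy: "x \<in> \<Omega>" "y \<in> \<Omega>"
    and r: "r = norm (x - y)" "0 < r"
  shows "ennreal \<bar>f x - f y\<bar> * emeasure lborel (ball x r \<inter> \<Omega>)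
    \<le> ennreal (2 * r) * (\<Sum>j. ennreal (2 powr real DIM('a) * 2 powr (real j * (real DIM('a) - 1)))
      * ((\<integral>\<^sup>+z. ennreal (grad_norm \<Omega> f z) * indicator (ball x (2 powr (- real j) * (2 * r))) z \<partial>lborel)
       + (\<integral>\<^sup>+z. ennreal (grad_norm \<Omega> f z) * indicator (ball y (2 powr (- real j) * (2 * r))) z \<partial>lborel)))"
proof -
  let ?S = "ball x r \<inter> \<Omega>"
  let ?c = "\<lambda>j. ennreal (2 powr real DIM('a) * 2 powr (real j * (real DIM('a) - 1)))"
  let ?I = "\<lambda>a j. \<integral>\<^sup>+z. ennreal (grad_norm \<Omega> f z) * indicator (ball a (2 powr (- real j) * (2 * r))) z \<partial>lborel"
  let ?H = "\<lambda>a z. \<integral>\<^sup>+t. ennreal (grad_norm \<Omega> f (a + t *\<^sub>R (z - a))) * indicator {0..1} t \<partial>lborel"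
  have [measurable]: "grad_norm \<Omega> f \<in> borel_measurable borel" by (rule grad_norm_borel) fact+
  have [measurable]: "\<Omega> \<in> sets borel" "ball a s \<in> sets borel" for a :: 'a and s using \<Omega>(1) by auto
  have seg: "ennreal \<bar>f a - f z\<bar> \<le> ennreal (2 * r) * ?H a z" if "a = x \<or> a = y" "z \<in> ?S" for a z
  proof -
    have "norm (z - a) \<le> 2 * r"
    proof -
      have "norm (z - x) < r" using that by (simp add: dist_norm norm_minus_commute)
      moreover have "norm (z - y) \<le> norm (z - x) + norm (x - y)"
        using norm_triangle_ineq[of "z - x" "x - y"] by simp
      ultimately show ?thesis using that(1) r by (elim disjE; hypsubst; linarith)
    qed
    then have "ennreal (norm (z - a)) * ?H a z \<le> ennreal (2 * r) * ?H a z"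
      by (intro mult_right_mono ennreal_leI) auto
    then show ?thesis
      using segment_bound[OF \<Omega> f, of a z] that xy by force
  qed
  have "ennreal \<bar>f x - f y\<bar> * emeasure lborel ?S = (\<integral>\<^sup>+z. ennreal \<bar>f x - f y\<bar> * indicator ?S z \<partial>lborel)"
    by (subst nn_integral_cmult_indicator) auto
  also have "\<dots> \<le> (\<integral>\<^sup>+z. ennreal (2 * r) * (?H x z * indicator (ball x (2 * r)) z + ?H y z * indicator (ball y (2 * r)) z) \<partial>lborel)"
  proof (rule nn_integral_mono)
    fix z
    show "ennreal \<bar>f x - f y\<bar> * indicator ?S z
      \<le> ennreal (2 * r) * (?H x z * indicator (ball x (2 * r)) z + ?H y z * indicator (ball y (2 * r)) z)"
    proof (cases "z \<in> ?S")
      case True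
      then have "norm (z - x) < r" by (simp add: dist_norm norm_minus_commute)
      moreover have "norm (z - y) \<le> norm (z - x) + norm (x - y)"
        using norm_triangle_ineq[of "z - x" "x - y"] by simp
      ultimately have "norm (z - x) < 2 * r" "norm (z - y) < 2 * r"
        using r by linarith+
      then have z: "z \<in> ball x (2 * r)" "z \<in> ball y (2 * r)"
        by (simp_all add: dist_norm norm_minus_commute)
      have "ennreal \<bar>f x - f y\<bar> \<le> ennreal \<bar>f x - f z\<bar> + ennreal \<bar>f y - f z\<bar>"
      proof -
        have "ennreal \<bar>f x - f y\<bar> \<le> ennreal (\<bar>f x - f z\<bar> + \<bar>f y - f z\<bar>)"
          by (intro ennreal_leI) linarith
        then show ?thesis by (simp only: ennreal_plus abs_ge_zero)
      qed
      also have "\<dots> \<le> ennreal (2 * r) * ?H x z + ennreal (2 * r) * ?H y z"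
        using True by (intro add_mono seg) auto
      finally show ?thesis
        using True z by (simp add: distrib_left)
    qed simp
  qed
  also have "\<dots> = ennreal (2 * r) * ((\<integral>\<^sup>+z. ?H x z * indicator (ball x (2 * r)) z \<partial>lborel)
      + (\<integral>\<^sup>+z. ?H y z * indicator (ball y (2 * r)) z \<partial>lborel))"
    by (subst nn_integral_cmult, measurable) (subst nn_integral_add, auto)
  also have "\<dots> \<le> ennreal (2 * r) * ((\<Sum>j. ?c j * ?I x j) + (\<Sum>j. ?c j * ?I y j))"
    using r by (intro mult_left_mono add_mono ball_average_of_segments_le) auto
  also have "(\<Sum>j. ?c j * ?I x j) + (\<Sum>j. ?c j * ?I y j) = (\<Sum>j. ?c j * (?I x j + ?I y j))"
    by (subst suminf_add) (auto simp: distrib_left intro!: summableI)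
  finally show ?thesis .
qed


section \<open>Cubes carrying much of the gradient\<close>

text \<open>The distance of two points of \<Omega> is an admissible radius in the supremum. The
  quotient can be multiplied out because the intersection is open and nonempty, hence of positive
  measure, and has finite measure.\<close>

lemma ball_deviation_ball:
  fixes \<Omega> :: "'a::euclidean_space set"
  assumes "open \<Omega>" "x \<in> \<Omega>" "y \<in> \<Omega>" "x \<noteq> y" and D: "ball_deviation \<Omega> = ennreal D" "0 \<le> D"
  shows "emeasure lborel (ball x (norm (x - y))) \<le> ennreal D * emeasure lborel (ball x (norm (x - y)) \<inter> \<Omega>)"
proof -
  let ?B = "ball x (norm (x - y))"
  have "ennreal (norm (x - y)) \<le> ediam \<Omega>"
    unfolding ediam_def using assms by (intro SUP_upper2[of x] SUP_upper2[of y]) auto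
  then have "emeasure lebesgue ?B / emeasure lebesgue (?B \<inter> \<Omega>) \<le> ball_deviation \<Omega>"
    unfolding ball_deviation_def using assms
    by (intro SUP_upper2[of x] SUP_upper2[of "norm (x - y)"]) auto
  then have le: "emeasure lborel ?B / emeasure lborel (?B \<inter> \<Omega>) \<le> ennreal D"
    using assms by (simp add: D)
  have "emeasure lborel (?B \<inter> \<Omega>) \<le> emeasure lborel ?B"
    using assms by (intro emeasure_mono) auto
  then have fin: "emeasure lborel (?B \<inter> \<Omega>) < top"
    by (rule le_less_trans) (simp add: emeasure_ball)
  have pos: "0 < emeasure lborel (?B \<inter> \<Omega>)"
  proof -
    have "x \<in> ?B \<inter> \<Omega>" "open (?B \<inter> \<Omega>)" using assms by auto
    then have "?B \<inter> \<Omega> \<noteq> {}" by blast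
    with \<open>open (?B \<inter> \<Omega>)\<close> have "\<not> negligible (?B \<inter> \<Omega>)" by (rule open_not_negligible)
    then have "?B \<inter> \<Omega> \<notin> null_sets lebesgue" by (simp add: negligible_iff_null_sets)
    then show ?thesis using \<open>open (?B \<inter> \<Omega>)\<close> by (auto simp: null_sets_def zero_less_iff_neq_zero)
  qed
  have "emeasure lborel ?B = emeasure lborel ?B / emeasure lborel (?B \<inter> \<Omega>) * emeasure lborel (?B \<inter> \<Omega>)"
    using pos fin by (simp add: ennreal_divide_times ennreal_times_divide [symmetric] ennreal_divide_self)
  also have "\<dots> \<le> ennreal D * emeasure lborel (?B \<inter> \<Omega>)"
    by (intro mult_right_mono le) simp
  finally show ?thesis .
qed

text \<open>Replacing r by 2^i changes the base by a factor of at most 2; the loss 2^(-|\<kappa>|)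
  covers either sign of the exponent.\<close>

lemma powr_dyadic_le:
  assumes "2 powr (i - 1) < r" "r \<le> 2 powr (i::real)"
  shows "2 powr (i * \<kappa>) * 2 powr - \<bar>\<kappa>\<bar> \<le> r powr \<kappa>"
proof (cases "0 \<le> \<kappa>")
  case True
  then have "2 powr (i * \<kappa>) * 2 powr - \<bar>\<kappa>\<bar> = (2 powr (i - 1)) powr \<kappa>"
    by (simp add: powr_powr powr_add [symmetric] algebra_simps)
  also have "\<dots> \<le> r powr \<kappa>"
    using True assms by (intro powr_mono2) auto
  finally show ?thesis .
next
  case False
  have "0 < r" using assms(1) by (rule less_trans[rotated]) simp
  have "2 powr (i * \<kappa>) * 2 powr - \<bar>\<kappa>\<bar> \<le> 2 powr (i * \<kappa>) * 1"
    using powr_mono[of "- \<bar>\<kappa>\<bar>" 0 2] by (intro mult_left_mono) auto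
  also have "\<dots> = (2 powr i) powr \<kappa>" by (simp add: powr_powr)
  also have "\<dots> \<le> r powr \<kappa>"
    using False assms \<open>0 < r\<close> by (intro powr_mono2') auto
  finally show ?thesis .
qed

text \<open>If every cube failed the bound, the oscillation series would be dominated by a geometric series
  with ratio \<open>2\<^bsup>-\<delta>\<^esup>\<close>, and \<open>c\<close> is chosen so that its sum is too small.\<close>

lemma exists_large_cell:
  fixes \<kappa> \<delta> :: real
  assumes \<delta>: "0 < \<delta>"
  shows "\<exists>c>0. \<forall>(\<Omega> :: 'a::euclidean_space set) f x y t D.
    domain \<Omega> \<longrightarrow> convex \<Omega> \<longrightarrow> ball_deviation \<Omega> = ennreal D \<longrightarrow> 0 < D \<longrightarrow> C1_on \<Omega> f \<longrightarrow>
    x \<in> \<Omega> \<longrightarrow> y \<in> \<Omega> \<longrightarrow> 0 < t \<longrightarrow> t < diff_quot (\<kappa> - real DIM('a)) f x y \<longrightarrow>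
    (\<exists>(i::int) (j::nat). \<exists>a\<in>{x, y}. \<exists>v\<in>offsets.
      2 powr (real_of_int i - 1) < norm (x - y) \<and> norm (x - y) \<le> 2 powr real_of_int i \<and>
      ennreal (c * (t / D) * 2 powr (real j * (\<kappa> - (real DIM('a) - 1) - \<delta>)) * 2 powr (real_of_int (i - int j) * \<kappa>))
        \<le> (\<integral>\<^sup>+z. ennreal (grad_norm \<Omega> f z) * indicator (cell (i - int j) (a + 2 powr real_of_int (i - int j) *\<^sub>R v)) z \<partial>lborel))"
proof -
  let ?d = "real DIM('a)"
  define N where "N = real (card (offsets :: 'a set))"
  define q where "q = 2 powr - \<delta>"
  have q: "0 < q" "q < 1" using \<delta> by (auto simp: q_def powr_less_one)
  define V where "V = unit_ball_vol ?d"
  have V: "0 < V" by (simp add: V_def)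
  have N: "0 \<le> N" by (simp add: N_def)
  \<comment> \<open>The constant undoes the losses below: 2^(d+2) collects the 2^d of the series,
    the two centers and the factor 2r, while 1 - q comes from the geometric sum.
    \<open>N + 1\<close> is used as a denominator that is positive without counting the
    offsets.\<close>
  define c where "c = V * 2 powr - \<bar>\<kappa>\<bar> * (1 - q) / (2 powr (?d + 2) * (N + 1))"
  have c: "0 < c" using V N q by (simp add: c_def)
  show ?thesis
  proof (intro exI[of _ c] conjI allI impI c)
    fix \<Omega> :: "'a set" and f :: "'a \<Rightarrow> real" and x y :: 'a and t D :: real
    assume \<Omega>: "domain \<Omega>" "convex \<Omega>" and D: "ball_deviation \<Omega> = ennreal D" "0 < D" and f: "C1_on \<Omega> f"
      and xy: "x \<in> \<Omega>" "y \<in> \<Omega>" and t: "0 < t" "t < diff_quot (\<kappa> - ?d) f x y"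
    have op: "open \<Omega>" using \<Omega>(1) by (simp add: domain_def)
    have [measurable]: "grad_norm \<Omega> f \<in> borel_measurable borel" by (rule grad_norm_borel) fact+
    have ne: "x \<noteq> y" using t by (auto simp: diff_quot_def)
    define r where "r = norm (x - y)"
    have r: "0 < r" using ne by (simp add: r_def)
    define i where "i = \<lceil>log 2 r\<rceil>"
    have "log 2 r \<le> i" "real_of_int i - 1 < log 2 r" unfolding i_def by linarith+
    then have i: "2 powr (real_of_int i - 1) < r" "r \<le> 2 powr real_of_int i"
      using r by (auto simp: log_le_iff less_log_iff)
    let ?s = "\<lambda>j::nat. c * (t / D) * 2 powr (real j * (\<kappa> - (?d - 1) - \<delta>)) * 2 powr (real_of_int (i - int j) * \<kappa>)"
    let ?J = "\<lambda>(j::nat) a v. \<integral>\<^sup>+z. ennreal (grad_norm \<Omega> f z) * indicator (cell (i - int j) (a + 2 powr real_of_int (i - int j) *\<^sub>R v)) z \<partial>lborel"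
    let ?I = "\<lambda>a j. \<integral>\<^sup>+z. ennreal (grad_norm \<Omega> f z) * indicator (ball a (2 powr (- real j) * (2 * r))) z \<partial>lborel"
    have s0: "0 \<le> ?s j" for j using c t D by simp
    have "\<exists>j. \<exists>a\<in>{x, y}. \<exists>v\<in>offsets. ennreal (?s j) \<le> ?J j a v"
    proof (rule ccontr)
      assume contra: "\<not> ?thesis"
      have I: "?I a j \<le> ennreal (N * ?s j)" if a: "a \<in> {x, y}" for a j
      proof -
        \<comment> \<open>The radius is at most twice the side of the cubes of level i - j, which is
          the range that the offsets cover.\<close>
        have "2 powr (- real j) * (2 * r) \<le> 2 powr (- real j) * (2 * 2 powr real_of_int i)"
          using i by (intro mult_left_mono) auto
        also have "\<dots> = 2 * 2 powr real_of_int (i - int j)"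
          by (simp add: powr_add [symmetric] mult.left_commute)
        finally have "ball a (2 powr (- real j) * (2 * r)) \<subseteq> ball a (2 * 2 powr real_of_int (i - int j))"
          by (rule subset_ball)
        also have "\<dots> \<subseteq> (\<Union>v\<in>offsets. cell (i - int j) (a + 2 powr real_of_int (i - int j) *\<^sub>R v))"
          by (rule ball_subset_offset_cells)
        finally have sub: "ball a (2 powr (- real j) * (2 * r)) \<subseteq> \<dots>" .
        have "?I a j \<le> (\<integral>\<^sup>+z. (\<Sum>v\<in>offsets. ennreal (grad_norm \<Omega> f z) * indicator (cell (i - int j) (a + 2 powr real_of_int (i - int j) *\<^sub>R v)) z) \<partial>lborel)"
        proof (rule nn_integral_mono)
          fix z
          show "ennreal (grad_norm \<Omega> f z) * indicator (ball a (2 powr (- real j) * (2 * r))) z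
            \<le> (\<Sum>v\<in>offsets. ennreal (grad_norm \<Omega> f z) * indicator (cell (i - int j) (a + 2 powr real_of_int (i - int j) *\<^sub>R v)) z)"
          proof (cases "z \<in> ball a (2 powr (- real j) * (2 * r))")
            case True
            then obtain v where v: "v \<in> offsets" "z \<in> cell (i - int j) (a + 2 powr real_of_int (i - int j) *\<^sub>R v)"
              using sub by blast
            have "ennreal (grad_norm \<Omega> f z) * indicator (ball a (2 powr (- real j) * (2 * r))) z
              = ennreal (grad_norm \<Omega> f z) * indicator (cell (i - int j) (a + 2 powr real_of_int (i - int j) *\<^sub>R v)) z"
              using True v by simp
            also have "\<dots> \<le> (\<Sum>v\<in>offsets. ennreal (grad_norm \<Omega> f z) * indicator (cell (i - int j) (a + 2 powr real_of_int (i - int j) *\<^sub>R v)) z)"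
              using v finite_offsets by (intro member_le_sum) auto
            finally show ?thesis .
          qed simp
        qed
        also have "\<dots> = (\<Sum>v\<in>offsets. ?J j a v)"
          by (rule nn_integral_sum) measurable
        also have "\<dots> \<le> (\<Sum>v\<in>(offsets :: 'a set). ennreal (?s j))"
          using contra a by (intro sum_mono) (auto simp: not_le intro: less_imp_le)
        also have "\<dots> = ennreal (N * ?s j)"
          by (simp only: sum_constant ennreal_of_nat_eq_real_of_nat N_def ennreal_mult s0 of_nat_0_le_iff)
        finally show ?thesis .
      qed
      define K where "K = 2 powr (?d + 1) * N * c * (t / D) * 2 powr (real_of_int i * \<kappa>)"
      have K: "0 \<le> K" using c t D N by (simp add: K_def)
      have summand: "ennreal (2 powr ?d * 2 powr (real j * (?d - 1))) * (?I x j + ?I y j) \<le> ennreal (K * q ^ j)" for j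
      proof -
        have "ennreal (2 powr ?d * 2 powr (real j * (?d - 1))) * (?I x j + ?I y j)
            \<le> ennreal (2 powr ?d * 2 powr (real j * (?d - 1))) * (ennreal (N * ?s j) + ennreal (N * ?s j))"
          by (intro mult_left_mono add_mono I) auto
        also have "\<dots> = ennreal (2 powr ?d * 2 powr (real j * (?d - 1)) * (2 * (N * ?s j)))"
        proof -
          have double: "ennreal e * (ennreal b + ennreal b) = ennreal (e * (2 * b))" if "0 \<le> e" "0 \<le> b" for e b
            using that by (simp only: mult_2 ennreal_plus [symmetric] ennreal_mult [symmetric] add_nonneg_nonneg)
          show ?thesis
            by (rule double[OF _ mult_nonneg_nonneg[OF N s0[of j]]]) simp
        qed
        also have "2 powr ?d * 2 powr (real j * (?d - 1)) * (2 * (N * ?s j))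
          = (2 powr ?d * 2) * N * c * (t / D) * (2 powr (real j * (?d - 1)) * 2 powr (real j * (\<kappa> - (?d - 1) - \<delta>)) * 2 powr (real_of_int (i - int j) * \<kappa>))"
          by (simp add: mult_ac)
        \<comment> \<open>The threshold exponent is chosen for this cancellation: the growth
          2^(j(d-1)) of the oscillation series is compensated up to 2^(-\<delta>j).\<close>
        also have "2 powr (real j * (?d - 1)) * 2 powr (real j * (\<kappa> - (?d - 1) - \<delta>)) * 2 powr (real_of_int (i - int j) * \<kappa>)
          = 2 powr (real_of_int i * \<kappa> + (- \<delta>) * real j)"
          by (simp add: powr_add [symmetric] algebra_simps)
        also have "\<dots> = 2 powr (real_of_int i * \<kappa>) * q ^ j"
        proof -
          have "q ^ j = q powr real j" using q(1) by (rule powr_realpow [symmetric])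
          also have "\<dots> = 2 powr (- \<delta> * real j)" by (simp only: q_def powr_powr)
          finally show ?thesis by (simp only: powr_add)
        qed
        also have "2 powr ?d * 2 = 2 powr (?d + 1)" by (simp add: powr_add)
        finally show ?thesis by (simp add: K_def mult.assoc)
      qed
      have "ennreal \<bar>f x - f y\<bar> * emeasure lborel (ball x r \<inter> \<Omega>)
          \<le> ennreal (2 * r) * (\<Sum>j. ennreal (2 powr ?d * 2 powr (real j * (?d - 1))) * (?I x j + ?I y j))"
        using oscillation_bound[OF op \<Omega>(2) f xy r_def r] .
      also have "\<dots> \<le> ennreal (2 * r) * (\<Sum>j. ennreal (K * q ^ j))"
        by (intro mult_left_mono suminf_le summand) (auto intro: summableI)
      also have "(\<Sum>j. ennreal (K * q ^ j)) = ennreal (K / (1 - q))"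
        using K q by (subst suminf_ennreal2) (auto simp: suminf_mult suminf_geometric intro!: summable_mult summable_geometric)
      finally have osc: "ennreal \<bar>f x - f y\<bar> * emeasure lborel (ball x r \<inter> \<Omega>) \<le> ennreal (2 * r) * ennreal (K / (1 - q))" .
      have "ennreal (\<bar>f x - f y\<bar> * (V * r powr ?d)) = ennreal \<bar>f x - f y\<bar> * emeasure lborel (ball x r)"
        using r by (simp add: emeasure_ball V_def powr_realpow ennreal_mult)
      also have "\<dots> \<le> ennreal \<bar>f x - f y\<bar> * (ennreal D * emeasure lborel (ball x r \<inter> \<Omega>))"
        unfolding r_def using D by (intro mult_left_mono ball_deviation_ball op xy ne) auto
      also have "\<dots> = ennreal D * (ennreal \<bar>f x - f y\<bar> * emeasure lborel (ball x r \<inter> \<Omega>))"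
        by (simp add: mult_ac)
      also have "\<dots> \<le> ennreal D * (ennreal (2 * r) * ennreal (K / (1 - q)))"
        by (intro mult_left_mono osc) simp
      also have "\<dots> = ennreal (D * (2 * r * (K / (1 - q))))"
        using D r K q by (simp add: ennreal_mult [symmetric])
      finally have "\<bar>f x - f y\<bar> * (V * r powr ?d) \<le> D * (2 * r * (K / (1 - q)))"
        using D r K q by (subst (asm) ennreal_le_iff) auto
      also have "\<dots> = r * t * V * (2 powr (real_of_int i * \<kappa>) * 2 powr - \<bar>\<kappa>\<bar>) * (N / (N + 1))"
      proof -
        \<comment> \<open>The cancellation is proved for free variables, which keeps the powers of 2
          opaque: \<open>P\<close>, \<open>k\<close>, \<open>e\<close>, \<open>l\<close> and
          \<open>m\<close> stand for 2^(d+1), 2^(-|\<kappa>|), 1 - q, 2^(i\<kappa>) and N +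
          1.\<close>
        have cancel: "D * (2 * r * (P * N * (V * k * e / (2 * P * m)) * (t / D) * l / e)) = r * t * V * (l * k) * (N / m)"
          if "D \<noteq> 0" "P \<noteq> 0" "e \<noteq> 0" "m \<noteq> 0" for P k e l m :: real
          using that by (simp add: divide_simps)
        have "2 powr (?d + 2) = 2 * 2 powr (?d + 1)" by (simp add: powr_add)
        then show ?thesis
          unfolding K_def c_def by (simp only:) (rule cancel, use D(2) q N in auto)
      qed
      also have "\<dots> \<le> r * t * V * r powr \<kappa> * 1"
        using r t V N by (intro mult_mono powr_dyadic_le i) auto
      finally have up: "\<bar>f x - f y\<bar> * (V * r powr ?d) \<le> r * t * V * r powr \<kappa>" by simp
      have "t * r powr (1 + (\<kappa> - ?d)) < \<bar>f x - f y\<bar>"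
        using t(2) ne r by (simp add: diff_quot_def r_def norm_minus_commute abs_minus_commute pos_less_divide_eq)
      then have "t * r powr (1 + (\<kappa> - ?d)) * (V * r powr ?d) < \<bar>f x - f y\<bar> * (V * r powr ?d)"
        using V r by (intro mult_strict_right_mono) auto
      moreover have "t * r powr (1 + (\<kappa> - ?d)) * (V * r powr ?d) = r * t * V * r powr \<kappa>"
      proof -
        have "r powr (1 + (\<kappa> - ?d)) * r powr ?d = r * r powr \<kappa>"
          using r by (simp add: powr_add [symmetric] powr_mult_base)
        then show ?thesis by (metis mult.assoc mult.commute)
      qed
      ultimately show False using up by linarith
    qed
    then show "\<exists>(i::int) (j::nat). \<exists>a\<in>{x, y}. \<exists>v\<in>offsets.
      2 powr (real_of_int i - 1) < norm (x - y) \<and> norm (x - y) \<le> 2 powr real_of_int i \<and>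
      ennreal (c * (t / D) * 2 powr (real j * (\<kappa> - (real DIM('a) - 1) - \<delta>)) * 2 powr (real_of_int (i - int j) * \<kappa>))
        \<le> (\<integral>\<^sup>+z. ennreal (grad_norm \<Omega> f z) * indicator (cell (i - int j) (a + 2 powr real_of_int (i - int j) *\<^sub>R v)) z \<partial>lborel)"
      using i unfolding r_def by blast
  qed
qed


text \<open>Continuity from below along an enumeration. It transfers the estimates for finite
  families of cubes to countable ones.\<close>

lemma emeasure_UN_le_finite_sums:
  assumes "countable I" "\<And>i. i \<in> I \<Longrightarrow> X i \<in> sets M"
    and le: "\<And>F. finite F \<Longrightarrow> F \<subseteq> I \<Longrightarrow> (\<Sum>i\<in>F. emeasure M (X i)) \<le> B"
  shows "emeasure M (\<Union>i\<in>I. X i) \<le> B"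
proof (cases "I = {}")
  case False
  let ?e = "from_nat_into I"
  let ?Y = "\<lambda>n. \<Union>i\<in>?e ` {..n}. X i"
  have e: "?e n \<in> I" for n using False by (rule from_nat_into)
  have "(\<Union>i\<in>I. X i) = (\<Union>i\<in>range ?e. X i)"
    using range_from_nat_into[OF False assms(1)] by simp
  also have "\<dots> = (\<Union>n. ?Y n)" by auto
  also have "emeasure M \<dots> = (SUP n. emeasure M (?Y n))"
  proof (rule SUP_emeasure_incseq [symmetric])
    show "range ?Y \<subseteq> sets M" using e assms(2) by (auto intro!: sets.finite_UN)
    show "incseq ?Y" unfolding incseq_def by (intro allI impI UN_mono image_mono) auto
  qed
  also have "\<dots> \<le> B"
  proof (rule SUP_least)
    fix n
    have "emeasure M (?Y n) \<le> (\<Sum>i\<in>?e ` {..n}. emeasure M (X i))"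
      using e assms(2) by (intro emeasure_subadditive_finite) auto
    also have "\<dots> \<le> B" using e by (intro le) auto
    finally show "emeasure M (?Y n) \<le> B" .
  qed
  finally show ?thesis .
qed simp

subsection \<open>Consequences of the two-weight condition\<close>

lemma ennreal_divide_mult_cancel: "0 < b \<Longrightarrow> a / ennreal b * ennreal b = a"
  by (simp add: ennreal_divide_times ennreal_divide_self)

text \<open>An infinite essential infimum would bound the finite values of \<open>w\<close> from
  below almost everywhere, which is impossible on a set of positive measure.\<close>

lemma ess_inf_on_finite:
  assumes "S \<in> sets lebesgue" "S \<notin> null_sets lebesgue"
  shows "ess_inf_on S w < top"
proof (rule ccontr)
  assume "\<not> ?thesis"
  then have "ess_inf_on S w = top" using top.not_eq_extremum by blast
  then have "AE y in lebesgue_on S. False"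
    using ess_inf_on_AE[of S w] by (auto simp: top_unique elim: eventually_mono)
  then have "AE y in lebesgue. y \<notin> S"
    using assms(1) by (subst (asm) AE_restrict_space_iff) auto
  then show False
    using assms by (simp add: AE_iff_null_sets [symmetric])
qed

text \<open>The two-weight condition is used on the ball around z, and its dual factor is then
  decreased to that of Q, a subset of the ball. Clearing the averages leaves the p-th power of the
  volume of the ball.\<close>

lemma Ap_ball_bound:
  fixes \<Omega> :: "'a::euclidean_space set"
  assumes p: "1 \<le> p" and \<Omega>: "open \<Omega>" and Ap: "Ap_pair p \<Omega> u w"
    and Q: "Q \<in> sets borel" "Q \<subseteq> ball z R" "Q \<inter> \<Omega> \<notin> null_sets lebesgue" and R: "0 < R"
  shows "(\<integral>\<^sup>+x. ennreal (u x) \<partial>lebesgue_on (ball z R \<inter> \<Omega>))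
    \<le> Ap_const p \<Omega> u w * ennreal ((unit_ball_vol DIM('a) * R powr DIM('a)) powr p * cube_weight p \<Omega> w Q)"
proof -
  define \<beta> where "\<beta> = unit_ball_vol DIM('a) * R powr DIM('a)"
  have \<beta>: "0 < \<beta>" using R by (simp add: \<beta>_def)
  have vol: "emeasure lebesgue (ball z R) = ennreal \<beta>"
    using R by (simp add: emeasure_ball \<beta>_def powr_realpow)
  define U where "U = (\<integral>\<^sup>+x. ennreal (u x) \<partial>lebesgue_on (ball z R \<inter> \<Omega>))"
  have avg: "ball_avg \<Omega> z R (\<lambda>x. ennreal (u x)) = U / ennreal \<beta>"
    by (simp add: ball_avg_def U_def vol)
  have S: "Q \<inter> \<Omega> \<in> sets lebesgue" "ball z R \<inter> \<Omega> \<in> sets lebesgue" using Q(1) \<Omega> by auto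
  have "U \<le> Ap_const p \<Omega> u w * ennreal (\<beta> powr p * cube_weight p \<Omega> w Q)"
  proof (cases "p = 1")
    case True
    let ?v = "cube_weight p \<Omega> w Q"
    let ?\<K> = "{K. K < top \<and> A1_bound \<Omega> u w K}"
    have v: "ess_inf_on (Q \<inter> \<Omega>) w = ennreal ?v"
      using ess_inf_on_finite[OF S(1) Q(3)] True by (simp add: cube_weight_def)
    have le: "U / ennreal \<beta> \<le> K * ennreal ?v" if "K \<in> ?\<K>" for K
    proof -
      have "U / ennreal \<beta> \<le> K * ess_inf_on (ball z R \<inter> \<Omega>) w"
        using that R by (auto simp: A1_bound_def avg [symmetric])
      also have "\<dots> \<le> K * ess_inf_on (Q \<inter> \<Omega>) w"
        using Q(2) S by (intro mult_left_mono ess_inf_on_antimono) auto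
      finally show ?thesis by (simp add: v)
    qed
    have "U / ennreal \<beta> \<le> Inf ?\<K> * ennreal ?v"
    \<comment> \<open>If \<open>?v\<close> vanishes, one admissible finite \<open>K\<close> already
      forces the average of \<open>u\<close> to be 0; otherwise division by \<open>?v\<close> allows
      passing to the infimum over \<open>K\<close>.\<close>
    proof (cases "?v = 0")
      case True
      obtain K where "K \<in> ?\<K>" using Ap \<open>p = 1\<close> by (auto simp: Ap_pair_def)
      from le[OF this] show ?thesis using True by simp
    next
      case False
      then have "0 < ?v" using cube_weight_nonneg[of p \<Omega> w Q] by linarith
      have "U / ennreal \<beta> / ennreal ?v \<le> Inf ?\<K>"
      proof (rule Inf_greatest)
        fix K assume "K \<in> ?\<K>"
        then show "U / ennreal \<beta> / ennreal ?v \<le> K"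
          using le[of K] \<open>0 < ?v\<close> by (subst divide_le_posI_ennreal) (simp_all add: mult.commute)
      qed
      then have "U / ennreal \<beta> / ennreal ?v * ennreal ?v \<le> Inf ?\<K> * ennreal ?v"
        by (rule mult_right_mono) simp
      then show ?thesis
        using \<open>0 < ?v\<close> by (simp add: ennreal_divide_mult_cancel)
    qed
    then have "U / ennreal \<beta> * ennreal \<beta> \<le> Inf ?\<K> * ennreal ?v * ennreal \<beta>"
      by (rule mult_right_mono) simp
    then have "U \<le> Inf ?\<K> * ennreal ?v * ennreal \<beta>"
      using \<beta> by (simp add: ennreal_divide_mult_cancel)
    then show ?thesis
      using True \<beta> by (simp add: Ap_const_def ennreal_mult mult_ac)
  next
    case False
    then have p1: "1 < p" using p by simp
    define b where "b = 1 / (p - 1)"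
    have b: "0 < b" using p1 by (simp add: b_def)
    define \<sigma> where "\<sigma> T = (\<integral>\<^sup>+x. epowr (ennreal (w x)) (- b) * indicator (T \<inter> \<Omega>) x \<partial>lebesgue)" for T
    have v: "cube_weight p \<Omega> w Q = enn2real (\<sigma> Q) powr (1 - p)"
      using False p1 by (simp add: cube_weight_def \<sigma>_def b_def conj_exp_div)
    define A where "A = Ap_const p \<Omega> u w"
    have Afin: "A < top" using Ap False by (simp add: Ap_pair_def A_def)
    have pe: "p / conj_exp p = p - 1" using p1 by (simp add: conj_exp_def)
    have "ball_avg \<Omega> z R (\<lambda>x. ennreal (u x)) *
        epowr (ball_avg \<Omega> z R (\<lambda>y. epowr (ennreal (w y)) (- (conj_exp p / p)))) (p / conj_exp p) \<le> A"
      unfolding A_def Ap_const_def using False R by (simp, intro SUP_upper2[of z] SUP_upper2[of R]) auto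
    then have A: "U / ennreal \<beta> * epowr (\<sigma> (ball z R) / ennreal \<beta>) (p - 1) \<le> A"
      unfolding avg pe conj_exp_div[OF p1] b_def [symmetric]
      using S(2) by (simp add: ball_avg_def vol \<sigma>_def nn_integral_lebesgue_on)
    have mono: "\<sigma> Q \<le> \<sigma> (ball z R)"
      unfolding \<sigma>_def using Q(2) by (intro nn_integral_mono mult_left_mono) (auto simp: indicator_def)
    \<comment> \<open>A negative power of the finite weight is positive at every point of \<Omega>,
      and the cube meets \<Omega> in a set that is not null.\<close>
    have pos: "0 < \<sigma> Q"
    proof (rule ccontr)
      assume "\<not> 0 < \<sigma> Q"
      then have z: "\<sigma> Q = 0" by (simp add: zero_less_iff_neq_zero)
      have wt: "weight \<Omega> w" using Ap by (simp add: Ap_pair_def)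
      have [measurable]: "(\<lambda>x. w x * indicator \<Omega> x) \<in> borel_measurable lebesgue"
        by (rule weight_borel_lebesgue) fact+
      have w0: "0 \<le> w x" if "x \<in> \<Omega>" for x using that wt by (auto simp: weight_def)
      have eq: "(\<lambda>x. epowr (ennreal (w x)) (- b) * indicator (Q \<inter> \<Omega>) x) =
        (\<lambda>x. (if w x * indicator \<Omega> x = 0 then top else ennreal ((w x * indicator \<Omega> x) powr - b)) * indicator (Q \<inter> \<Omega>) x)"
        using b w0 epowr_neg[of 0 b] by (auto simp: fun_eq_iff indicator_def epowr_neg)
      note S(1) [measurable]
      have [measurable]: "(\<lambda>x. epowr (ennreal (w x)) (- b) * indicator (Q \<inter> \<Omega>) x) \<in> borel_measurable lebesgue"
        unfolding eq by measurable
      have "AE x in lebesgue. epowr (ennreal (w x)) (- b) * indicator (Q \<inter> \<Omega>) x = 0"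
        using z unfolding \<sigma>_def by (simp add: nn_integral_0_iff_AE)
      then have "AE x in lebesgue. x \<notin> Q \<inter> \<Omega>"
      proof eventually_elim
        case (elim x)
        show ?case
        proof
          assume x: "x \<in> Q \<inter> \<Omega>"
          then show False
            using elim w0[of x] b epowr_neg[of "w x" b] by (auto split: if_splits)
        qed
      qed
      then show False using Q(3) AE_iff_null_sets[OF S(1)] by blast
    qed
    show ?thesis
    \<comment> \<open>An infinite dual integral over the ball is compatible with a finite constant
      only if \<open>u\<close> has integral 0 there.\<close>
    proof (cases "\<sigma> (ball z R) = top")
      case True
      then have "epowr (\<sigma> (ball z R) / ennreal \<beta>) (p - 1) = top"
        using p1 by (simp add: epowr_def ennreal_top_divide)
      then have "U / ennreal \<beta> = 0"
        using A Afin by (auto simp: ennreal_mult_top split: if_splits)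
      then have "U = 0" by (auto simp: ennreal_divide_eq_0_iff)
      then show ?thesis by simp
    next
      case False
      moreover have "0 < \<sigma> (ball z R)" using pos mono by (rule less_le_trans)
      ultimately obtain S where S: "\<sigma> (ball z R) = ennreal S" "0 < S"
        by (cases "\<sigma> (ball z R)") auto
      with pos mono obtain s where s: "\<sigma> Q = ennreal s" "0 < s" "s \<le> S"
        by (cases "\<sigma> Q") (auto simp: top_unique)
      have "epowr (\<sigma> (ball z R) / ennreal \<beta>) (p - 1) = ennreal ((S / \<beta>) powr (p - 1))"
        using S \<beta> p1 by (simp add: epowr_def divide_ennreal)
      then have A': "U / ennreal \<beta> * ennreal ((S / \<beta>) powr (p - 1)) \<le> A" using A by simp
      have one: "(S / \<beta>) powr (p - 1) * (\<beta> powr p * S powr (1 - p)) = \<beta>"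
      proof -
        have "(S / \<beta>) powr (p - 1) = S powr (p - 1) * \<beta> powr (1 - p)"
          using powr_minus_divide[of \<beta> "p - 1"] by (simp add: powr_divide)
        then have "(S / \<beta>) powr (p - 1) * (\<beta> powr p * S powr (1 - p))
            = (S powr (p - 1) * S powr (1 - p)) * (\<beta> powr (1 - p) * \<beta> powr p)" by simp
        also have "\<dots> = \<beta>" using S \<beta> by (simp add: powr_add [symmetric])
        finally show ?thesis .
      qed
      have "U = U / ennreal \<beta> * ennreal \<beta>"
        using \<beta> by (simp add: ennreal_divide_mult_cancel)
      also have "\<dots> = U / ennreal \<beta> * ennreal ((S / \<beta>) powr (p - 1)) * ennreal (\<beta> powr p * S powr (1 - p))"
        by (subst mult.assoc, subst ennreal_mult [symmetric]) (simp_all only: one powr_ge_zero mult_nonneg_nonneg)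
      also have "\<dots> \<le> A * ennreal (\<beta> powr p * s powr (1 - p))"
        using s p1 by (intro mult_mono A' ennreal_leI mult_left_mono powr_mono2') auto
      finally show ?thesis using s by (simp add: A_def v)
    qed
  qed
  then show ?thesis by (simp add: U_def \<beta>_def)
qed


subsection \<open>Measure of the dyadic pieces\<close>

text \<open>A Borel substitute for \<open>mu\<close> on the product of uncompleted measures, where
  Tonelli's theorem applies; \<open>U\<close> will be a Borel version of \<open>u\<close> extended
  by 0.\<close>

definition weighted_pair_measure :: "('a::euclidean_space \<Rightarrow> ennreal) \<Rightarrow> real \<Rightarrow> ('a \<times> 'a) measure" where
  "weighted_pair_measure U \<gamma> = density (lborel \<Otimes>\<^sub>M lborel)
    (\<lambda>z. U (fst z) * ennreal (norm (snd z - fst z) powr (\<gamma> - real DIM('a))))"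

lemma sets_weighted_pair_measure [simp]: "sets (weighted_pair_measure U \<gamma>) = sets (borel \<Otimes>\<^sub>M borel)"
  unfolding weighted_pair_measure_def sets_density by (intro sets_pair_measure_cong) auto

lemma AE_fst_lborel:
  fixes P :: "'a::euclidean_space \<Rightarrow> bool"
  assumes "AE x in lborel. P x"
  shows "AE z in (lborel :: 'a measure) \<Otimes>\<^sub>M (lborel :: 'a measure). P (fst z)"
proof -
  obtain N where N: "{x. \<not> P x} \<subseteq> N" "N \<in> null_sets lborel"
    using assms by (auto simp: eventually_ae_filter)
  have "N \<times> (UNIV :: 'a set) \<in> null_sets (lborel \<Otimes>\<^sub>M lborel)"
    using N(2) lborel.emeasure_pair_measure_Times[of N lborel "UNIV :: 'a set"] by (auto simp: null_sets_def)
  then show ?thesis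
    by (rule AE_I') (use N(1) in \<open>auto simp: space_pair_measure\<close>)
qed

text \<open>Completion does not change nonnegative integrals, and the extension of \<open>u\<close>
  by 0 agrees with \<open>U\<close> off a null set of first coordinates, hence off a null set of
  pairs.\<close>

lemma mu_le_weighted_pair_measure:
  fixes \<Omega> :: "'a::euclidean_space set"
  assumes "open \<Omega>" and [measurable]: "U \<in> borel_measurable borel"
    and AE: "AE x in lborel. ennreal (u x * indicator \<Omega> x) = U x"
    and u: "\<And>x. x \<in> \<Omega> \<Longrightarrow> 0 \<le> u x"
    and E: "E \<subseteq> P" and P: "P \<in> sets (borel \<Otimes>\<^sub>M borel)"
  shows "emeasure (mu \<Omega> u \<gamma>) E \<le> emeasure (weighted_pair_measure U \<gamma>) P"
proof -
  let ?d = "real DIM('a)"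
  let ?M = "lebesgue_on (\<Omega> \<times> \<Omega>)"
  let ?h = "\<lambda>(x, y). ennreal (u x * norm (y - x) powr (\<gamma> - ?d))"
  have [measurable]: "P \<in> sets (lborel \<Otimes>\<^sub>M lborel)"
    using P by (simp cong: sets_pair_measure_cong)
  \<comment> \<open>\<^const>\<open>measure_of\<close> falls back to \<open>0\<close>, so neither \<open>E\<close> nor the density needs to be measurable here.\<close>
  have "emeasure (mu \<Omega> u \<gamma>) E \<le> (\<integral>\<^sup>+z. ?h z * indicator E z \<partial>?M)"
    unfolding mu_def density_def by (subst emeasure_measure_of_conv) auto
  also have "\<dots> = (\<integral>\<^sup>+z. ?h z * indicator E z * indicator (\<Omega> \<times> \<Omega>) z \<partial>lebesgue)"
    using open_Times[OF assms(1) assms(1)] by (subst nn_integral_restrict_space) auto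
  also have "\<dots> = (\<integral>\<^sup>+z. ?h z * indicator E z * indicator (\<Omega> \<times> \<Omega>) z \<partial>(lborel \<Otimes>\<^sub>M lborel))"
    by (simp add: nn_integral_completion lborel_prod)
  also have "\<dots> \<le> (\<integral>\<^sup>+z. U (fst z) * ennreal (norm (snd z - fst z) powr (\<gamma> - ?d)) * indicator P z \<partial>(lborel \<Otimes>\<^sub>M lborel))"
  proof (rule nn_integral_mono_AE)
    show "AE z in lborel \<Otimes>\<^sub>M lborel. ?h z * indicator E z * indicator (\<Omega> \<times> \<Omega>) z
        \<le> U (fst z) * ennreal (norm (snd z - fst z) powr (\<gamma> - ?d)) * indicator P z"
      using AE_fst_lborel[OF AE]
    proof eventually_elim
      case (elim z)
      obtain x y where z: "z = (x, y)" by (cases z)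
      show ?case
      proof (cases "z \<in> E \<and> x \<in> \<Omega> \<and> y \<in> \<Omega>")
        case True
        then have "ennreal (u x) = U x" using elim z by simp
        then show ?thesis
          using True E u[of x] z by (auto simp: ennreal_mult)
      qed (use z in \<open>auto simp: indicator_def\<close>)
    qed
  qed
  also have "\<dots> = emeasure (weighted_pair_measure U \<gamma>) P"
    unfolding weighted_pair_measure_def using P by (subst emeasure_density) auto
  finally show ?thesis .
qed

text \<open>A cube \<open>Q \<ni> c\<close> of side \<open>2\<^sup>k\<close> serves the pairs at distance about \<open>2\<^bsup>k+j\<^esup>\<close> one of whose points is close to \<open>Q\<close>;
  when it is the second point, the first one is only known to be within about \<open>2\<^bsup>k+j\<^esup>\<close> of \<open>c\<close>.\<close>

definition dyadic_piece :: "real \<Rightarrow> int \<Rightarrow> nat \<Rightarrow> 'a::euclidean_space \<Rightarrow> ('a \<times> 'a) set" where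
  "dyadic_piece \<rho> k j c = {z. 2 powr (real_of_int (k + int j) - 1) < norm (fst z - snd z) \<and>
     norm (fst z - snd z) \<le> 2 powr real_of_int (k + int j) \<and>
     (fst z \<in> ball c (\<rho> * 2 powr k) \<or>
      snd z \<in> ball c (\<rho> * 2 powr k) \<and> fst z \<in> ball c ((\<rho> + 1) * 2 powr real_of_int (k + int j)))}"

lemma dyadic_piece_borel [measurable, simp]: "dyadic_piece \<rho> k j c \<in> sets (borel \<Otimes>\<^sub>M borel)"
proof -
  have "{z \<in> space (borel \<Otimes>\<^sub>M borel). z \<in> dyadic_piece \<rho> k j c} \<in> sets (borel \<Otimes>\<^sub>M borel)"
    unfolding dyadic_piece_def mem_ball dist_norm mem_Collect_eq by measurable
  then show ?thesis by (simp add: space_pair_measure)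
qed

text \<open>The lower bound for the exponent -\<kappa>, inverted.\<close>

lemma dyadic_powr_le:
  assumes "2 powr (i - 1) < r" "r \<le> 2 powr (i::real)"
  shows "r powr \<kappa> \<le> 2 powr \<bar>\<kappa>\<bar> * 2 powr (i * \<kappa>)"
proof -
  have r: "0 < r" using assms(1) by (rule less_trans[rotated]) simp
  have "2 powr (i * - \<kappa>) * 2 powr - \<bar>- \<kappa>\<bar> \<le> r powr - \<kappa>"
    by (rule powr_dyadic_le) fact+
  then have "inverse (r powr - \<kappa>) \<le> inverse (2 powr (i * - \<kappa>) * 2 powr - \<bar>\<kappa>\<bar>)"
    by (intro le_imp_inverse_le) auto
  then show ?thesis
    by (simp add: powr_minus mult.commute)
qed

lemma nn_integral_lincomb:
  assumes [measurable]: "g \<in> borel_measurable M" "h \<in> borel_measurable M"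
  shows "(\<integral>\<^sup>+x. C * (a * g x + b * h x) \<partial>M) = C * (a * (\<integral>\<^sup>+x. g x \<partial>M) + b * (\<integral>\<^sup>+x. h x \<partial>M))"
  by (simp add: nn_integral_cmult nn_integral_add)

lemma nn_integral_lincomb_indicators:
  assumes [measurable]: "A \<in> sets M" "B \<in> sets M"
  shows "(\<integral>\<^sup>+x. C * (a * indicator A x + b * indicator B x) \<partial>M) = C * (a * emeasure M A + b * emeasure M B)"
  by (subst nn_integral_lincomb) auto

text \<open>At distance about 2^(k+j) the kernel is comparable to a constant. For x near c, the
  point y ranges over a ball of radius 2^(k+j) around x; for y near c, it ranges over a ball of
  radius \<rho> 2^k while x stays in the large ball. Integrating y first gives the two
  terms.\<close>

lemma emeasure_dyadic_piece:
  fixes c :: "'a::euclidean_space"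
  assumes [measurable]: "U \<in> borel_measurable borel" and \<rho>: "0 < \<rho>"
  shows "emeasure (weighted_pair_measure U \<gamma>) (dyadic_piece \<rho> k j c)
    \<le> ennreal (2 powr \<bar>\<gamma> - real DIM('a)\<bar> * 2 powr (real_of_int (k + int j) * (\<gamma> - real DIM('a))))
      * (ennreal (unit_ball_vol DIM('a) * (2 powr real_of_int (k + int j)) powr DIM('a))
          * (\<integral>\<^sup>+x. U x * indicator (ball c (\<rho> * 2 powr k)) x \<partial>lborel)
       + ennreal (unit_ball_vol DIM('a) * (\<rho> * 2 powr k) powr DIM('a))
          * (\<integral>\<^sup>+x. U x * indicator (ball c ((\<rho> + 1) * 2 powr real_of_int (k + int j))) x \<partial>lborel))"
proof -
  let ?d = "real DIM('a)" and ?i = "real_of_int (k + int j)"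
  let ?B1 = "ball c (\<rho> * 2 powr k)" and ?B2 = "ball c ((\<rho> + 1) * 2 powr ?i)"
  let ?C = "ennreal (2 powr \<bar>\<gamma> - ?d\<bar> * 2 powr (?i * (\<gamma> - ?d)))"
  have [measurable]: "?B1 \<in> sets borel" "?B2 \<in> sets borel" "cball x (2 powr ?i) \<in> sets borel" for x by auto
  have [measurable]: "dyadic_piece \<rho> k j c \<in> sets (lborel \<Otimes>\<^sub>M lborel)"
    using dyadic_piece_borel by (simp cong: sets_pair_measure_cong)
  have "emeasure (weighted_pair_measure U \<gamma>) (dyadic_piece \<rho> k j c)
      = (\<integral>\<^sup>+z. U (fst z) * ennreal (norm (snd z - fst z) powr (\<gamma> - ?d)) * indicator (dyadic_piece \<rho> k j c) z \<partial>(lborel \<Otimes>\<^sub>M lborel))"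
    unfolding weighted_pair_measure_def by (subst emeasure_density) auto
  also have "\<dots> = (\<integral>\<^sup>+x. \<integral>\<^sup>+y. U x * ennreal (norm (y - x) powr (\<gamma> - ?d)) * indicator (dyadic_piece \<rho> k j c) (x, y) \<partial>lborel \<partial>lborel)"
    by (subst lborel.nn_integral_fst [symmetric]) auto
  also have "\<dots> \<le> (\<integral>\<^sup>+x. ?C * (ennreal (unit_ball_vol ?d * (2 powr ?i) powr ?d) * (U x * indicator ?B1 x)
      + ennreal (unit_ball_vol ?d * (\<rho> * 2 powr k) powr ?d) * (U x * indicator ?B2 x)) \<partial>lborel)"
  proof (rule nn_integral_mono)
    fix x
    have "(\<integral>\<^sup>+y. U x * ennreal (norm (y - x) powr (\<gamma> - ?d)) * indicator (dyadic_piece \<rho> k j c) (x, y) \<partial>lborel)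
        \<le> (\<integral>\<^sup>+y. ?C * (U x * indicator ?B1 x * indicator (cball x (2 powr ?i)) y + U x * indicator ?B2 x * indicator ?B1 y) \<partial>lborel)"
    proof (rule nn_integral_mono)
      fix y
      show "U x * ennreal (norm (y - x) powr (\<gamma> - ?d)) * indicator (dyadic_piece \<rho> k j c) (x, y)
          \<le> ?C * (U x * indicator ?B1 x * indicator (cball x (2 powr ?i)) y + U x * indicator ?B2 x * indicator ?B1 y)"
      proof (cases "(x, y) \<in> dyadic_piece \<rho> k j c")
        case True
        then have i: "2 powr (?i - 1) < norm (y - x)" "norm (y - x) \<le> 2 powr ?i"
          and or: "x \<in> ?B1 \<or> y \<in> ?B1 \<and> x \<in> ?B2"
          unfolding dyadic_piece_def by (auto simp: norm_minus_commute)
        have le: "ennreal (norm (y - x) powr (\<gamma> - ?d)) \<le> ?C"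
          by (intro ennreal_leI dyadic_powr_le i)
        have "U x * 1 \<le> U x * (indicator ?B1 x * indicator (cball x (2 powr ?i)) y + indicator ?B2 x * indicator ?B1 y)"
        proof (rule mult_left_mono)
          show "1 \<le> (indicator ?B1 x * indicator (cball x (2 powr ?i)) y + indicator ?B2 x * indicator ?B1 y :: ennreal)"
            using or
          proof
            assume "x \<in> ?B1"
            moreover have "y \<in> cball x (2 powr ?i)" using i(2) by (simp add: dist_norm norm_minus_commute)
            ultimately show ?thesis by simp
          next
            assume "y \<in> ?B1 \<and> x \<in> ?B2"
            then show ?thesis by simp
          qed
        qed simp
        then have "?C * (U x * 1) \<le> ?C * (U x * (indicator ?B1 x * indicator (cball x (2 powr ?i)) y + indicator ?B2 x * indicator ?B1 y))"
          by (rule mult_left_mono) simp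
        moreover have "U x * ennreal (norm (y - x) powr (\<gamma> - ?d)) \<le> ?C * (U x * 1)"
          using mult_left_mono[OF le, of "U x"] by (simp add: mult.commute)
        ultimately show ?thesis
          using True by (simp add: distrib_left mult.assoc)
      qed simp
    qed
    also have "\<dots> = ?C * (U x * indicator ?B1 x * emeasure lborel (cball x (2 powr ?i)) + U x * indicator ?B2 x * emeasure lborel ?B1)"
      by (rule nn_integral_lincomb_indicators) auto
    also have "\<dots> = ?C * (ennreal (unit_ball_vol ?d * (2 powr ?i) powr ?d) * (U x * indicator ?B1 x)
      + ennreal (unit_ball_vol ?d * (\<rho> * 2 powr k) powr ?d) * (U x * indicator ?B2 x))"
    proof -
      have "emeasure lborel (cball x (2 powr ?i)) = ennreal (unit_ball_vol ?d * (2 powr ?i) powr ?d)"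
        by (subst emeasure_cball) (simp_all add: powr_realpow)
      moreover have "emeasure lborel ?B1 = ennreal (unit_ball_vol ?d * (\<rho> * 2 powr k) powr ?d)"
        using \<rho> by (subst emeasure_ball) (simp_all add: powr_realpow)
      ultimately show ?thesis by (simp only: mult.commute)
    qed
    finally show "(\<integral>\<^sup>+y. U x * ennreal (norm (y - x) powr (\<gamma> - ?d)) * indicator (dyadic_piece \<rho> k j c) (x, y) \<partial>lborel) \<le> \<dots>" .
  qed
  also have "\<dots> = ?C * (ennreal (unit_ball_vol ?d * (2 powr ?i) powr ?d) * (\<integral>\<^sup>+x. U x * indicator ?B1 x \<partial>lborel)
       + ennreal (unit_ball_vol ?d * (\<rho> * 2 powr k) powr ?d) * (\<integral>\<^sup>+x. U x * indicator ?B2 x \<partial>lborel))"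
    by (rule nn_integral_lincomb) measurable
  finally show ?thesis .
qed


text \<open>Both configurations are bounded by the same quantity. Their exponents of 2 differ by
  jd(p-1), which is nonnegative because p \<ge> 1, so the case of the second point near the cube is
  decisive.\<close>

lemma piece_const_le:
  fixes d p \<gamma> \<rho> V k j :: real
  assumes "0 < \<rho>" "0 < V" "1 \<le> p" "0 \<le> j" "0 \<le> d"
  shows "2 powr \<bar>\<gamma> - d\<bar> * 2 powr ((k + j) * (\<gamma> - d))
      * (V * (2 powr (k + j)) powr d * (V * (\<rho> * 2 powr k) powr d) powr p
       + V * (\<rho> * 2 powr k) powr d * (V * ((\<rho> + 1) * 2 powr (k + j)) powr d) powr p)
    \<le> 2 * 2 powr \<bar>\<gamma> - d\<bar> * V powr (1 + p) * (\<rho> + 1) powr (d * (1 + p))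
      * 2 powr (j * (p * d + \<gamma> - d)) * 2 powr (k * (p * d + \<gamma>))"
proof -
  let ?T = "V powr (1 + p) * (\<rho> + 1) powr (d * (1 + p)) * 2 powr (k * d + (k + j) * (d * p))"
  have V: "V * V powr p = V powr (1 + p)" using assms by (simp add: powr_mult_base)
  have "V * (2 powr (k + j)) powr d * (V * (\<rho> * 2 powr k) powr d) powr p
      = (V * V powr p) * \<rho> powr (d * p) * (2 powr ((k + j) * d) * 2 powr (k * (d * p)))"
    by (simp only: powr_mult powr_powr mult.assoc) (simp only: mult_ac)
  also have "\<dots> = V powr (1 + p) * \<rho> powr (d * p) * 2 powr ((k + j) * d + k * (d * p))"
    by (simp only: V powr_add)
  also have "\<dots> \<le> ?T"
  proof (intro mult_mono)
    have "\<rho> powr (d * p) \<le> (\<rho> + 1) powr (d * p)"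
      using assms by (intro powr_mono2) auto
    also have "\<dots> \<le> (\<rho> + 1) powr (d * (1 + p))"
      using assms by (intro powr_mono mult_left_mono) auto
    finally show "\<rho> powr (d * p) \<le> (\<rho> + 1) powr (d * (1 + p))" .
    have "0 \<le> j * d * (p - 1)" using assms by simp
    then have "(k + j) * d + k * (d * p) \<le> k * d + (k + j) * (d * p)"
      by (simp add: algebra_simps)
    then show "2 powr ((k + j) * d + k * (d * p)) \<le> (2::real) powr (k * d + (k + j) * (d * p))"
      by (intro powr_mono) auto
  qed auto
  finally have 1: "V * (2 powr (k + j)) powr d * (V * (\<rho> * 2 powr k) powr d) powr p \<le> ?T" .
  have "V * (\<rho> * 2 powr k) powr d * (V * ((\<rho> + 1) * 2 powr (k + j)) powr d) powr p
      = (V * V powr p) * (\<rho> powr d * (\<rho> + 1) powr (d * p)) * (2 powr (k * d) * 2 powr ((k + j) * (d * p)))"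
    by (simp only: powr_mult powr_powr mult.assoc) (simp only: mult_ac)
  also have "\<dots> \<le> V powr (1 + p) * ((\<rho> + 1) powr d * (\<rho> + 1) powr (d * p)) * (2 powr (k * d) * 2 powr ((k + j) * (d * p)))"
    unfolding V using assms by (intro mult_right_mono mult_left_mono powr_mono2) auto
  also have "\<dots> = ?T"
    by (simp add: powr_add distrib_left)
  finally have 2: "V * (\<rho> * 2 powr k) powr d * (V * ((\<rho> + 1) * 2 powr (k + j)) powr d) powr p \<le> ?T" .
  have "2 powr \<bar>\<gamma> - d\<bar> * 2 powr ((k + j) * (\<gamma> - d))
      * (V * (2 powr (k + j)) powr d * (V * (\<rho> * 2 powr k) powr d) powr p
       + V * (\<rho> * 2 powr k) powr d * (V * ((\<rho> + 1) * 2 powr (k + j)) powr d) powr p)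
      \<le> 2 powr \<bar>\<gamma> - d\<bar> * 2 powr ((k + j) * (\<gamma> - d)) * (?T + ?T)"
    by (intro mult_left_mono add_mono 1 2) auto
  also have "\<dots> = 2 * 2 powr \<bar>\<gamma> - d\<bar> * V powr (1 + p) * (\<rho> + 1) powr (d * (1 + p))
      * (2 powr ((k + j) * (\<gamma> - d)) * 2 powr (k * d + (k + j) * (d * p)))"
    by (simp only: mult_2 [symmetric] mult_ac)
  also have "2 powr ((k + j) * (\<gamma> - d)) * 2 powr (k * d + (k + j) * (d * p))
      = 2 powr (j * (p * d + \<gamma> - d)) * 2 powr (k * (p * d + \<gamma>))"
    by (simp only: powr_add [symmetric]) (simp add: algebra_simps)
  finally show ?thesis by (simp only: mult.assoc)
qed

text \<open>The condition on \<rho> puts the cube inside both balls of the preceding measure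
  estimate, so the two-weight bound applies to each with the same cube weight.\<close>

lemma weighted_dyadic_piece:
  fixes \<Omega> :: "'a::euclidean_space set" and p \<gamma> \<rho> :: real
  defines "d \<equiv> real DIM('a)"
  assumes p: "1 \<le> p" and \<Omega>: "open \<Omega>" and Ap: "Ap_pair p \<Omega> u w"
    and U: "U \<in> borel_measurable borel" "AE x in lborel. ennreal (u x * indicator \<Omega> x) = U x"
    and Q: "(k, Q) \<in> cubes" "c \<in> Q" "Q \<inter> \<Omega> \<notin> null_sets lebesgue" and \<rho>: "d + 1 \<le> \<rho>"
  shows "emeasure (weighted_pair_measure U \<gamma>) (dyadic_piece \<rho> k j c)
    \<le> Ap_const p \<Omega> u w * ennreal (2 * 2 powr \<bar>\<gamma> - d\<bar> * unit_ball_vol d powr (1 + p) * (\<rho> + 1) powr (d * (1 + p))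
        * 2 powr (real j * (p * d + \<gamma> - d)) * (2 powr (real_of_int k * (p * d + \<gamma>)) * cube_weight p \<Omega> w Q))"
proof -
  let ?v = "cube_weight p \<Omega> w Q" and ?V = "unit_ball_vol d" and ?A = "Ap_const p \<Omega> u w"
  have \<rho>0: "0 < \<rho>" using \<rho> by (simp add: d_def)
  have V: "0 < ?V" by (simp add: d_def)
  have sub: "Q \<subseteq> ball c (\<rho> * 2 powr k)"
  proof -
    have "Q = cell k c" using Q by (auto simp: cubes_eq_cell)
    then have "Q \<subseteq> ball c ((d + 1) * 2 powr k)" using cell_subset_ball[of k c] by (simp add: d_def)
    also have "\<dots> \<subseteq> ball c (\<rho> * 2 powr k)" using \<rho> by (intro subset_ball mult_right_mono) auto
    finally show ?thesis .
  qed
  have L: "(\<integral>\<^sup>+x. U x * indicator (ball c R) x \<partial>lborel) \<le> ?A * ennreal ((?V * R powr d) powr p * ?v)"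
    if R: "\<rho> * 2 powr k \<le> R" for R
  proof -
    have "0 < \<rho> * 2 powr k" using \<rho>0 by simp
    then have R0: "0 < R" using R by linarith
    have "(\<integral>\<^sup>+x. U x * indicator (ball c R) x \<partial>lborel)
        = (\<integral>\<^sup>+x. ennreal (u x * indicator \<Omega> x) * indicator (ball c R) x \<partial>lborel)"
      using U(2) by (intro nn_integral_cong_AE) (auto elim: eventually_mono)
    also have "\<dots> = (\<integral>\<^sup>+x. ennreal (u x * indicator \<Omega> x) * indicator (ball c R) x \<partial>lebesgue)"
      by (simp add: nn_integral_completion)
    also have "\<dots> = (\<integral>\<^sup>+x. ennreal (u x) \<partial>lebesgue_on (ball c R \<inter> \<Omega>))"
      using \<Omega> by (subst nn_integral_lebesgue_on) (auto intro!: nn_integral_cong simp: indicator_def)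
    also have "\<dots> \<le> ?A * ennreal ((?V * R powr d) powr p * ?v)"
      unfolding d_def
      using sub R by (intro Ap_ball_bound p \<Omega> Ap Q(3) R0) (auto intro: cubes_borel[OF Q(1)])
    finally show ?thesis .
  qed
  let ?C = "2 powr \<bar>\<gamma> - d\<bar> * 2 powr (real_of_int (k + int j) * (\<gamma> - d))"
  let ?R1 = "\<rho> * 2 powr k" and ?R2 = "(\<rho> + 1) * 2 powr real_of_int (k + int j)"
  let ?a1 = "?V * (2 powr real_of_int (k + int j)) powr d" and ?a2 = "?V * ?R1 powr d"
  let ?b1 = "(?V * ?R1 powr d) powr p" and ?b2 = "(?V * ?R2 powr d) powr p"
  have R2: "?R1 \<le> ?R2" using \<rho>0 by (intro mult_mono powr_mono) auto
  have "emeasure (weighted_pair_measure U \<gamma>) (dyadic_piece \<rho> k j c)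
      \<le> ennreal ?C * (ennreal ?a1 * (\<integral>\<^sup>+x. U x * indicator (ball c ?R1) x \<partial>lborel)
        + ennreal ?a2 * (\<integral>\<^sup>+x. U x * indicator (ball c ?R2) x \<partial>lborel))"
    unfolding d_def by (rule emeasure_dyadic_piece[OF U(1) \<rho>0])
  also have "\<dots> \<le> ennreal ?C * (ennreal ?a1 * (?A * ennreal (?b1 * ?v)) + ennreal ?a2 * (?A * ennreal (?b2 * ?v)))"
    by (intro mult_left_mono add_mono L[OF order_refl] L[OF R2]) auto
  also have "\<dots> = ?A * ennreal (?C * (?a1 * ?b1 + ?a2 * ?b2) * ?v)"
  proof -
    have "ennreal C * (ennreal a1 * (A * ennreal (b1 * v)) + ennreal a2 * (A * ennreal (b2 * v)))
        = A * ennreal (C * (a1 * b1 + a2 * b2) * v)"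
      if "0 \<le> C" "0 \<le> a1" "0 \<le> a2" "0 \<le> b1" "0 \<le> b2" "0 \<le> v" for A C a1 a2 b1 b2 v
    proof -
      have "C * (a1 * b1 + a2 * b2) * v = C * (a1 * (b1 * v) + a2 * (b2 * v))" by (simp add: algebra_simps)
      then show ?thesis
        using that by (simp only: ennreal_mult ennreal_plus add_nonneg_nonneg mult_nonneg_nonneg) (simp only: distrib_left mult_ac)
    qed
    then show ?thesis using V by simp
  qed
  also have "\<dots> \<le> ?A * ennreal (2 * 2 powr \<bar>\<gamma> - d\<bar> * ?V powr (1 + p) * (\<rho> + 1) powr (d * (1 + p))
        * 2 powr (real j * (p * d + \<gamma> - d)) * 2 powr (real_of_int k * (p * d + \<gamma>)) * ?v)"
    using piece_const_le[of \<rho> ?V p "real j" d \<gamma> "real_of_int k"] \<rho>0 V p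
    by (intro mult_left_mono ennreal_leI mult_right_mono) (auto simp: d_def)
  finally show ?thesis by (simp only: mult.assoc)
qed

section \<open>Summation over the dyadic pieces\<close>

lemma not_null_of_integral_pos:
  assumes "\<And>x. x \<notin> \<Omega> \<Longrightarrow> g x = 0" "0 < (\<integral>\<^sup>+x. g x * indicator Q x \<partial>M)"
  shows "Q \<inter> \<Omega> \<notin> null_sets M"
proof
  assume "Q \<inter> \<Omega> \<in> null_sets M"
  then have "AE x in M. x \<notin> Q \<inter> \<Omega>" by (rule AE_not_in)
  then have "AE x in M. g x * indicator Q x = 0"
    by eventually_elim (use assms(1) in \<open>auto simp: indicator_def\<close>)
  then have "(\<integral>\<^sup>+x. g x * indicator Q x \<partial>M) = (\<integral>\<^sup>+x. 0 \<partial>M)" by (rule nn_integral_cong_AE)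
  with assms(2) show False by simp
qed

theorem corollary1p2:
  fixes p \<gamma> :: real
  assumes "1 \<le> p"
    and "DIM('a::euclidean_space) = 1 \<or> p < real DIM('a) / (real DIM('a) - 1)"
    and "\<gamma> \<notin> {- (p * real DIM('a))..0}"
  shows "\<exists>C::real. 0 \<le> C \<and>
    (\<forall>(\<Omega> :: 'a set) f u w t.
       domain \<Omega> \<longrightarrow> convex \<Omega> \<longrightarrow> ball_deviation \<Omega> < top \<longrightarrow>
       C1_on \<Omega> f \<longrightarrow> Ap_pair p \<Omega> u w \<longrightarrow> 0 < t \<longrightarrow>
       emeasure (mu \<Omega> u \<gamma>) (level_set \<Omega> t (\<gamma> / p) f)
         \<le> ennreal C * Ap_const p \<Omega> u w * epowr (ball_deviation \<Omega> / ennreal t) p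
            * (\<integral>\<^sup>+ y. ennreal (norm (gradient f y) powr p * w y) \<partial>lebesgue_on \<Omega>))"
proof -
  define d where "d = real DIM('a)"
  define \<theta> where "\<theta> = p * d + \<gamma>"
  define \<kappa> where "\<kappa> = \<theta> / p"
  \<comment> \<open>Positivity of \<epsilon> is the condition p(d-1) < d. Half of the available gap
    d - p(d-1) is spent on \<delta>, which makes the oscillation series converge; the other half
    remains as decay of the sum over j.\<close>
  define \<epsilon> where "\<epsilon> = (d - p * (d - 1)) / 2"
  define \<delta> where "\<delta> = \<epsilon> / p"
  \<comment> \<open>In units of 2^k: d + 1 for two points of one cube plus 2d for an offset.\<close>
  define \<rho> where "\<rho> = 3 * d + 1"
  have p: "1 \<le> p" by fact
  have d: "1 \<le> d" using DIM_positive[where 'a = 'a] by (simp add: d_def)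
  have \<theta>: "\<theta> < 0 \<or> p * d < \<theta>" using assms(3) by (auto simp: \<theta>_def d_def)
  have "p * (d - 1) < d"
  proof (cases "d = 1")
    case False
    then have "1 < d" using d by simp
    moreover have "p < d / (d - 1)" using assms(2) False by (auto simp: d_def)
    ultimately show ?thesis by (simp add: pos_less_divide_eq)
  qed simp
  then have \<epsilon>: "0 < \<epsilon>" by (simp add: \<epsilon>_def)
  have \<delta>: "0 < \<delta>" using \<epsilon> p by (simp add: \<delta>_def)
  have \<kappa>: "\<kappa> - d = \<gamma> / p" using p by (simp add: \<kappa>_def \<theta>_def field_simps)
  obtain C1 where C1: "0 \<le> C1" and sum_le: "\<And>(\<Omega> :: 'a set) w g s F.
    open \<Omega> \<Longrightarrow> weight \<Omega> w \<Longrightarrow> g \<in> borel_measurable borel \<Longrightarrow> \<forall>x. 0 \<le> g x \<Longrightarrow> \<forall>x. x \<notin> \<Omega> \<longrightarrow> g x = 0 \<Longrightarrow>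
    0 < s \<Longrightarrow> finite F \<Longrightarrow> F \<subseteq> cubes \<Longrightarrow>
    \<forall>q\<in>F. ennreal (s * 2 powr (real_of_int (fst q) * (\<theta> / p))) \<le> (\<integral>\<^sup>+x. ennreal (g x) * indicator (snd q) x \<partial>lebesgue) \<Longrightarrow>
    (\<Sum>q\<in>F. ennreal (2 powr (real_of_int (fst q) * \<theta>) * cube_weight p \<Omega> w (snd q)))
      \<le> ennreal (C1 * s powr - p) * (\<integral>\<^sup>+x. ennreal (g x powr p * w x) \<partial>lebesgue_on \<Omega>)"
    using cube_sum[OF p, where 'a = 'a, folded d_def, OF \<theta>] by blast
  obtain c where c: "0 < c" and large: "\<And>(\<Omega> :: 'a set) f x y t D.
    domain \<Omega> \<Longrightarrow> convex \<Omega> \<Longrightarrow> ball_deviation \<Omega> = ennreal D \<Longrightarrow> 0 < D \<Longrightarrow> C1_on \<Omega> f \<Longrightarrow>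
    x \<in> \<Omega> \<Longrightarrow> y \<in> \<Omega> \<Longrightarrow> 0 < t \<Longrightarrow> t < diff_quot (\<kappa> - d) f x y \<Longrightarrow>
    (\<exists>(i::int) (j::nat). \<exists>a\<in>{x, y}. \<exists>v\<in>offsets.
      2 powr (real_of_int i - 1) < norm (x - y) \<and> norm (x - y) \<le> 2 powr real_of_int i \<and>
      ennreal (c * (t / D) * 2 powr (real j * (\<kappa> - (d - 1) - \<delta>)) * 2 powr (real_of_int (i - int j) * \<kappa>))
        \<le> (\<integral>\<^sup>+z. ennreal (grad_norm \<Omega> f z) * indicator (cell (i - int j) (a + 2 powr real_of_int (i - int j) *\<^sub>R v)) z \<partial>lborel))"
    using exists_large_cell[OF \<delta>, where 'a = 'a and \<kappa> = \<kappa>, folded d_def] by blast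
  define C2 where "C2 = 2 * 2 powr \<bar>\<gamma> - d\<bar> * unit_ball_vol d powr (1 + p) * (\<rho> + 1) powr (d * (1 + p))"
  have C2: "0 \<le> C2" by (simp add: C2_def)
  define q where "q = 2 powr - \<epsilon>"
  have q: "0 < q" "q < 1" using \<epsilon> by (auto simp: q_def powr_less_one)
  define C where "C = C2 * C1 * c powr - p / (1 - q)"
  have C0: "0 \<le> C" using C1 C2 q by (simp add: C_def)
  show ?thesis
  proof (intro exI[of _ C] conjI allI impI C0)
    fix \<Omega> :: "'a set" and f u w :: "'a \<Rightarrow> real" and t :: real
    assume dom: "domain \<Omega>" and conv: "convex \<Omega>" and dev: "ball_deviation \<Omega> < top" and f: "C1_on \<Omega> f"
      and Ap: "Ap_pair p \<Omega> u w" and t: "0 < t"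
    let ?E = "level_set \<Omega> t (\<gamma> / p) f" and ?A = "Ap_const p \<Omega> u w"
    let ?X = "\<integral>\<^sup>+y. ennreal (norm (gradient f y) powr p * w y) \<partial>lebesgue_on \<Omega>"
    have op: "open \<Omega>" using dom by (simp add: domain_def)
    show "emeasure (mu \<Omega> u \<gamma>) ?E \<le> ennreal C * ?A * epowr (ball_deviation \<Omega> / ennreal t) p * ?X"
    \<comment> \<open>A nonempty level set supplies two distinct points of \<Omega>, from which the
      deviation is seen to be positive.\<close>
    proof (cases "?E = {}")
      case False
      then obtain x0 y0 where xy0: "x0 \<in> \<Omega>" "y0 \<in> \<Omega>" "x0 \<noteq> y0"
        using t by (auto simp: level_set_def diff_quot_def split: if_splits)
      define D where "D = enn2real (ball_deviation \<Omega>)"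
      have D: "ball_deviation \<Omega> = ennreal D" using dev by (simp add: D_def)
      have "emeasure lborel (ball x0 (norm (x0 - y0))) \<le> ennreal D * emeasure lborel (ball x0 (norm (x0 - y0)) \<inter> \<Omega>)"
        by (rule ball_deviation_ball[OF op xy0 D]) (simp add: D_def)
      moreover have "0 < emeasure lborel (ball x0 (norm (x0 - y0)))"
        using xy0 by (simp add: emeasure_ball)
      ultimately have "D \<noteq> 0" by auto
      then have D0: "0 < D" by (simp add: D_def less_le)
      have wt: "weight \<Omega> u" "weight \<Omega> w" using Ap by (auto simp: Ap_pair_def)
      have "(\<lambda>x. ennreal (u x * indicator \<Omega> x)) \<in> borel_measurable lebesgue"
        using weight_borel_lebesgue[OF op wt(1)] by measurable
      from completion_ex_borel_measurable[OF this]
      obtain U where U: "U \<in> borel_measurable borel" "AE x in lborel. ennreal (u x * indicator \<Omega> x) = U x"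
        by auto
      define g where "g = grad_norm \<Omega> f"
      have g: "g \<in> borel_measurable borel" unfolding g_def by (rule grad_norm_borel) fact+
      define s where "s j = c * (t / D) * 2 powr (real j * (\<kappa> - (d - 1) - \<delta>))" for j :: nat
      have s: "0 < s j" for j using c t D0 by (simp add: s_def)
      define Bad where "Bad j = {q \<in> cubes. ennreal (s j * 2 powr (real_of_int (fst q) * (\<theta> / p)))
        \<le> (\<integral>\<^sup>+x. ennreal (g x) * indicator (snd q) x \<partial>lebesgue)}" for j
      \<comment> \<open>The center of a piece depends on the cube alone, so countably many pieces
        cover the level set.\<close>
      define pt where "pt q = (SOME z. z \<in> snd q)" for q :: "int \<times> 'a set"
      have pt: "pt q \<in> snd q" if "q \<in> cubes" for q
        using cubes_nonempty[of "fst q" "snd q"] that unfolding pt_def by (auto intro: someI_ex)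
      define S where "S j = (\<Union>q\<in>Bad j. dyadic_piece \<rho> (fst q) j (pt q))" for j
      have Bad: "Bad j \<subseteq> cubes" for j by (auto simp: Bad_def)
      have S[measurable]: "S j \<in> sets (borel \<Otimes>\<^sub>M borel)" for j
        unfolding S_def by (intro sets.countable_UN'' countable_subset[OF Bad countable_cubes] dyadic_piece_borel)
      let ?\<nu> = "weighted_pair_measure U \<gamma>"
      have "?E \<subseteq> (\<Union>j. S j)"
      proof
        fix z assume z: "z \<in> ?E"
        obtain x y where zxy: "z = (x, y)" by (cases z)
        have xy: "x \<in> \<Omega>" "y \<in> \<Omega>" "t < diff_quot (\<kappa> - d) f x y"
          using z by (auto simp: zxy level_set_def \<kappa>)
        from large[OF dom conv D D0 f xy(1,2) t xy(3)] obtain i :: int and j :: nat and a v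
          where a: "a \<in> {x, y}" and v: "v \<in> offsets"
            and i: "2 powr (real_of_int i - 1) < norm (x - y)" "norm (x - y) \<le> 2 powr real_of_int i"
            and low: "ennreal (c * (t / D) * 2 powr (real j * (\<kappa> - (d - 1) - \<delta>)) * 2 powr (real_of_int (i - int j) * \<kappa>))
              \<le> (\<integral>\<^sup>+z. ennreal (grad_norm \<Omega> f z) * indicator (cell (i - int j) (a + 2 powr real_of_int (i - int j) *\<^sub>R v)) z \<partial>lborel)"
          by blast
        define k where "k = i - int j"
        define b where "b = a + 2 powr real_of_int k *\<^sub>R v"
        have kQ: "(k, cell k b) \<in> cubes" by (auto simp: cubes_iff)
        have bad: "(k, cell k b) \<in> Bad j"
          using low kQ by (simp add: Bad_def s_def \<kappa>_def k_def b_def g_def nn_integral_completion)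
        let ?c = "pt (k, cell k b)"
        have "cell k b = cell k ?c" using pt[OF kQ] by (auto dest: cell_eq)
        then have "b \<in> ball ?c ((d + 1) * 2 powr k)"
          using cell_subset_ball[of k ?c] cell_self[of b k] unfolding d_def by blast
        then have bc: "norm (?c - b) < (d + 1) * 2 powr k" by (simp add: dist_norm)
        have "norm (b - a) \<le> 2 powr k * (2 * d)"
          using offsets_bound[OF v] by (simp add: b_def d_def)
        moreover have "norm (?c - a) \<le> norm (?c - b) + norm (b - a)"
          using norm_triangle_ineq[of "?c - b" "b - a"] by simp
        ultimately have ca: "norm (?c - a) < \<rho> * 2 powr k"
          using bc by (simp add: \<rho>_def algebra_simps)
        have ij: "k + int j = i" by (simp add: k_def)
        have "(x, y) \<in> dyadic_piece \<rho> k j ?c"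
        proof (cases "a = x")
          case True
          then show ?thesis using ca i by (simp add: dyadic_piece_def ij dist_norm)
        next
          case False
          then have ay: "a = y" using a by simp
          \<comment> \<open>Here only y is known to be close to the cube; x follows at distance at
            most 2^i, which accounts for the radius (\<rho> + 1) 2^i.\<close>
          have "norm (?c - x) \<le> norm (?c - y) + norm (x - y)"
            using norm_triangle_ineq[of "?c - y" "y - x"] by (simp add: norm_minus_commute)
          also have "\<dots> < \<rho> * 2 powr k + 2 powr i" using ca ay i by auto
          also have "\<dots> \<le> \<rho> * 2 powr i + 2 powr i"
            using d by (intro add_right_mono mult_left_mono powr_mono) (auto simp: \<rho>_def k_def)
          finally have "norm (?c - x) < (\<rho> + 1) * 2 powr i" by (simp add: algebra_simps)
          then show ?thesis using ca ay i by (simp add: dyadic_piece_def ij dist_norm)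
        qed
        then show "z \<in> (\<Union>j. S j)"
          using bad by (auto simp: zxy S_def intro!: bexI[of _ "(k, cell k b)"])
      qed
      then have "emeasure (mu \<Omega> u \<gamma>) ?E \<le> emeasure ?\<nu> (\<Union>j. S j)"
        using wt(1) S by (intro mu_le_weighted_pair_measure op U) (auto simp: weight_def)
      also have "\<dots> \<le> (\<Sum>j. emeasure ?\<nu> (S j))"
        by (rule emeasure_subadditive_countably) auto
      also have "\<dots> \<le> (\<Sum>j. ?A * ?X * ennreal (C2 * C1 * c powr - p * (D / t) powr p * q ^ j))"
      proof (intro suminf_le summableI)
        fix j
        \<comment> \<open>A bad cube carries gradient mass inside \<Omega>, so its weight is not the
          default value attached to null cubes and the ball bound is available.\<close>
        have null: "snd r \<inter> \<Omega> \<notin> null_sets lebesgue" if "r \<in> Bad j" for r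
        proof (rule not_null_of_integral_pos)
          show "ennreal (g x) = 0" if "x \<notin> \<Omega>" for x using that by (simp add: g_def)
          have "0 < ennreal (s j * 2 powr (real_of_int (fst r) * (\<theta> / p)))" using s[of j] by simp
          also have "\<dots> \<le> (\<integral>\<^sup>+x. ennreal (g x) * indicator (snd r) x \<partial>lebesgue)"
            using that by (simp add: Bad_def)
          finally show "0 < (\<integral>\<^sup>+x. ennreal (g x) * indicator (snd r) x \<partial>lebesgue)" .
        qed
        show "emeasure ?\<nu> (S j) \<le> ?A * ?X * ennreal (C2 * C1 * c powr - p * (D / t) powr p * q ^ j)"
          unfolding S_def
        proof (rule emeasure_UN_le_finite_sums)
          show "countable (Bad j)" by (rule countable_subset[OF Bad countable_cubes])
        next
          fix F assume F: "finite F" "F \<subseteq> Bad j"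
          let ?m = "\<lambda>r. ennreal (2 powr (real_of_int (fst r) * \<theta>) * cube_weight p \<Omega> w (snd r))"
          let ?b = "C2 * 2 powr (real j * (\<theta> - d))"
          have b0: "0 \<le> ?b" using C2 by simp
          have "(\<Sum>r\<in>F. emeasure ?\<nu> (dyadic_piece \<rho> (fst r) j (pt r))) \<le> (\<Sum>r\<in>F. ?A * (ennreal ?b * ?m r))"
          proof (rule sum_mono)
            fix r assume "r \<in> F"
            then have r: "r \<in> Bad j" "r \<in> cubes" using F Bad by auto
            have "emeasure ?\<nu> (dyadic_piece \<rho> (fst r) j (pt r))
              \<le> ?A * ennreal (?b * (2 powr (real_of_int (fst r) * \<theta>) * cube_weight p \<Omega> w (snd r)))"
              unfolding C2_def \<theta>_def d_def
              by (rule weighted_dyadic_piece[OF p op Ap U])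
                (use r pt[OF r(2)] null[OF r(1)] d in \<open>auto simp: \<rho>_def d_def\<close>)
            then show "emeasure ?\<nu> (dyadic_piece \<rho> (fst r) j (pt r)) \<le> ?A * (ennreal ?b * ?m r)"
              using b0 by (simp only: ennreal_mult cube_weight_nonneg powr_ge_zero mult_nonneg_nonneg)
          qed
          also have "\<dots> = ?A * ennreal ?b * (\<Sum>r\<in>F. ?m r)"
            by (simp only: sum_distrib_left mult.assoc)
          also have "\<dots> \<le> ?A * ennreal ?b * (ennreal (C1 * s j powr - p) * (\<integral>\<^sup>+x. ennreal (g x powr p * w x) \<partial>lebesgue_on \<Omega>))"
            using F Bad[of j] g s[of j]
            by (intro mult_left_mono sum_le op wt(2)) (auto simp: g_def Bad_def)
          also have "(\<integral>\<^sup>+x. ennreal (g x powr p * w x) \<partial>lebesgue_on \<Omega>) = ?X"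
            by (intro nn_integral_cong) (simp add: g_def)
          also have "?A * ennreal ?b * (ennreal (C1 * s j powr - p) * ?X) = ?A * ?X * ennreal (?b * (C1 * s j powr - p))"
            using b0 C1 by (simp only: ennreal_mult powr_ge_zero mult_nonneg_nonneg) (simp only: mult_ac)
          also have "?b * (C1 * s j powr - p) = C2 * C1 * c powr - p * (D / t) powr p * q ^ j"
          proof -
            have "(t / D) powr - p = (D / t) powr p"
              using t D0 by (simp add: powr_minus_divide powr_divide)
            then have "s j powr - p = c powr - p * (D / t) powr p * 2 powr (real j * (\<kappa> - (d - 1) - \<delta>) * - p)"
              by (simp only: s_def powr_mult powr_powr)
            then have "?b * (C1 * s j powr - p) = C2 * C1 * c powr - p * (D / t) powr p
              * (2 powr (real j * (\<theta> - d)) * 2 powr (real j * (\<kappa> - (d - 1) - \<delta>) * - p))"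
              by simp
            \<comment> \<open>The growth 2^(j(\<theta>-d)) of the measure of the pieces meets the
              p-th power of the thresholds: of the gap 2\<epsilon>, the part p\<delta> = \<epsilon>
              is used up and 2^(-\<epsilon>j) remains.\<close>
            also have "2 powr (real j * (\<theta> - d)) * 2 powr (real j * (\<kappa> - (d - 1) - \<delta>) * - p) = 2 powr (- \<epsilon> * real j)"
            proof -
              have "(\<kappa> - (d - 1) - \<delta>) * p = \<theta> - p * (d - 1) - \<epsilon>"
                using p by (simp add: \<kappa>_def \<delta>_def algebra_simps)
              then have "\<theta> - d - (\<kappa> - (d - 1) - \<delta>) * p = - \<epsilon>" by (simp add: \<epsilon>_def field_simps)
              then have "real j * (\<theta> - d) + real j * (\<kappa> - (d - 1) - \<delta>) * - p = - \<epsilon> * real j"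
                by (metis (no_types, opaque_lifting) mult.assoc mult.commute mult_minus_right right_diff_distrib uminus_add_conv_diff add.commute)
              then show ?thesis by (simp only: powr_add [symmetric])
            qed
            also have "2 powr (- \<epsilon> * real j) = q ^ j"
              using q(1) by (simp only: q_def powr_powr [symmetric] powr_realpow)
            finally show ?thesis .
          qed
          finally show "(\<Sum>r\<in>F. emeasure ?\<nu> (dyadic_piece \<rho> (fst r) j (pt r)))
            \<le> ?A * ?X * ennreal (C2 * C1 * c powr - p * (D / t) powr p * q ^ j)" .
        qed simp
      qed
      also have "\<dots> = ?A * ?X * ennreal (C2 * C1 * c powr - p * (D / t) powr p / (1 - q))"
      proof -
        let ?K = "C2 * C1 * c powr - p * (D / t) powr p"
        have "(\<Sum>j. ennreal (?K * q ^ j)) = ennreal (?K / (1 - q))"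
          using C1 C2 q by (subst suminf_ennreal2) (auto simp: suminf_mult suminf_geometric intro!: summable_mult summable_geometric)
        then show ?thesis by simp
      qed
      also have "C2 * C1 * c powr - p * (D / t) powr p / (1 - q) = C * (D / t) powr p"
        by (simp add: C_def)
      also have "?A * ?X * ennreal (C * (D / t) powr p) = ennreal C * ?A * ennreal ((D / t) powr p) * ?X"
        using C0 by (simp only: ennreal_mult powr_ge_zero) (simp only: mult_ac)
      also have "ennreal ((D / t) powr p) = epowr (ball_deviation \<Omega> / ennreal t) p"
        using p t D0 by (simp add: D divide_ennreal epowr_def)
      finally show ?thesis .
    qed simp
  qed
qed

end
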